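(* Let $r=p^*$. Then there exists $\Lambda>0$ such that for all $\lambda\in(0,\Lambda)$ and all $\beta>0$, problem $(P_\lambda)$ admits at least one weak solution.
   Context: Setting: $\Omega\subset\mathbb{R}^n$ is a bounded domain with smooth boundary, $n>p$, $1<q<p<r\le p^*$ with $p^*=\frac{np}{n-p}$, $0<\delta<1$, and $\lambda,\beta>0$ are parameters. $\Delta_m u=\nabla\cdot(|\nabla u|^{m-2}\nabla u)$. Problem $(P_\lambda)$ is $$-\Delta_p u-\beta\Delta_q u=\lambda u^{-\delta}+u^{r-1},\quad u>0 \text{ in }\Omega,\qquad u=0\text{ on }\partial\Omega.$$ A function $u\in W^{1,p}_0(\Omega)$ is a weak solution of $(P_\lambda)$ if $u>0$ a.e. in $\Omega$ and $\int_\Omega\big(|\nabla u|^{p-2}\nabla u\cdot\nabla\phi+\beta|\nabla u|^{q-2}\nabla u\cdot\nabla\phi-\lambda u^{-\delta}\phi-u^{r-1}\phi\big)dx=0$ for all $\phi\in W^{1,p}_0(\Omega)$. *)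

theory Defs
  imports "HOL-Analysis.Analysis"
begin

primrec Ck :: "nat \<Rightarrow> ('a::euclidean_space \<Rightarrow> real) \<Rightarrow> bool" where
  "Ck 0 f \<longleftrightarrow> continuous_on UNIV f"
| "Ck (Suc k) f \<longleftrightarrow>
     (\<forall>x. f differentiable (at x)) \<and> (\<forall>v. Ck k (\<lambda>x. frechet_derivative f (at x) v))"

definition smooth :: "('a::euclidean_space \<Rightarrow> real) \<Rightarrow> bool" where
  "smooth f \<longleftrightarrow> (\<forall>k. Ck k f)"

(* Near each of its boundary points the set is the strict epigraph of a smooth function of the
   n - 1 variables orthogonal to a unit vector e. The function g is total on the whole space, but
   it is only evaluated at the orthogonal projection of x onto the hyperplane orthogonal to e. *)
definition smooth_boundary :: "'a::euclidean_space set \<Rightarrow> bool" where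
  "smooth_boundary \<Omega> \<longleftrightarrow>
     (\<forall>z\<in>frontier \<Omega>. \<exists>s>0. \<exists>e g. norm e = 1 \<and> smooth g \<and>
        \<Omega> \<inter> ball z s = {x \<in> ball z s. g (x - (x \<bullet> e) *\<^sub>R e) < x \<bullet> e})"

definition bounded_smooth_domain :: "'a::euclidean_space set \<Rightarrow> bool" where
  "bounded_smooth_domain \<Omega> \<longleftrightarrow>
     open \<Omega> \<and> connected \<Omega> \<and> \<Omega> \<noteq> {} \<and> bounded \<Omega> \<and> smooth_boundary \<Omega>"

definition test_function :: "'a::euclidean_space set \<Rightarrow> ('a \<Rightarrow> real) \<Rightarrow> bool" where
  "test_function \<Omega> \<phi> \<longleftrightarrow>
     smooth \<phi> \<and> compact (closure {x. \<phi> x \<noteq> 0}) \<and> closure {x. \<phi> x \<noteq> 0} \<subseteq> \<Omega>"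

definition grad :: "('a::euclidean_space \<Rightarrow> real) \<Rightarrow> 'a \<Rightarrow> 'a" where
  "grad f x = (\<Sum>b\<in>Basis. frechet_derivative f (at x) b *\<^sub>R b)"

definition locally_integrable_on ::
  "('a::euclidean_space \<Rightarrow> 'b::euclidean_space) \<Rightarrow> 'a set \<Rightarrow> bool" where
  "locally_integrable_on f \<Omega> \<longleftrightarrow> (\<forall>K. compact K \<and> K \<subseteq> \<Omega> \<longrightarrow> f absolutely_integrable_on K)"

definition is_weak_grad ::
  "'a::euclidean_space set \<Rightarrow> ('a \<Rightarrow> real) \<Rightarrow> ('a \<Rightarrow> 'a) \<Rightarrow> bool" where
  "is_weak_grad \<Omega> u g \<longleftrightarrow>
     locally_integrable_on u \<Omega> \<and> locally_integrable_on g \<Omega> \<and>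
     (\<forall>\<phi>. test_function \<Omega> \<phi> \<longrightarrow>
        (LINT x|lebesgue_on \<Omega>. u x *\<^sub>R grad \<phi> x) = - (LINT x|lebesgue_on \<Omega>. \<phi> x *\<^sub>R g x))"

(* Weak gradients are determined up to null subsets of the domain; the choice of representative
   does not affect the notions below. The value is meaningful only if a weak gradient exists. *)
definition weak_grad :: "'a::euclidean_space set \<Rightarrow> ('a \<Rightarrow> real) \<Rightarrow> 'a \<Rightarrow> 'a" where
  "weak_grad \<Omega> u = (SOME g. is_weak_grad \<Omega> u g)"

definition Lp :: "real \<Rightarrow> 'a::euclidean_space set \<Rightarrow> ('a \<Rightarrow> 'b::euclidean_space) set" where
  "Lp p \<Omega> = {f. f \<in> borel_measurable (lebesgue_on \<Omega>) \<and>
                integrable (lebesgue_on \<Omega>) (\<lambda>x. norm (f x) powr p)}"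

(* Elements are functions on the whole space, of which only the values on the domain matter. *)
definition W1p :: "real \<Rightarrow> 'a::euclidean_space set \<Rightarrow> ('a \<Rightarrow> real) set" where
  "W1p p \<Omega> = {u \<in> Lp p \<Omega>. (\<exists>g. is_weak_grad \<Omega> u g) \<and> weak_grad \<Omega> u \<in> Lp p \<Omega>}"

definition W1p_norm :: "real \<Rightarrow> 'a::euclidean_space set \<Rightarrow> ('a \<Rightarrow> real) \<Rightarrow> real" where
  "W1p_norm p \<Omega> u =
     (LINT x|lebesgue_on \<Omega>. \<bar>u x\<bar> powr p + norm (weak_grad \<Omega> u x) powr p) powr (1 / p)"

(* The closure of the test functions in the Sobolev space W1p. *)
definition W1p0 :: "real \<Rightarrow> 'a::euclidean_space set \<Rightarrow> ('a \<Rightarrow> real) set" where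
  "W1p0 p \<Omega> = {u \<in> W1p p \<Omega>. \<exists>\<phi>. (\<forall>k::nat. test_function \<Omega> (\<phi> k)) \<and>
                 (\<lambda>k. W1p_norm p \<Omega> (\<lambda>x. u x - \<phi> k x)) \<longlonglongrightarrow> 0}"

definition critical_exponent :: "nat \<Rightarrow> real \<Rightarrow> real" where
  "critical_exponent n p = real n * p / (real n - p)"

(* has_bochner_integral demands integrability of the integrand, so the identity cannot hold
   merely because the integral of a non-integrable function is 0 by convention. Since
   0 powr a = 0, the field |Du|^(p-2) Du is 0 wherever Du = 0, also for p < 2. *)
definition weak_solution ::
  "'a::euclidean_space set \<Rightarrow> real \<Rightarrow> real \<Rightarrow> real \<Rightarrow> real \<Rightarrow> real \<Rightarrow> real \<Rightarrow> ('a \<Rightarrow> real) \<Rightarrow> bool" where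
  "weak_solution \<Omega> p q r \<delta> lam \<beta> u \<longleftrightarrow>
     u \<in> W1p0 p \<Omega> \<and> (AE x in lebesgue_on \<Omega>. u x > 0) \<and>
     (\<forall>\<phi>\<in>W1p0 p \<Omega>. has_bochner_integral (lebesgue_on \<Omega>)
        (\<lambda>x. (norm (weak_grad \<Omega> u x) powr (p - 2) *\<^sub>R weak_grad \<Omega> u x) \<bullet> weak_grad \<Omega> \<phi> x
           + \<beta> * ((norm (weak_grad \<Omega> u x) powr (q - 2) *\<^sub>R weak_grad \<Omega> u x) \<bullet> weak_grad \<Omega> \<phi> x)
           - lam * u x powr (- \<delta>) * \<phi> x - u x powr (r - 1) * \<phi> x) 0)"

end

theory Submission
  imports Defs
begin

text \<open>
  Small parameters allow a route that avoids the loss of compactness at the critical exponent.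
  For a fixed bounded right-hand side \<open>h \<ge> 0\<close> the functional
  \<open>\<integral> |Du|\<^sup>p/p + \<beta> |Du|\<^sup>q/q - \<lambda>/(1-\<delta>) u\<^sup>1\<^sup>-\<^sup>\<delta> - h u\<close> is strictly convex on the cone of nonnegative
  functions, because \<open>-u\<^sup>1\<^sup>-\<^sup>\<delta>\<close> is convex there. Uniform convexity makes minimizing sequences Cauchy,
  so a unique minimizer exists; it is positive almost everywhere and solves the equation with
  right-hand side \<open>\<lambda> u\<^sup>-\<^sup>\<delta> + h\<close>. Minimizers increase with \<open>h\<close> and lie below supersolutions.
  The function \<open>w = a (2 + arctan (x \<bullet> e + c))\<close> has \<open>-\<Delta>\<^sub>q w \<ge> 0\<close> and \<open>-\<Delta>\<^sub>p w\<close> of order \<open>a\<^sup>p\<^sup>-\<^sup>1\<close>, which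
  exceeds \<open>\<lambda> w\<^sup>-\<^sup>\<delta> + w\<^sup>r\<^sup>-\<^sup>1\<close> for a suitable small \<open>a\<close> and all small \<open>\<lambda>\<close>, uniformly in \<open>\<beta>\<close>, since
  \<open>r > p\<close>. Hence the iteration \<open>h = u\<^sup>r\<^sup>-\<^sup>1\<close> started at \<open>0\<close> increases, stays bounded, and converges to a
  bounded weak solution.
\<close>

section \<open>Norm powers and their convexity\<close>

text \<open>Critical growth permits concentrating sequences, which obstructs a direct variational
  treatment of the full problem. Freezing the power as a bounded source \<open>h\<close> removes it
  from the functional: \<open>h\<close> times any element of \<open>W1p0\<close> is integrable, and
  limits are taken by dominated or monotone convergence. The bound survives the iteration because a
  source below \<open>(4 * a) powr (r - 1)\<close> yields a minimizer below \<open>4 * a\<close>. A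
  second obstacle is that \<open>u powr (- \<delta>)\<close> may be singular, so the energy cannot
  simply be differentiated at \<open>u\<close>. It is varied at \<open>u + t * \<phi>\<close> with
  \<phi> \<ge> 0 and t > 0 only; the other half of the equation comes from the scaling
  \<open>t * u\<close>, which is admissible on both sides of t = 1. One balance fixes the size of
  the barrier: \<open>a powr (p - 1) * c0\<close> has to pay for \<open>(4 * a) powr (r - 1)\<close>
  and for \<open>lam * a powr (- \<delta>)\<close>. The choice of \<open>a\<close> makes the first
  cost exactly half, and \<open>lam < \<Lambda>\<close> keeps the second below the other half. The
  q-part of the operator contributes a nonnegative multiple of \<beta>, so \<Lambda> does not depend
  on \<beta>.\<close>

lemma one_add_less_exp:
  fixes t :: real
  assumes "t \<noteq> 0"
  shows "1 + t < exp t"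
proof (cases "1 + t > 0")
  case True
  then have "ln (1 + t) \<noteq> t" using assms ln_eq_minus_one[of "1+t"] by auto
  moreover have "ln (1 + t) \<le> t" using True ln_le_minus_one[of "1+t"] by simp
  ultimately have "ln (1+t) < t" by simp
  then show ?thesis using True by (metis exp_less_mono exp_ln)
next
  case False
  then show ?thesis using exp_gt_zero[of t] by linarith
qed

lemma powr_less_tangent:
  fixes x a :: real
  assumes "0 < a" "a < 1" "0 \<le> x" "x \<noteq> 1"
  shows "x powr a < 1 + a * (x - 1)"
proof (cases "x = 0")
  case False
  then have x: "x > 0" using assms by simp
  define s where "s = ln x"
  have s: "s \<noteq> 0" "x = exp s" using x assms by (auto simp: s_def)
  have e: "exp (a * s) * exp ((1-a) * s) = x"
    unfolding s exp_add[symmetric] by (simp add: algebra_simps)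
  have e': "exp (a * s) * exp (- (a * s)) = 1" by (simp add: exp_minus)
  \<comment> \<open>With x = exp s, the exponential at \<open>(1-a) * s\<close> and at
    \<open>- (a * s)\<close> is bounded below by its tangent at 0. Multiplied by
    \<open>exp (a * s)\<close> and weighted with a and 1 - a, the terms linear in s cancel, which
    leaves \<open>exp (a * s) < a * x + (1 - a)\<close>.\<close>
  have "1 + (1-a) * s < exp ((1-a) * s)" using s assms by (intro one_add_less_exp) auto
  then have 1: "a * (exp (a * s) * (1 + (1-a) * s)) < a * x"
    using assms e by (metis exp_gt_zero mult_strict_left_mono)
  have "1 + (-(a * s)) \<le> exp (-(a * s))" by (rule exp_ge_add_one_self)
  then have "exp (a * s) * (1 + (-(a * s))) \<le> 1"
    using e' by (metis exp_ge_zero mult_left_mono)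
  then have 2: "(1-a) * (exp (a * s) * (1 + (-(a * s)))) \<le> (1-a) * 1"
    using assms by (intro mult_left_mono) auto
  have "x powr a = exp (a * s)" using x by (simp add: powr_def s_def)
  then show ?thesis using 1 2 by (simp add: algebra_simps)
qed (use assms in auto)

text \<open>Homogeneity reduces this to the tangent at 1. With \<open>a = 1 - \<delta>\<close> the
  slope is \<open>(1 - \<delta>) * s powr (- \<delta>)\<close>; this is how the singular term enters
  every energy estimate. The value t = 0 is allowed, only the base point must be positive.\<close>

lemma powr_tangent_concave:
  fixes s t a :: real
  assumes "0 < a" "a < 1" "0 < s" "0 \<le> t"
  shows "t powr a \<le> s powr a + a * s powr (a - 1) * (t - s)"
proof -
  have "(t/s) powr a \<le> 1 + a * (t/s - 1)"
    using powr_less_tangent[of a "t/s"] assms by (cases "t/s = 1") auto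
  then have "s powr a * (t/s) powr a \<le> s powr a * (1 + a * (t/s - 1))"
    by (intro mult_left_mono) auto
  moreover have "s powr a * (t/s) powr a = t powr a"
    using assms by (simp add: powr_divide)
  ultimately have "t powr a \<le> s powr a + a * (s powr a / s) * (t - s)"
    using assms by (simp add: field_simps)
  then show ?thesis using assms by (simp add: powr_diff)
qed

text \<open>The strict Young inequality for the exponents p and p/(p-1), obtained by applying the
  strict concave bound with exponent 1/p to \<open>(t/s) powr p\<close>. Strictness is what later
  identifies the equality case.\<close>

lemma powr_tangent_convex_strict:
  fixes s t p :: real
  assumes "1 < p" "0 < s" "0 \<le> t" "t \<noteq> s"
  shows "p * s powr (p - 1) * t < (p - 1) * s powr p + t powr p"
proof -
  define y where "y = (t/s) powr p"
  have y: "y powr (1/p) = t/s" using assms by (simp add: y_def powr_powr)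
  then have "y \<noteq> 1" using assms by auto
  then have "y powr (1/p) < 1 + (1/p) * (y - 1)"
    using assms by (intro powr_less_tangent) (auto simp: y_def)
  then have "p * (t/s) < p * (1 + (1/p) * (y - 1))" using y assms by (intro mult_strict_left_mono) auto
  also have "\<dots> = (p - 1) + y" using assms by (simp add: distrib_left)
  finally have "p * (t/s) < (p - 1) + y" .
  then have "s powr p * (p * (t/s)) < s powr p * ((p - 1) + y)"
    using assms by (intro mult_strict_left_mono) auto
  moreover have "s powr p * y = t powr p" using assms by (simp add: y_def powr_divide)
  moreover have "s powr p = s powr (p-1) * s"
    using assms powr_mult_base[of s "p-1"] by (simp add: mult.commute)
  ultimately show ?thesis using assms by (simp add: field_simps)
qed

lemma powr_tangent_convex:
  fixes s t p :: real
  assumes "1 < p" "0 \<le> s" "0 \<le> t"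
  shows "p * s powr (p - 1) * t \<le> (p - 1) * s powr p + t powr p"
proof (cases "s = 0 \<or> t = s")
  case True
  moreover have "s powr p = s powr (p-1) * s"
    using assms powr_mult_base[of s "p-1"] by (simp add: mult.commute)
  ultimately show ?thesis by (auto simp: algebra_simps)
qed (use powr_tangent_convex_strict[of p s t] assms in auto)

text \<open>Whichever of y and \<open>\<eta> * x\<close> is larger absorbs the whole product, so no
  sharp constants arise. The free parameter serves to hide one of the two powers in a left-hand
  side.\<close>

lemma powr_mult_le_eta:
  fixes x y p \<eta> :: real
  assumes "1 < p" "0 \<le> x" "0 \<le> y" "0 < \<eta>"
  shows "x powr (p - 1) * y \<le> \<eta> * x powr p + \<eta> powr (1 - p) * y powr p"
proof (cases "y \<le> \<eta> * x")
  case True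
  then have "x powr (p-1) * y \<le> x powr (p-1) * (\<eta> * x)" by (intro mult_left_mono) auto
  also have "\<dots> = \<eta> * x powr p" using assms powr_mult_base[of x "p-1"] by (simp add: mult_ac)
  finally show ?thesis by (simp add: add_increasing2)
next
  case False
  then have "x \<le> y / \<eta>" using assms by (simp add: field_simps)
  then have "x powr (p-1) * y \<le> (y/\<eta>) powr (p-1) * y"
    using assms by (intro mult_right_mono powr_mono2) auto
  also have "\<dots> = \<eta> powr (1-p) * y powr p" using assms powr_mult_base[of y "p-1"]
    by (simp add: powr_divide field_simps flip: powr_add powr_minus)
  finally show ?thesis using assms by (simp add: add_increasing)
qed

lemma powr_mult_le:
  fixes x y p :: real
  assumes "1 < p" "0 \<le> x" "0 \<le> y"
  shows "x powr (p - 1) * y \<le> x powr p + y powr p"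
  using powr_mult_le_eta[of p x y 1] assms by simp

lemma powr_le_one_plus:
  fixes x m p :: real
  assumes "0 \<le> m" "m \<le> p" "0 \<le> x"
  shows "x powr m \<le> 1 + x powr p"
proof (cases "x \<le> 1")
  case True
  then have "x powr m \<le> 1" using assms by (intro powr_le1) auto
  then show ?thesis by (simp add: add_increasing2)
next
  case False
  then have "x powr m \<le> x powr p" using assms by (intro powr_mono) auto
  then show ?thesis by simp
qed

lemma le_eta_powr:
  fixes x p \<eta> :: real
  assumes "1 < p" "0 < \<eta>" "0 \<le> x"
  shows "x \<le> \<eta> * x powr p + \<eta> powr (1 / (1 - p))"
proof (cases "x \<le> \<eta> powr (1/(1-p))")
  case False
  have e: "(p - 1) / (1 - p) = -1" using assms by (simp add: field_simps)
  \<comment> \<open>The additive constant is the solution x of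
    \<open>\<eta> * x powr (p-1) = 1\<close>; beyond it x is dominated by
    \<open>\<eta> * x powr p\<close>.\<close>
  have "\<eta> * (\<eta> powr (1/(1-p))) powr (p-1) = \<eta> * \<eta> powr (-1)"
    using e by (simp add: powr_powr)
  also have "\<dots> = 1" using assms by (simp add: powr_minus)
  finally have 1: "\<eta> * (\<eta> powr (1/(1-p))) powr (p-1) = 1" .
  have "(\<eta> powr (1/(1-p))) powr (p-1) \<le> x powr (p-1)"
    using False assms by (intro powr_mono2) auto
  then have "1 \<le> \<eta> * x powr (p-1)" using assms 1 by (metis less_imp_le mult_left_mono)
  then have "x * 1 \<le> x * (\<eta> * x powr (p-1))" using assms by (intro mult_left_mono) auto
  also have "\<dots> = \<eta> * x powr p" using assms powr_mult_base[of x "p-1"] by (simp add: mult_ac)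
  finally show ?thesis using assms by (simp add: add_increasing2)
qed (use assms in \<open>simp add: add_increasing\<close>)

text \<open>This crude bound stands in for the triangle inequality of the p-norm: integrals of p-th
  powers are handled directly, without roots, at the price of a factor
  \<open>2 powr p\<close>.\<close>

lemma norm_add_powr_le:
  fixes a b :: "'a::real_normed_vector"
  assumes "0 \<le> p"
  shows "norm (a + b) powr p \<le> 2 powr p * (norm a powr p + norm b powr p)"
proof -
  have "norm (a + b) powr p \<le> (2 * max (norm a) (norm b)) powr p"
    using norm_triangle_ineq[of a b] assms by (intro powr_mono2) auto
  also have "\<dots> = 2 powr p * max (norm a) (norm b) powr p" by (simp add: powr_mult)
  also have "\<dots> \<le> 2 powr p * (norm a powr p + norm b powr p)"
    by (intro mult_left_mono) (auto simp: max_def)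
  finally show ?thesis .
qed

section \<open>The field |a|^(p-2) a and the convexity of |a|^p\<close>

definition flux :: "real \<Rightarrow> 'a::euclidean_space \<Rightarrow> 'a" where
  "flux p a = norm a powr (p - 2) *\<^sub>R a"

lemma norm_flux: "norm (flux p a) = norm a powr (p - 1)"
  using powr_mult_base[of "norm a" "p-2"] by (simp add: flux_def mult.commute)

lemma flux_0 [simp]: "flux p 0 = 0"
  by (simp add: flux_def)

lemma flux_inner_self: "flux p a \<bullet> a = norm a powr p"
proof (cases "a = 0")
  case False
  have "flux p a \<bullet> a = norm a powr (p-2) * norm a powr 2"
    using False by (simp add: flux_def power2_norm_eq_inner)
  then show ?thesis unfolding powr_add[symmetric] by simp
qed simp

lemma flux_scaleR: "0 < c \<Longrightarrow> flux p (c *\<^sub>R a) = c powr (p - 1) *\<^sub>R flux p a"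
  using powr_mult_base[of c "p-2"] by (simp add: flux_def powr_mult mult_ac)

lemma flux_inner_le: "\<bar>flux p a \<bullet> b\<bar> \<le> norm a powr (p - 1) * norm b"
  using Cauchy_Schwarz_ineq2[of "flux p a" b] by (simp add: norm_flux)

lemma flux_inner_bound: "1 < p \<Longrightarrow> \<bar>flux p a \<bullet> b\<bar> \<le> norm a powr p + norm b powr p"
  using flux_inner_le[of p a b] powr_mult_le[of p "norm a" "norm b"] by force

text \<open>Cauchy-Schwarz reduces the claim to Young's inequality for the two norms. Since
  \<open>p * flux p a\<close> corresponds to the gradient of |a|^p, this is the tangent inequality
  of a convex function, and it replaces differentiation under the integral in the sequel.\<close>

lemma flux_tangent:
  assumes "1 < p"
  shows "norm a powr p + p * (flux p a \<bullet> (b - a)) \<le> norm b powr p"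
proof -
  have "p * (flux p a \<bullet> b) \<le> p * (norm a powr (p-1) * norm b)"
    using flux_inner_le[of p a b] assms by (intro mult_left_mono) auto
  also have "\<dots> \<le> (p - 1) * norm a powr p + norm b powr p"
    using powr_tangent_convex[of p "norm a" "norm b"] assms by (simp add: mult.assoc)
  finally show ?thesis by (simp add: inner_diff_right flux_inner_self algebra_simps)
qed

text \<open>Equality must hold in both inequalities behind \<open>flux_tangent\<close>: in Young's,
  which forces equal norms, and then in Cauchy-Schwarz, which forces the inner product of a and b to
  be |a|^2. Together they give |b - a| = 0, that is, strict convexity.\<close>

lemma flux_tangent_eqD:
  assumes "1 < p" and eq: "norm a powr p + p * (flux p a \<bullet> (b - a)) = norm b powr p"
  shows "b = a"
proof (cases "a = 0")
  case False
  have fi: "flux p a \<bullet> b = norm a powr (p-2) * (a \<bullet> b)" by (simp add: flux_def)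
  have eq': "p * (flux p a \<bullet> b) = (p - 1) * norm a powr p + norm b powr p"
    using eq by (simp add: inner_diff_right flux_inner_self algebra_simps)
  have le: "p * (flux p a \<bullet> b) \<le> p * norm a powr (p-1) * norm b"
    using flux_inner_le[of p a b] assms by simp
  have nb: "norm b = norm a"
    using powr_tangent_convex_strict[of p "norm a" "norm b"] assms False eq' le by force
  have "p * (flux p a \<bullet> b) = p * norm a powr p" unfolding eq' nb by (simp add: algebra_simps)
  then have "norm a powr (p-2) * (a \<bullet> b) = norm a powr p" using assms fi by simp
  also have "\<dots> = norm a powr (p-2) * (norm a powr 2)" unfolding powr_add[symmetric] by simp
  finally have "a \<bullet> b = norm a powr 2" using False by simp
  then have ab: "a \<bullet> b = a \<bullet> a" using False by (simp add: power2_norm_eq_inner)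
  have "b \<bullet> b = a \<bullet> a" using nb by (metis power2_norm_eq_inner)
  then have "(b - a) \<bullet> (b - a) = 0" using ab by (simp add: inner_diff inner_commute)
  then show ?thesis by simp
qed (use eq in auto)

lemma continuous_flux: "1 < p \<Longrightarrow> continuous_on UNIV (flux p)"
proof (rule continuous_at_imp_continuous_on, rule ballI)
  fix a :: 'a assume p: "1 < p"
  show "isCont (flux p) a"
  proof (cases "a = 0")
    case True
    \<comment> \<open>For p < 2 the scalar factor of the flux blows up at the origin, so continuity
      there is read off from the norm of the flux, whose exponent p - 1 is positive.\<close>
    have "((\<lambda>x::'a. norm x powr (p-1)) \<longlongrightarrow> 0) (at 0)"
      by (rule tendsto_zero_powrI[where b="p-1"]) (use p in \<open>auto intro!: tendsto_eq_intros\<close>)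
    then have "((\<lambda>x::'a. norm (flux p x)) \<longlongrightarrow> 0) (at 0)" by (simp add: norm_flux)
    then show ?thesis unfolding True isCont_def by (simp add: tendsto_norm_zero_iff)
  qed (auto simp: flux_def[abs_def] intro!: continuous_intros)
qed

section \<open>Uniform convexity of |a|^p, measured by the deficit in midpoint convexity\<close>

definition midgap :: "real \<Rightarrow> 'a::euclidean_space \<Rightarrow> 'a \<Rightarrow> real" where
  "midgap p a b = (norm a powr p + norm b powr p) / 2 - norm ((1/2) *\<^sub>R (a + b)) powr p"

text \<open>Measured from the midpoint, a and b lie in opposite directions, so the linear terms
  cancel and the deficit becomes half the sum of two tangent gaps. Each gap is nonnegative and
  vanishes only at the base point, which settles both sign and zero set of
  \<open>midgap\<close>.\<close>

lemma midgap_split: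
  fixes a b :: "'a::euclidean_space"
  defines "m \<equiv> (1/2) *\<^sub>R (a + b)"
  shows "2 * midgap p a b = (norm a powr p - norm m powr p - p * (flux p m \<bullet> (a - m)))
     + (norm b powr p - norm m powr p - p * (flux p m \<bullet> (b - m)))"
proof -
  have "(a - m) = - (b - m)"
    unfolding m_def by (simp add: euclidean_eq_iff[where 'a='a] inner_simps field_simps)
  then have "flux p m \<bullet> (a - m) = - (flux p m \<bullet> (b - m))" by (simp only: inner_minus_right)
  then show ?thesis by (simp add: midgap_def m_def)
qed

lemma midgap_nonneg: "1 < p \<Longrightarrow> 0 \<le> midgap p a b"
  using midgap_split[of p a b] flux_tangent[of p "(1/2) *\<^sub>R (a + b)" a]
    flux_tangent[of p "(1/2) *\<^sub>R (a + b)" b] by simp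

lemma midgap_eq_0D:
  assumes "1 < p" "midgap p a b = 0"
  shows "a = b"
proof -
  define m where "m = (1/2) *\<^sub>R (a + b)"
  have sp: "2 * midgap p a b = (norm a powr p - norm m powr p - p * (flux p m \<bullet> (a - m)))
     + (norm b powr p - norm m powr p - p * (flux p m \<bullet> (b - m)))"
    unfolding m_def by (rule midgap_split)
  have "a = m"
    by (rule flux_tangent_eqD[OF assms(1)])
       (use sp assms(2) flux_tangent[OF assms(1), of m a] flux_tangent[OF assms(1), of m b] in linarith)
  moreover have "b = m"
    by (rule flux_tangent_eqD[OF assms(1)])
       (use sp assms(2) flux_tangent[OF assms(1), of m a] flux_tangent[OF assms(1), of m b] in linarith)
  ultimately show ?thesis by simp
qed

lemma midgap_scaleR: "0 \<le> t \<Longrightarrow> midgap p (t *\<^sub>R a) (t *\<^sub>R b) = t powr p * midgap p a b"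
proof -
  assume t: "0 \<le> t"
  have "(1/2) *\<^sub>R (t *\<^sub>R a + t *\<^sub>R b) = t *\<^sub>R ((1/2) *\<^sub>R (a + b))"
    by (simp add: scaleR_add_right)
  then show ?thesis using t
    by (simp only: midgap_def norm_scaleR powr_mult abs_of_nonneg) (simp add: algebra_simps add_divide_distrib)
qed

text \<open>By homogeneity it suffices to consider pairs in the unit ball, where compactness turns the
  strict convexity of the norm power into a positive lower bound of the midpoint gap.\<close>

lemma norm_diff_powr_le_midgap:
  assumes p: "1 < p" and \<eta>: "0 < \<eta>"
  shows "\<exists>C\<ge>0. \<forall>a b :: 'a::euclidean_space.
     norm (a - b) powr p \<le> \<eta> * (norm a powr p + norm b powr p) + C * midgap p a b"
proof -
  \<comment> \<open>Pairs in the unit ball that stay \<open>\<eta> powr (1/p)\<close> apart. On them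
    the gap has a positive minimum d; closer pairs are paid for by the \<eta>-term alone. Distances
    in the ball are at most 2, whence the constant \<open>2 powr p / d\<close>.\<close>
  define K :: "('a \<times> 'a) set" where
    "K = (cball 0 1 \<times> cball 0 1) \<inter> {z. \<eta> powr (1/p) \<le> norm (fst z - snd z)}"
  have "compact K" unfolding K_def
    by (intro compact_Int_closed compact_Times closed_Collect_le continuous_intros) auto
  have cont: "continuous_on S (\<lambda>z. midgap p (fst z) (snd z))" for S :: "('a \<times> 'a) set"
    unfolding midgap_def using p by (intro continuous_intros continuous_on_powr') auto
  have "\<exists>d>0. \<forall>z\<in>K. d \<le> midgap p (fst z) (snd z)"
  proof (cases "K = {}")
    case False
    obtain z where z: "z \<in> K" "\<forall>y\<in>K. midgap p (fst z) (snd z) \<le> midgap p (fst y) (snd y)"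
      using continuous_attains_inf[OF \<open>compact K\<close> False cont] by blast
    have "\<eta> powr (1/p) > 0" using \<eta> by simp
    then have "fst z \<noteq> snd z" using z(1) by (auto simp: K_def)
    then have "midgap p (fst z) (snd z) > 0"
      using midgap_nonneg[OF p, of "fst z" "snd z"] midgap_eq_0D[OF p, of "fst z" "snd z"] by fastforce
    then show ?thesis using z by blast
  qed (use zero_less_one in blast)
  then obtain d where d: "d > 0" "\<And>z. z \<in> K \<Longrightarrow> d \<le> midgap p (fst z) (snd z)" by blast
  show ?thesis
  proof (intro exI conjI allI)
    fix a b :: 'a
    define t where "t = max (norm a) (norm b)"
    show "norm (a - b) powr p \<le> \<eta> * (norm a powr p + norm b powr p) + (2 powr p / d) * midgap p a b"
    proof (cases "t = 0")
      case True
      then have "norm a \<le> 0" "norm b \<le> 0" unfolding t_def by (metis max.cobounded1 max.cobounded2)+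
      then show ?thesis by (simp add: midgap_def)
    next
      case False
      then have t: "t > 0" unfolding t_def by (metis max.cobounded1 norm_ge_zero less_eq_real_def order_trans)
      define a' b' where "a' = (1/t) *\<^sub>R a" and "b' = (1/t) *\<^sub>R b"
      have ab: "a = t *\<^sub>R a'" "b = t *\<^sub>R b'" using t by (auto simp: a'_def b'_def)
      have n: "norm a' \<le> 1" "norm b' \<le> 1" using t by (auto simp: a'_def b'_def t_def field_simps)
      have s: "norm (a - b) powr p = t powr p * norm (a' - b') powr p"
        unfolding ab using t by (simp add: powr_mult flip: scaleR_diff_right)
      have g: "midgap p a b = t powr p * midgap p a' b'" unfolding ab using t by (simp add: midgap_scaleR)
      show ?thesis
      proof (cases "\<eta> powr (1/p) \<le> norm (a' - b')")
        case True
        then have "(a', b') \<in> K" using n by (auto simp: K_def)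
        then have "d \<le> midgap p a' b'" using d(2) by force
        have "norm (a' - b') \<le> 2" using n norm_triangle_ineq4[of a' b'] by linarith
        then have "norm (a' - b') powr p \<le> 2 powr p * 1" using p by (auto intro: powr_mono2)
        also have "\<dots> \<le> 2 powr p * (midgap p a' b' / d)"
          using \<open>d \<le> midgap p a' b'\<close> d(1) by (intro mult_left_mono) auto
        finally have "norm (a - b) powr p \<le> t powr p * (2 powr p * (midgap p a' b' / d))"
          unfolding s by (intro mult_left_mono) auto
        also have "\<dots> = (2 powr p / d) * midgap p a b" unfolding g by simp
        finally show ?thesis using \<eta> by (simp add: add_increasing)
      next
        case False
        then have "norm (a' - b') powr p \<le> (\<eta> powr (1/p)) powr p" using p by (intro powr_mono2) auto
        also have "\<dots> = \<eta>" using p \<eta> by (simp add: powr_powr)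
        finally have "norm (a - b) powr p \<le> t powr p * \<eta>" unfolding s by (intro mult_left_mono) auto
        also have "t powr p \<le> norm a powr p + norm b powr p" by (auto simp: t_def max_def)
        finally have "norm (a - b) powr p \<le> \<eta> * (norm a powr p + norm b powr p)"
          using \<eta> by (simp add: mult.commute)
        moreover have "0 \<le> (2 powr p / d) * midgap p a b" using d(1) midgap_nonneg[OF p, of a b] by simp
        ultimately show ?thesis by linarith
      qed
    qed
  qed (use d in auto)
qed

section \<open>Smooth functions and test functions\<close>

lemma Ck_SucI:
  assumes "\<And>x. (f has_derivative f' x) (at x)" "\<And>v. Ck k (\<lambda>x. f' x v)"
  shows "Ck (Suc k) f"
  using assms by (auto simp: differentiable_def simp flip: frechet_derivative_at[OF assms(1)])

lemma Ck_SucD: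
  assumes "Ck (Suc k) f"
  shows "(f has_derivative frechet_derivative f (at x)) (at x)"
    and "Ck k (\<lambda>x. frechet_derivative f (at x) v)"
  using assms by (auto simp: frechet_derivative_works)

text \<open>The recursion of \<open>Ck\<close> speaks only of derivatives, while the product and
  chain rules also contain undifferentiated factors. Lowering the order supplies their regularity
  inside the inductions.\<close>

lemma Ck_SucD_Ck: "Ck (Suc k) f \<Longrightarrow> Ck k f"
proof (induction k arbitrary: f)
  case 0
  then show ?case by (auto intro!: continuous_at_imp_continuous_on differentiable_imp_continuous_within)
next
  case (Suc k)
  then show ?case by (subst Ck.simps) (simp del: Ck.simps add: Ck.simps(2)[of "Suc k"])
qed

lemma Ck_const: "Ck k (\<lambda>_. c)"
proof (induction k arbitrary: c)
  case (Suc k)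
  then show ?case by (intro Ck_SucI[where f'="\<lambda>_ _. 0"]) auto
qed simp

lemma Ck_inner_left: "Ck k (\<lambda>x. x \<bullet> e)"
proof (cases k)
  case (Suc j)
  have "Ck (Suc j) (\<lambda>x. x \<bullet> e)"
    by (rule Ck_SucI[where f'="\<lambda>_ v. v \<bullet> e"]) (auto intro!: derivative_eq_intros Ck_const)
  then show ?thesis unfolding Suc .
qed (auto intro!: continuous_intros)

lemma Ck_ident: "Ck k (\<lambda>x::real. x)"
  using Ck_inner_left[of k "1::real"] by simp

lemma Ck_add:
  assumes "Ck k f" "Ck k g"
  shows "Ck k (\<lambda>x. f x + g x)"
  using assms
proof (induction k arbitrary: f g)
  case (Suc k)
  show ?case
    by (rule Ck_SucI[where f'="\<lambda>x v. frechet_derivative f (at x) v + frechet_derivative g (at x) v"])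
      (auto intro!: Suc.IH derivative_intros Ck_SucD[OF Suc.prems(1)] Ck_SucD[OF Suc.prems(2)])
qed (auto intro!: continuous_intros)

lemma Ck_mult:
  assumes "Ck k f" "Ck k g"
  shows "Ck k (\<lambda>x. f x * g x)"
  using assms
proof (induction k arbitrary: f g)
  case (Suc k)
  show ?case
    by (rule Ck_SucI[where f'="\<lambda>x v. f x * frechet_derivative g (at x) v + frechet_derivative f (at x) v * g x"])
      (auto intro!: Suc.IH Ck_add has_derivative_mult Ck_SucD[OF Suc.prems(1)] Ck_SucD[OF Suc.prems(2)]
        Ck_SucD_Ck[OF Suc.prems(1)] Ck_SucD_Ck[OF Suc.prems(2)])
qed (auto intro!: continuous_intros)

text \<open>The outer function has a real argument, so its derivative is multiplication by the value
  at 1. The chain rule is then a product, and \<open>Ck_mult\<close> closes the induction.\<close>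

lemma Ck_compose:
  fixes F :: "real \<Rightarrow> real"
  assumes "Ck k F" "Ck k f"
  shows "Ck k (\<lambda>x. F (f x))"
  using assms
proof (induction k arbitrary: F f)
  case 0
  then show ?case using continuous_on_compose[of UNIV f F]
    by (auto simp: o_def intro: continuous_on_subset)
next
  case (Suc k)
  show ?case
  proof (rule Ck_SucI[where f'="\<lambda>x v. frechet_derivative f (at x) v * frechet_derivative F (at (f x)) 1"])
    fix x
    have lin: "linear (frechet_derivative F (at (f x)))"
      by (rule has_derivative_linear[OF Ck_SucD(1)[OF Suc.prems(1)]])
    have "(\<lambda>v. frechet_derivative F (at (f x)) (frechet_derivative f (at x) v)) =
        (\<lambda>v. frechet_derivative f (at x) v * frechet_derivative F (at (f x)) 1)"
      using linear_scale[OF lin, of "frechet_derivative f (at x) _" 1] by simp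
    then show "((\<lambda>x. F (f x)) has_derivative
        (\<lambda>v. frechet_derivative f (at x) v * frechet_derivative F (at (f x)) 1)) (at x)"
      using has_derivative_compose[OF Ck_SucD(1)[OF Suc.prems(2)] Ck_SucD(1)[OF Suc.prems(1)], of x]
      by simp
  next
    fix v
    show "Ck k (\<lambda>x. frechet_derivative f (at x) v * frechet_derivative F (at (f x)) 1)"
      by (rule Ck_mult[OF Ck_SucD(2)[OF Suc.prems(2)]
            Suc.IH[OF Ck_SucD(2)[OF Suc.prems(1)] Ck_SucD_Ck[OF Suc.prems(2)]]])
  qed
qed

lemma Ck_has_real_derivativeI:
  fixes F :: "real \<Rightarrow> real"
  assumes "\<And>t. (F has_real_derivative F' t) (at t)" "Ck k F'"
  shows "Ck (Suc k) F"
  by (rule Ck_SucI[where f'="\<lambda>t v. F' t * v"])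
    (use assms in \<open>auto simp: has_field_derivative_def intro!: Ck_mult Ck_const\<close>)

lemma smooth_const: "smooth (\<lambda>_. c)"
  by (simp add: smooth_def Ck_const)

lemma smooth_inner_left: "smooth (\<lambda>x. x \<bullet> e)"
  by (simp add: smooth_def Ck_inner_left)

lemma smooth_add: "smooth f \<Longrightarrow> smooth g \<Longrightarrow> smooth (\<lambda>x. f x + g x)"
  by (simp add: smooth_def Ck_add)

lemma smooth_mult: "smooth f \<Longrightarrow> smooth g \<Longrightarrow> smooth (\<lambda>x. f x * g x)"
  by (simp add: smooth_def Ck_mult)

lemma smooth_compose:
  fixes F :: "real \<Rightarrow> real"
  shows "smooth F \<Longrightarrow> smooth f \<Longrightarrow> smooth (\<lambda>x. F (f x))"
  by (simp add: smooth_def Ck_compose)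

lemma smooth_diff: "smooth f \<Longrightarrow> smooth g \<Longrightarrow> smooth (\<lambda>x. f x - g x)"
  using smooth_add[of f "\<lambda>x. (-1) * g x"] smooth_mult[OF smooth_const[of "-1"], of g] by simp

lemma smooth_power: "smooth f \<Longrightarrow> smooth (\<lambda>x. f x ^ n)"
  by (induction n) (auto intro: smooth_mult smooth_const)

lemma smooth_prod: "(\<And>i. i \<in> I \<Longrightarrow> smooth (f i)) \<Longrightarrow> smooth (\<lambda>x. \<Prod>i\<in>I. f i x)"
  by (induction I rule: infinite_finite_induct) (auto intro: smooth_mult smooth_const)

lemma smooth_has_derivative_grad:
  assumes "smooth f"
  shows "(f has_derivative (\<lambda>v. grad f x \<bullet> v)) (at x)"
proof -
  have d: "(f has_derivative frechet_derivative f (at x)) (at x)"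
    using assms Ck_SucD(1)[of 0] unfolding smooth_def by blast
  have lin: "linear (frechet_derivative f (at x))" using d by (simp add: has_derivative_linear)
  have "frechet_derivative f (at x) v = grad f x \<bullet> v" for v
  proof -
    have "frechet_derivative f (at x) v = frechet_derivative f (at x) (\<Sum>b\<in>Basis. (v \<bullet> b) *\<^sub>R b)"
      by (simp add: euclidean_representation)
    also have "\<dots> = (\<Sum>b\<in>Basis. (v \<bullet> b) * frechet_derivative f (at x) b)"
      by (simp add: linear_sum[OF lin] linear_scale[OF lin])
    also have "\<dots> = grad f x \<bullet> v"
      unfolding grad_def inner_sum_left by (simp add: inner_commute mult.commute)
    finally show ?thesis .
  qed
  then have "frechet_derivative f (at x) = (\<lambda>v. grad f x \<bullet> v)" by auto
  then show ?thesis using d by simp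
qed

lemma grad_eqI:
  assumes "(f has_derivative (\<lambda>v. G \<bullet> v)) (at x)"
  shows "grad f x = G"
proof -
  have "frechet_derivative f (at x) = (\<lambda>v. G \<bullet> v)"
    using frechet_derivative_at[OF assms] by simp
  then show ?thesis by (simp add: grad_def euclidean_representation)
qed

lemma smooth_imp_continuous: "smooth f \<Longrightarrow> continuous_on UNIV f"
  using Ck.simps(1) unfolding smooth_def by blast

lemma smooth_imp_continuous_grad:
  assumes "smooth f"
  shows "continuous_on UNIV (grad f)"
proof -
  have "Ck 0 (\<lambda>x. frechet_derivative f (at x) b)" for b
    using assms Ck_SucD(2)[of 0] unfolding smooth_def by blast
  then show ?thesis unfolding grad_def[abs_def] by (auto intro!: continuous_intros)
qed

lemma grad_add:
  assumes "smooth f" "smooth g"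
  shows "grad (\<lambda>x. f x + g x) x = grad f x + grad g x"
  by (rule grad_eqI)
    (auto intro!: derivative_eq_intros smooth_has_derivative_grad[OF assms(1)]
      smooth_has_derivative_grad[OF assms(2)] simp: inner_add_left)

lemma grad_cmult:
  assumes "smooth f"
  shows "grad (\<lambda>x. c * f x) x = c *\<^sub>R grad f x"
  by (rule grad_eqI) (auto intro!: derivative_eq_intros smooth_has_derivative_grad[OF assms(1)])

lemma grad_compose_diff:
  assumes "smooth f" "smooth w" "(F has_real_derivative F') (at (f x - w x))"
  shows "grad (\<lambda>x. F (f x - w x)) x = F' *\<^sub>R (grad f x - grad w x)"
proof (rule grad_eqI)
  have d: "((\<lambda>x. f x - w x) has_derivative (\<lambda>v. grad f x \<bullet> v - grad w x \<bullet> v)) (at x)"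
    by (intro derivative_intros smooth_has_derivative_grad assms)
  have "(\<bullet>) (F' *\<^sub>R (grad f x - grad w x)) = (\<lambda>v. F' * (grad f x \<bullet> v - grad w x \<bullet> v))"
    by (auto simp: inner_diff_left)
  then show "((\<lambda>x. F (f x - w x)) has_derivative (\<bullet>) (F' *\<^sub>R (grad f x - grad w x))) (at x)"
    using has_derivative_compose[OF d assms(3)[unfolded has_field_derivative_def]] by simp
qed

text \<open>The functions \<open>t\<^sup>-\<^sup>m exp (-1/t)\<close>, extended by \<open>0\<close> to the negative axis, form a
  family closed under differentiation, so that smoothness follows for all of them at once.\<close>

definition flat :: "nat \<Rightarrow> real \<Rightarrow> real" where
  "flat m t = (if t > 0 then (1 / t) ^ m * exp (- (1 / t)) else 0)"

lemma flat_nonneg: "0 \<le> flat m t"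
  by (simp add: flat_def)

lemma flat_tendsto_0: "(flat m \<longlongrightarrow> 0) (at_right 0)"
proof -
  have "((\<lambda>t::real. (inverse t) ^ m / exp (inverse t)) \<longlongrightarrow> 0) (at_right 0)"
    by (rule filterlim_compose[OF tendsto_power_div_exp_0 filterlim_inverse_at_top_right])
  then show ?thesis
    by (rule tendsto_cong[THEN iffD1, rotated])
      (auto simp: eventually_at_filter flat_def exp_minus field_simps)
qed

lemma flat_has_real_derivative:
  "(flat m has_real_derivative - (real m * flat (Suc m) t) + flat (Suc (Suc m)) t) (at t)"
proof -
  consider "t > 0" | "t < 0" | "t = 0" by linarith
  then show ?thesis
  proof cases
    case 1
    have d: "((\<lambda>t. (1 / t) ^ m * exp (- (1 / t))) has_real_derivative
        - (real m * flat (Suc m) t) + flat (Suc (Suc m)) t) (at t)"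
    proof -
      have 2: "((\<lambda>t. 1 / t) has_real_derivative (- ((1 / t)^2))) (at t)"
        using 1 by (auto intro!: derivative_eq_intros simp: power2_eq_square)
      have 3: "((\<lambda>t. exp (- (1 / t))) has_real_derivative (exp (- (1 / t)) * (1 / t)^2)) (at t)"
        using 1 by (auto intro!: derivative_eq_intros simp: power2_eq_square)
      show ?thesis using DERIV_mult[OF DERIV_power[OF 2, of m] 3] 1
        by (cases m) (simp_all add: flat_def power2_eq_square algebra_simps del: power_one_over)
    qed
    have "eventually (\<lambda>s. (1 / s) ^ m * exp (- (1 / s)) = flat m s) (nhds t)"
      using eventually_nhds_in_open[of "{0<..}" t] 1 by (auto simp: flat_def elim: eventually_mono)
    from DERIV_cong_ev[OF refl this refl] d show ?thesis by blast
  next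
    case 2
    have d: "((\<lambda>_. 0) has_real_derivative - (real m * flat (Suc m) t) + flat (Suc (Suc m)) t) (at t)"
      using 2 by (simp add: flat_def)
    have "eventually (\<lambda>s. 0 = flat m s) (nhds t)"
      using eventually_nhds_in_open[of "{..<0}" t] 2 by (auto simp: flat_def elim: eventually_mono)
    from DERIV_cong_ev[OF refl this refl] d show ?thesis by blast
  next
    case 3
    have "((\<lambda>s. (flat m s - flat m 0) / (s - 0)) \<longlongrightarrow> 0) (at 0)"
    proof (rule filterlim_split_at)
      show "((\<lambda>s. (flat m s - flat m 0) / (s - 0)) \<longlongrightarrow> 0) (at_left 0)"
        by (rule tendsto_eventually) (auto simp: flat_def eventually_at_filter)
      \<comment> \<open>For s > 0 the difference quotient at the origin is
        \<open>flat (Suc m) s\<close>, which tends to 0.\<close>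
      show "((\<lambda>s. (flat m s - flat m 0) / (s - 0)) \<longlongrightarrow> 0) (at_right 0)"
        by (rule tendsto_cong[THEN iffD1, OF _ flat_tendsto_0[of "Suc m"]])
          (auto simp: eventually_at_filter flat_def)
    qed
    then show ?thesis using 3 by (simp add: has_field_derivative_iff flat_def)
  qed
qed

lemma smooth_flat: "smooth (flat m)"
proof -
  have "Ck k (flat m)" for k
  proof (induction k arbitrary: m)
    case 0
    show ?case using flat_has_real_derivative
      by (auto intro!: continuous_at_imp_continuous_on DERIV_isCont)
  next
    case (Suc k)
    have "Ck k (\<lambda>t. (- real m) * flat (Suc m) t + flat (Suc (Suc m)) t)"
      by (intro Ck_add Ck_mult Ck_const Suc)
    then show ?case using flat_has_real_derivative by (intro Ck_has_real_derivativeI) auto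
  qed
  then show ?thesis by (simp add: smooth_def)
qed

lemma continuous_flat: "continuous_on UNIV (flat m)"
  by (intro smooth_imp_continuous smooth_flat)

text \<open>This smooth approximation of the positive part vanishes on the negative axis, so that
  composing it with \<open>\<phi> - w\<close> for \<open>w \<ge> 0\<close> does not enlarge the support of \<open>\<phi>\<close>.\<close>

definition pospart :: "real \<Rightarrow> real \<Rightarrow> real" where
  "pospart \<epsilon> t = t * flat 0 (t / \<epsilon>)"

definition pospart' :: "real \<Rightarrow> real \<Rightarrow> real" where
  "pospart' \<epsilon> t = flat 0 (t / \<epsilon>) + (t / \<epsilon>) * flat 2 (t / \<epsilon>)"

lemma smooth_pospart: "smooth (pospart \<epsilon>)"
proof -
  have "smooth (\<lambda>t::real. t)" using smooth_inner_left[of "1::real"] by simp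
  moreover have "smooth (\<lambda>t. flat 0 ((1 / \<epsilon>) * t))"
    by (intro smooth_compose[OF smooth_flat] smooth_mult smooth_const calculation)
  ultimately show ?thesis unfolding pospart_def[abs_def] using smooth_mult by fastforce
qed

lemma pospart_has_real_derivative:
  "(pospart \<epsilon> has_real_derivative pospart' \<epsilon> t) (at t)" if "\<epsilon> \<noteq> 0"
proof -
  have d: "(flat 0 has_real_derivative flat 2 s) (at s)" for s
    using flat_has_real_derivative[of 0 s] by (simp add: numeral_2_eq_2)
  have "((\<lambda>t. flat 0 (t / \<epsilon>)) has_real_derivative flat 2 (t / \<epsilon>) * (1 / \<epsilon>)) (at t)"
    by (rule DERIV_chain2[OF d]) (use that in \<open>auto intro!: derivative_eq_intros\<close>)
  then show ?thesis unfolding pospart_def[abs_def] pospart'_def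
    using that by (auto intro!: derivative_eq_intros simp: field_simps)
qed

lemma pospart_nonpos: "0 < \<epsilon> \<Longrightarrow> t \<le> 0 \<Longrightarrow> pospart \<epsilon> t = 0"
  by (simp add: pospart_def flat_def zero_less_divide_iff)

lemma pospart'_nonpos: "0 < \<epsilon> \<Longrightarrow> t \<le> 0 \<Longrightarrow> pospart' \<epsilon> t = 0"
  by (simp add: pospart'_def flat_def zero_less_divide_iff)

lemma pospart'_pos:
  "0 < \<epsilon> \<Longrightarrow> 0 < t \<Longrightarrow> pospart' \<epsilon> t = (1 + \<epsilon> / t) * exp (- (\<epsilon> / t))"
  by (simp add: pospart'_def flat_def field_simps power2_eq_square)

lemma pospart'_bounds:
  assumes "0 < \<epsilon>"
  shows "0 \<le> pospart' \<epsilon> t" "pospart' \<epsilon> t \<le> 1"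
proof -
  have "(1 + \<epsilon> / t) * exp (- (\<epsilon> / t)) \<le> exp (\<epsilon> / t) * exp (- (\<epsilon> / t))" if "t > 0"
    using that by (intro mult_right_mono exp_ge_add_one_self) auto
  then have "t > 0 \<Longrightarrow> (1 + \<epsilon> / t) * exp (- (\<epsilon> / t)) \<le> 1" by (simp flip: exp_add)
  then show "0 \<le> pospart' \<epsilon> t" "pospart' \<epsilon> t \<le> 1"
    using assms pospart'_nonpos[of \<epsilon> t] pospart'_pos[of \<epsilon> t] by (cases "t > 0"; simp)+
qed

lemma continuous_pospart': "continuous_on UNIV (pospart' \<epsilon>)"
  unfolding pospart'_def[abs_def] divide_inverse
  by (intro continuous_intros continuous_on_compose2[OF continuous_flat]) auto

lemma pospart_lipschitz:
  assumes "0 < \<epsilon>"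
  shows "\<bar>pospart \<epsilon> s - pospart \<epsilon> t\<bar> \<le> \<bar>s - t\<bar>"
proof -
  have "norm (pospart \<epsilon> s - pospart \<epsilon> t) \<le> 1 * norm (s - t)"
    by (rule field_differentiable_bound[of UNIV _ "pospart' \<epsilon>"])
      (use assms pospart_has_real_derivative pospart'_bounds[OF assms] in auto)
  then show ?thesis by simp
qed

lemma pospart_approx:
  assumes "0 < \<epsilon>"
  shows "\<bar>pospart \<epsilon> t - max 0 t\<bar> \<le> \<epsilon>"
proof (cases "t > 0")
  case True
  \<comment> \<open>Multiplied by t, the tangent bound of the exponential gives an error of at most
    \<epsilon>, uniformly in t.\<close>
  have "1 - \<epsilon> / t \<le> exp (- (\<epsilon> / t))" using exp_ge_add_one_self[of "- (\<epsilon> / t)"] by simp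
  then have "t * (1 - \<epsilon> / t) \<le> t * exp (- (\<epsilon> / t))" using True by (intro mult_left_mono) auto
  moreover have "t * exp (- (\<epsilon> / t)) \<le> t" using True assms by simp
  ultimately show ?thesis using True assms by (simp add: pospart_def flat_def right_diff_distrib)
qed (use assms pospart_nonpos in auto)

text \<open>The limit is 0 at t = 0 itself. This decides that the gradient of a truncation is 0 on
  the contact set and makes the strict case distinction in \<open>sob_truncate\<close> the right
  one.\<close>

lemma pospart'_tendsto:
  "(\<lambda>k. pospart' (1 / real (Suc k)) t) \<longlonglongrightarrow> (if t > 0 then 1 else 0)"
proof (cases "t > 0")
  case True
  have "(\<lambda>k. (1 + (1 / real (Suc k)) / t) * exp (- ((1 / real (Suc k)) / t))) \<longlonglongrightarrow> (1 + 0 / t) * exp (- (0 / t))"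
    by (intro tendsto_intros LIMSEQ_Suc[OF lim_1_over_n]) (use True in auto)
  then show ?thesis using True by (simp add: pospart'_pos)
qed (simp add: pospart'_nonpos)

section \<open>Supports of test functions\<close>

lemma not_in_support: "x \<notin> closure {x. f x \<noteq> 0} \<Longrightarrow> f x = 0"
  using closure_subset[of "{x. f x \<noteq> 0}"] by auto

lemma test_function_zero: "test_function \<Omega> (\<lambda>_. 0)"
  by (simp add: test_function_def smooth_const)

lemma test_functionD:
  assumes "test_function \<Omega> \<phi>"
  shows "smooth \<phi>" "compact (closure {x. \<phi> x \<noteq> 0})" "closure {x. \<phi> x \<noteq> 0} \<subseteq> \<Omega>"
  using assms by (auto simp: test_function_def)

lemma test_function_supportI:
  assumes "smooth f" "compact K" "K \<subseteq> \<Omega>" "\<And>x. x \<notin> K \<Longrightarrow> f x = 0"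
  shows "test_function \<Omega> f"
proof -
  have "closure {x. f x \<noteq> 0} \<subseteq> K"
    using assms by (intro closure_minimal compact_imp_closed) auto
  then show ?thesis
    using assms(1,2,3) compact_Int_closed[of K "closure {x. f x \<noteq> 0}"]
    by (auto simp: test_function_def Int_absorb1)
qed

lemma test_function_cmult:
  assumes "test_function \<Omega> f"
  shows "test_function \<Omega> (\<lambda>x. c * f x)"
proof (rule test_function_supportI)
  show "smooth (\<lambda>x. c * f x)"
    by (rule smooth_mult[OF smooth_const test_functionD(1)[OF assms]])
  show "c * f x = 0" if "x \<notin> closure {x. f x \<noteq> 0}" for x
    using not_in_support[OF that] by simp
qed (use test_functionD[OF assms] in auto)

lemma test_function_add:
  assumes "test_function \<Omega> f" "test_function \<Omega> g"
  shows "test_function \<Omega> (\<lambda>x. f x + g x)"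
proof (rule test_function_supportI)
  show "smooth (\<lambda>x. f x + g x)"
    by (rule smooth_add[OF test_functionD(1)[OF assms(1)] test_functionD(1)[OF assms(2)]])
  show "compact (closure {x. f x \<noteq> 0} \<union> closure {x. g x \<noteq> 0})"
    by (rule compact_Un[OF test_functionD(2)[OF assms(1)] test_functionD(2)[OF assms(2)]])
  show "f x + g x = 0" if "x \<notin> closure {x. f x \<noteq> 0} \<union> closure {x. g x \<noteq> 0}" for x
    using that not_in_support[of x f] not_in_support[of x g] by auto
qed (use test_functionD(3)[OF assms(1)] test_functionD(3)[OF assms(2)] in blast)

lemma test_function_pospart:
  assumes "test_function \<Omega> f" "smooth w" "\<And>x. 0 \<le> w x" "0 < \<epsilon>"
  shows "test_function \<Omega> (\<lambda>x. pospart \<epsilon> (f x - w x))"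
proof (rule test_function_supportI)
  show "smooth (\<lambda>x. pospart \<epsilon> (f x - w x))"
    by (rule smooth_compose[OF smooth_pospart smooth_diff[OF test_functionD(1)[OF assms(1)] assms(2)]])
  show "pospart \<epsilon> (f x - w x) = 0" if "x \<notin> closure {x. f x \<noteq> 0}" for x
    using not_in_support[OF that] assms(3)[of x] assms(4) by (intro pospart_nonpos) auto
qed (use test_functionD[OF assms(1)] in auto)

lemma support_grad:
  assumes "x \<notin> closure {x. f x \<noteq> 0}"
  shows "grad f x = 0"
proof (rule grad_eqI)
  have "(f has_derivative (\<lambda>_. 0)) (at x)"
    by (rule has_derivative_transform_within_open[OF has_derivative_const[of 0], of "- closure {x. f x \<noteq> 0}"])
      (use assms closure_subset[of "{x. f x \<noteq> 0}"] in auto)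
  moreover have "(\<bullet>) 0 = (\<lambda>_::'a. 0::real)" by auto
  ultimately show "(f has_derivative (\<bullet>) 0) (at x)" by simp
qed

lemma test_function_bounded:
  assumes "test_function \<Omega> f"
  shows "\<exists>B\<ge>0. \<forall>x. \<bar>f x\<bar> \<le> B \<and> norm (grad f x) \<le> B"
proof -
  let ?K = "closure {x. f x \<noteq> 0}"
  have K: "compact ?K" using test_functionD[OF assms] by simp
  have c: "continuous_on ?K f" "continuous_on ?K (grad f)"
    using smooth_imp_continuous smooth_imp_continuous_grad test_functionD(1)[OF assms]
    by (auto intro: continuous_on_subset)
  obtain B1 where B1: "\<And>x. x \<in> ?K \<Longrightarrow> norm (f x) \<le> B1"
    using compact_imp_bounded[OF compact_continuous_image[OF c(1) K]] unfolding bounded_iff by blast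
  obtain B2 where B2: "\<And>x. x \<in> ?K \<Longrightarrow> norm (grad f x) \<le> B2"
    using compact_imp_bounded[OF compact_continuous_image[OF c(2) K]] unfolding bounded_iff by blast
  have "\<bar>f x\<bar> \<le> max 0 (max B1 B2) \<and> norm (grad f x) \<le> max 0 (max B1 B2)" for x
  proof (cases "x \<in> ?K")
    case False
    then show ?thesis using support_grad[of x f] not_in_support[of x f] by auto
  qed (use B1[of x] B2[of x] in auto)
  then show ?thesis by (meson max.cobounded1)
qed

section \<open>Integration by parts against compactly supported functions\<close>

text \<open>The definitions integrate over the restricted Lebesgue measure, whereas translation
  invariance is available for \<open>lborel\<close> on the whole space. For a continuous function
  with compact support in the open set the two integrals agree.\<close>

lemma lebesgue_on_integral_continuous_support:
  fixes f :: "'a::euclidean_space \<Rightarrow> 'b::euclidean_space"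
  assumes "open \<Omega>" "continuous_on UNIV f" "compact K" "K \<subseteq> \<Omega>" "\<And>x. x \<notin> K \<Longrightarrow> f x = 0"
  shows "integrable lborel f" "integrable (lebesgue_on \<Omega>) f"
    "integral\<^sup>L (lebesgue_on \<Omega>) f = integral\<^sup>L lborel f"
proof -
  have m: "f \<in> borel_measurable lborel"
    using borel_measurable_continuous_onI[OF assms(2)] by simp
  have "integrable lborel (\<lambda>x. indicator K x *\<^sub>R f x)"
    by (rule borel_integrable_compact[OF assms(3)]) (use assms(2) continuous_on_subset in blast)
  moreover have "(\<lambda>x. indicator K x *\<^sub>R f x) = f" using assms(5) by (auto simp: indicator_def)
  ultimately show i: "integrable lborel f" by simp
  have e: "(\<lambda>x. indicator \<Omega> x *\<^sub>R f x) = f" using assms(4,5) by (auto simp: indicator_def fun_eq_iff)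
  have "\<Omega> \<inter> space lebesgue \<in> sets lebesgue" using assms(1) by auto
  then show "integrable (lebesgue_on \<Omega>) f" "integral\<^sup>L (lebesgue_on \<Omega>) f = integral\<^sup>L lborel f"
    using i m by (simp_all add: integrable_restrict_space integral_restrict_space e
        integrable_completion integral_completion)
qed

text \<open>By translation invariance the difference quotients of \<open>f\<close> have vanishing integral.\<close>

lemma integral_directional_derivative_eq_0:
  fixes f :: "'a::euclidean_space \<Rightarrow> real"
  assumes \<Omega>: "open \<Omega>" and K: "compact K" "K \<subseteq> \<Omega>" "\<And>x. x \<notin> K \<Longrightarrow> f x = 0"
    and d: "\<And>x. (f has_derivative f' x) (at x)" and c: "continuous_on UNIV (\<lambda>x. f' x e)"
  shows "integrable (lebesgue_on \<Omega>) (\<lambda>x. f' x e)" "(LINT x|lebesgue_on \<Omega>. f' x e) = 0"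
proof -
  have cf: "continuous_on UNIV f"
    by (intro continuous_at_imp_continuous_on ballI has_derivative_continuous[OF d])
  have f'0: "f' x e = 0" if "x \<notin> K" for x
  proof -
    have "(f has_derivative (\<lambda>_. 0)) (at x)"
      by (rule has_derivative_transform_within_open[OF has_derivative_const[of 0], of "- K"])
        (use that K compact_imp_closed[OF K(1)] in auto)
    then show ?thesis using has_derivative_unique[OF d] by metis
  qed
  show "integrable (lebesgue_on \<Omega>) (\<lambda>x. f' x e)"
    by (rule lebesgue_on_integral_continuous_support[OF \<Omega> c K(1,2) f'0])
  have eq: "(LINT x|lebesgue_on \<Omega>. f' x e) = (LINT x|lborel. f' x e)"
    by (rule lebesgue_on_integral_continuous_support[OF \<Omega> c K(1,2) f'0])
  have fi: "integrable lborel f"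
    by (rule lebesgue_on_integral_continuous_support[OF \<Omega> cf K])
  obtain R where R: "\<And>x. x \<in> K \<Longrightarrow> norm x \<le> R"
    using compact_imp_bounded[OF K(1)] unfolding bounded_iff by blast
  obtain B0 where B0: "\<And>x. x \<in> K \<Longrightarrow> norm (f' x e) \<le> B0"
    using compact_imp_bounded[OF compact_continuous_image[OF continuous_on_subset[OF c] K(1)]]
    unfolding bounded_iff by blast
  define B where "B = max 0 B0"
  have B: "\<bar>f' x e\<bar> \<le> B" for x using B0[of x] f'0[of x] by (cases "x \<in> K") (auto simp: B_def)
  define t where "t n = 1 / real (Suc n)" for n
  have t: "0 < t n" "t n \<le> 1" for n by (auto simp: t_def)
  define dq where "dq n x = (f (x + t n *\<^sub>R e) - f x) / t n" for n x
  have line: "((\<lambda>s. f (x + s *\<^sub>R e)) has_real_derivative f' (x + s *\<^sub>R e) e) (at s)" for x s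
  proof -
    have "((\<lambda>s. x + s *\<^sub>R e) has_derivative (\<lambda>h. h *\<^sub>R e)) (at s)"
      by (auto intro!: derivative_eq_intros)
    from has_derivative_compose[OF this d]
    have "((\<lambda>s. f (x + s *\<^sub>R e)) has_derivative (\<lambda>h. f' (x + s *\<^sub>R e) (h *\<^sub>R e))) (at s)" .
    moreover have "f' y (h *\<^sub>R e) = f' y e * h" for y h
      using linear_scale[OF has_derivative_linear[OF d], of y h e] by simp
    ultimately show ?thesis by (simp add: has_field_derivative_def)
  qed
  \<comment> \<open>The mean value theorem bounds every quotient by B, and
    \<open>t n \<le> 1\<close> confines all their supports to one ball of radius
    \<open>R + norm e\<close>; this gives the integrable majorant.\<close>
  have lim: "(\<lambda>n. LINT x|lborel. dq n x) \<longlonglongrightarrow> (LINT x|lborel. f' x e)"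
  proof (rule integral_dominated_convergence[where w="\<lambda>x. B * indicator (cball (0::'a) (R + norm e)) x"])
    show "(\<lambda>x. f' x e) \<in> borel_measurable lborel"
      using borel_measurable_continuous_onI[OF c] by simp
    have "continuous_on UNIV (dq n)" for n unfolding dq_def
      using t(1)[of n] by (intro continuous_intros continuous_on_compose2[OF cf]) auto
    then show "dq n \<in> borel_measurable lborel" for n
      using borel_measurable_continuous_onI by (simp add: borel_measurable_continuous_onI)
    show "integrable lborel (\<lambda>x. B * indicator (cball (0::'a) (R + norm e)) x)"
      by (intro integrable_mult_right integrable_real_indicator)
        (use emeasure_lborel_cball_finite[of "0::'a"] in auto)
    show "AE x in lborel. (\<lambda>n. dq n x) \<longlonglongrightarrow> f' x e"
    proof (rule AE_I2)
      fix x
      have "((\<lambda>h. (f (x + h *\<^sub>R e) - f x) / h) \<longlongrightarrow> f' x e) (at 0)"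
        using line[of x 0] by (simp add: DERIV_def)
      moreover have "filterlim t (at 0) sequentially"
        unfolding filterlim_at using t(1) LIMSEQ_Suc[OF lim_1_over_n]
        by (auto simp: t_def[abs_def] simp del: of_nat_Suc)
      ultimately show "(\<lambda>n. dq n x) \<longlonglongrightarrow> f' x e"
        unfolding dq_def by (rule filterlim_compose)
    qed
    show "AE x in lborel. norm (dq n x) \<le> B * indicator (cball (0::'a) (R + norm e)) x" for n
    proof (rule AE_I2)
      fix x
      show "norm (dq n x) \<le> B * indicator (cball (0::'a) (R + norm e)) x"
      proof (cases "x \<in> cball (0::'a) (R + norm e)")
        case True
        have "norm (f (x + t n *\<^sub>R e) - f (x + 0 *\<^sub>R e)) \<le> B * norm (t n - 0)"
          by (rule field_differentiable_bound[of UNIV "\<lambda>s. f (x + s *\<^sub>R e)" "\<lambda>s. f' (x + s *\<^sub>R e) e"])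
            (use line B in auto)
        then show ?thesis using True t(1)[of n] by (simp add: dq_def field_simps)
      next
        case False
        have "norm (t n *\<^sub>R e) \<le> norm e" using t[of n] by (simp add: mult_left_le_one_le)
        then have "norm x \<le> norm (x + t n *\<^sub>R e) + norm e"
          using norm_triangle_ineq4[of "x + t n *\<^sub>R e" "t n *\<^sub>R e"] by simp
        moreover have "R + norm e < norm x" using False by simp
        ultimately have "R < norm (x + t n *\<^sub>R e)" "R < norm x" using norm_ge_zero[of e] by linarith+
        then have "x \<notin> K" "x + t n *\<^sub>R e \<notin> K" using R by (meson not_le)+
        then show ?thesis using K(3) False by (simp add: dq_def)
      qed
    qed
  qed
  have "(LINT x|lborel. dq n x) = 0" for n
  proof -
    have tr: "lborel = distr lborel borel ((+) (t n *\<^sub>R e))" by (rule lborel_distr_plus[symmetric])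
    have fb: "f \<in> borel_measurable borel" using borel_measurable_continuous_onI[OF cf] .
    have i: "integrable lborel (\<lambda>x. f (t n *\<^sub>R e + x))"
      using fi by (subst (asm) tr) (use fb in \<open>simp add: integrable_distr_eq\<close>)
    have "integral\<^sup>L lborel f = (LINT x|lborel. f (t n *\<^sub>R e + x))"
      by (subst tr) (use fb in \<open>simp add: integral_distr\<close>)
    then show ?thesis unfolding dq_def using i fi
      by (simp add: add.commute[of _ "t n *\<^sub>R e"])
  qed
  then show "(LINT x|lebesgue_on \<Omega>. f' x e) = 0" using lim eq by (simp add: LIMSEQ_const_iff)
qed

text \<open>The product of z and \<phi> inherits the compact support of \<phi>, so its directional
  derivative integrates to 0. Regularity C^1 for z covers both uses: z a test function, and z the
  scalar factor of the flux of the barrier.\<close>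

lemma test_function_integral_by_parts:
  assumes \<Omega>: "open \<Omega>" and \<phi>: "test_function \<Omega> \<phi>"
    and z: "\<And>x. (z has_derivative (\<lambda>v. z' x \<bullet> v)) (at x)" "continuous_on UNIV z'"
  shows "integrable (lebesgue_on \<Omega>) (\<lambda>x. z x * (grad \<phi> x \<bullet> e))"
    "integrable (lebesgue_on \<Omega>) (\<lambda>x. \<phi> x * (z' x \<bullet> e))"
    "(LINT x|lebesgue_on \<Omega>. z x * (grad \<phi> x \<bullet> e)) = - (LINT x|lebesgue_on \<Omega>. \<phi> x * (z' x \<bullet> e))"
proof -
  let ?K = "closure {x. \<phi> x \<noteq> 0}"
  note t = test_functionD[OF \<phi>]
  have cz: "continuous_on UNIV z"
    by (intro continuous_at_imp_continuous_on ballI has_derivative_continuous[OF z(1)])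
  note c\<phi> = smooth_imp_continuous[OF t(1)] smooth_imp_continuous_grad[OF t(1)]
  have \<phi>0: "x \<notin> ?K \<Longrightarrow> \<phi> x = 0" for x by (rule not_in_support)
  have c1: "continuous_on UNIV (\<lambda>x. z x * (grad \<phi> x \<bullet> e))"
    by (intro continuous_on_mult continuous_on_inner continuous_on_const cz c\<phi>)
  have c2: "continuous_on UNIV (\<lambda>x. \<phi> x * (z' x \<bullet> e))"
    by (intro continuous_on_mult continuous_on_inner continuous_on_const z(2) c\<phi>)
  have c3: "continuous_on UNIV (\<lambda>x. z x * (grad \<phi> x \<bullet> e) + (z' x \<bullet> e) * \<phi> x)"
    using continuous_on_add[OF c1 c2] by (simp add: mult.commute[of "\<phi> _"])
  have i1: "integrable (lebesgue_on \<Omega>) (\<lambda>x. z x * (grad \<phi> x \<bullet> e))"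
    by (rule lebesgue_on_integral_continuous_support[OF \<Omega> c1 t(2,3)]) (simp add: support_grad)
  have i2: "integrable (lebesgue_on \<Omega>) (\<lambda>x. \<phi> x * (z' x \<bullet> e))"
    by (rule lebesgue_on_integral_continuous_support[OF \<Omega> c2 t(2,3)]) (drule \<phi>0, simp)
  have d: "((\<lambda>x. z x * \<phi> x) has_derivative (\<lambda>v. z x * (grad \<phi> x \<bullet> v) + (z' x \<bullet> v) * \<phi> x)) (at x)" for x
    by (rule has_derivative_mult[OF z(1) smooth_has_derivative_grad[OF t(1)]])
  have "(LINT x|lebesgue_on \<Omega>. z x * (grad \<phi> x \<bullet> e) + (z' x \<bullet> e) * \<phi> x) = 0"
    by (rule integral_directional_derivative_eq_0(2)[OF \<Omega> t(2,3) _ d c3]) (drule \<phi>0, simp)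
  then have "(LINT x|lebesgue_on \<Omega>. z x * (grad \<phi> x \<bullet> e) + \<phi> x * (z' x \<bullet> e)) = 0"
    by (simp only: mult.commute)
  then show "integrable (lebesgue_on \<Omega>) (\<lambda>x. z x * (grad \<phi> x \<bullet> e))"
    "integrable (lebesgue_on \<Omega>) (\<lambda>x. \<phi> x * (z' x \<bullet> e))"
    "(LINT x|lebesgue_on \<Omega>. z x * (grad \<phi> x \<bullet> e)) = - (LINT x|lebesgue_on \<Omega>. \<phi> x * (z' x \<bullet> e))"
    using i1 i2 by (simp_all add: eq_neg_iff_add_eq_0)
qed

section \<open>Powers of norms as integrands: completeness\<close>

definition LP :: "real \<Rightarrow> 'm measure \<Rightarrow> ('m \<Rightarrow> 'b::euclidean_space) set" where
  "LP p M = {f. f \<in> borel_measurable M \<and> integrable M (\<lambda>x. norm (f x) powr p)}"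

text \<open>The p-th power of the L^p norm. Leaving out the root turns pointwise inequalities into
  integral ones directly.\<close>

definition pmass :: "real \<Rightarrow> 'm measure \<Rightarrow> ('m \<Rightarrow> 'b::euclidean_space) \<Rightarrow> real" where
  "pmass p M f = (LINT x|M. norm (f x) powr p)"

lemma LP_measurable [measurable_dest]: "f \<in> LP p M \<Longrightarrow> f \<in> borel_measurable M"
  by (simp add: LP_def)

lemma LP_integrable_powr: "f \<in> LP p M \<Longrightarrow> integrable M (\<lambda>x. norm (f x) powr p)"
  by (simp add: LP_def)

lemma pmass_nonneg: "0 \<le> pmass p M f"
  by (simp add: pmass_def)

lemma LP_bound:
  assumes "f \<in> borel_measurable M" "integrable M G" "AE x in M. norm (f x) powr p \<le> G x"
  shows "f \<in> LP p M"
proof -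
  have "integrable M (\<lambda>x. norm (f x) powr p)"
    by (rule Bochner_Integration.integrable_bound[OF assms(2)])
      (use assms(1,3) in \<open>auto elim!: eventually_mono\<close>)
  then show ?thesis using assms by (simp add: LP_def)
qed

lemma LP_mono:
  assumes "0 \<le> p" "f \<in> borel_measurable M" "g \<in> LP p M" "AE x in M. norm (f x) \<le> norm (g x)"
  shows "f \<in> LP p M"
  by (rule LP_bound[OF assms(2) LP_integrable_powr[OF assms(3)]])
    (use assms in \<open>auto elim!: eventually_mono intro: powr_mono2\<close>)

lemma LP_scaleR: "f \<in> LP p M \<Longrightarrow> (\<lambda>x. c *\<^sub>R f x) \<in> LP p M"
  by (auto simp: LP_def powr_mult)

lemma LP_cmult: "f \<in> LP p M \<Longrightarrow> (\<lambda>x. c * f x :: real) \<in> LP p M"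
  using LP_scaleR[of f p M c] by simp

lemma LP_add:
  assumes "0 \<le> p" "f \<in> LP p M" "g \<in> LP p M"
  shows "(\<lambda>x. f x + g x) \<in> LP p M"
proof (rule LP_bound)
  show "(\<lambda>x. f x + g x) \<in> borel_measurable M" using assms by (auto simp: LP_def)
  show "integrable M (\<lambda>x. 2 powr p * (norm (f x) powr p + norm (g x) powr p))"
    using assms by (auto simp: LP_def)
qed (use norm_add_powr_le[OF assms(1)] in auto)

lemma LP_diff:
  assumes "0 \<le> p" "f \<in> LP p M" "g \<in> LP p M"
  shows "(\<lambda>x. f x - g x) \<in> LP p M"
  using LP_add[OF assms(1,2) LP_scaleR[OF assms(3), of "-1"]] by simp

lemma LP_AE_cong:
  assumes "f \<in> LP p M" "g \<in> borel_measurable M" "AE x in M. f x = g x"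
  shows "g \<in> LP p M"
  by (rule LP_bound[OF assms(2) LP_integrable_powr[OF assms(1)]]) (use assms(3) in auto)

lemma pmass_mono:
  assumes "f \<in> LP p M" "integrable M G" "AE x in M. norm (f x) powr p \<le> G x"
  shows "pmass p M f \<le> (LINT x|M. G x)"
  unfolding pmass_def by (rule integral_mono_AE[OF LP_integrable_powr[OF assms(1)] assms(2,3)])

lemma pmass_add_le:
  assumes "0 \<le> p" "f \<in> LP p M" "g \<in> LP p M"
  shows "pmass p M (\<lambda>x. f x + g x) \<le> 2 powr p * (pmass p M f + pmass p M g)"
proof -
  have "pmass p M (\<lambda>x. f x + g x) \<le> (LINT x|M. 2 powr p * (norm (f x) powr p + norm (g x) powr p))"
    by (rule pmass_mono[OF LP_add[OF assms]])
      (use assms norm_add_powr_le[OF assms(1)] in \<open>auto simp: LP_def\<close>)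
  also have "\<dots> = 2 powr p * (pmass p M f + pmass p M g)"
    using assms by (simp add: LP_def pmass_def)
  finally show ?thesis .
qed

lemma pmass_minus_commute: "pmass p M (\<lambda>x. f x - g x) = pmass p M (\<lambda>x. g x - f x)"
  by (simp add: pmass_def norm_minus_commute)

lemma pmass_triangle:
  assumes "0 \<le> p" "f \<in> LP p M" "g \<in> LP p M" "h \<in> LP p M"
  shows "pmass p M (\<lambda>x. f x - h x) \<le> 2 powr p * (pmass p M (\<lambda>x. f x - g x) + pmass p M (\<lambda>x. g x - h x))"
  using pmass_add_le[OF assms(1) LP_diff[OF assms(1-3)] LP_diff[OF assms(1,3,4)]] by simp

lemma pmass_cong_AE:
  assumes "f \<in> borel_measurable M" "g \<in> borel_measurable M" "AE x in M. f x = g x"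
  shows "pmass p M f = pmass p M g"
  unfolding pmass_def by (rule integral_cong_AE) (use assms in auto)

lemma pmass_scaleR: "pmass p M (\<lambda>x. c *\<^sub>R f x) = \<bar>c\<bar> powr p * pmass p M f"
  by (simp add: pmass_def powr_mult)

lemma pmass_eq_0D:
  assumes "f \<in> LP p M" "pmass p M f = 0"
  shows "AE x in M. f x = 0"
  using assms integral_nonneg_eq_0_iff_AE[OF LP_integrable_powr[OF assms(1)]]
  by (simp add: pmass_def)

lemma pmass_le_limit:
  assumes "\<And>k. a \<le> F k" "F \<longlonglongrightarrow> (b::real)"
  shows "a \<le> b"
  using LIMSEQ_le_const[OF assms(2)] assms(1) by blast

lemma LP_const:
  assumes "finite_measure M"
  shows "(\<lambda>_. c) \<in> LP p M"
  using finite_measure.integrable_const[OF assms] by (auto simp: LP_def)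

lemma LP_bounded:
  assumes "finite_measure M" "0 \<le> p" "f \<in> borel_measurable M" "AE x in M. norm (f x) \<le> B"
  shows "f \<in> LP p M"
  by (rule LP_bound[OF assms(3) finite_measure.integrable_const[OF assms(1), of "B powr p"]])
    (use assms in \<open>auto elim!: eventually_mono intro: powr_mono2\<close>)

lemma LP_integrable_powr_le:
  assumes "finite_measure M" "0 \<le> m" "m \<le> p" "f \<in> LP p M"
  shows "integrable M (\<lambda>x. norm (f x) powr m)"
proof (rule Bochner_Integration.integrable_bound)
  show "integrable M (\<lambda>x. 1 + norm (f x) powr p)"
    by (rule Bochner_Integration.integrable_add[OF finite_measure.integrable_const[OF assms(1)]
          LP_integrable_powr[OF assms(4)]])
  show "(\<lambda>x. norm (f x) powr m) \<in> borel_measurable M" using assms by (auto simp: LP_def)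
  show "AE x in M. norm (norm (f x) powr m) \<le> norm (1 + norm (f x) powr p)"
    using powr_le_one_plus[OF assms(2,3)] by (auto intro!: AE_I2)
qed

lemma LP_le:
  assumes "finite_measure M" "0 \<le> m" "m \<le> p" "f \<in> LP p M"
  shows "f \<in> LP m M"
  using LP_integrable_powr_le[OF assms] assms(4) by (auto simp: LP_def)

lemma LP_integrable:
  assumes "finite_measure M" "1 \<le> p" "f \<in> LP p M"
  shows "integrable M f"
proof -
  have "integrable M (\<lambda>x. norm (f x))" using LP_integrable_powr_le[OF assms(1) _ assms(2,3)] by simp
  then show ?thesis using assms(3) by (simp add: integrable_norm_iff LP_def)
qed

lemma LP_integrable_flux_inner:
  assumes "1 < p" "f \<in> LP p M" "g \<in> LP p M"
  shows "integrable M (\<lambda>x. flux p (f x) \<bullet> g x)"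
proof (rule Bochner_Integration.integrable_bound)
  show "integrable M (\<lambda>x. norm (f x) powr p + norm (g x) powr p)" using assms by (auto simp: LP_def)
  show "(\<lambda>x. flux p (f x) \<bullet> g x) \<in> borel_measurable M" using assms by (auto simp: LP_def flux_def)
  show "AE x in M. norm (flux p (f x) \<bullet> g x) \<le> norm (norm (f x) powr p + norm (g x) powr p)"
    using flux_inner_bound[OF assms(1)] by (auto intro!: AE_I2)
qed

text \<open>On a finite measure space L^p convergence implies L^1 convergence, since
  \<open>s \<le> \<eta> + \<eta> powr (1 - p) * s powr p\<close> for s \<ge> 0: the second term
  vanishes in the limit, and the first is as small as desired.\<close>

lemma LP_tendsto_integral:
  fixes f :: "nat \<Rightarrow> 'm \<Rightarrow> 'b::euclidean_space" and F :: "nat \<Rightarrow> 'm \<Rightarrow> 'c::euclidean_space"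
  assumes M: "finite_measure M" and p: "1 < p"
    and f: "\<And>k. f k \<in> LP p M" "g \<in> LP p M" "(\<lambda>k. pmass p M (\<lambda>x. f k x - g x)) \<longlonglongrightarrow> 0"
    and F: "\<And>k. integrable M (F k)" "integrable M G"
    and le: "\<And>k. AE x in M. norm (F k x - G x) \<le> B * norm (f k x - g x)" and B: "0 \<le> B"
  shows "(\<lambda>k. LINT x|M. F k x) \<longlonglongrightarrow> (LINT x|M. G x)"
proof (rule LIMSEQ_I)
  fix r :: real assume r: "r > 0"
  define \<mu> where "\<mu> = measure M (space M)"
  have \<mu>: "0 \<le> \<mu>" by (simp add: \<mu>_def)
  \<comment> \<open>This makes \<open>B * \<eta> * \<mu>\<close> at most r/2; the summands 1 guard
    against B = 0 and against a null space.\<close>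
  define \<eta> where "\<eta> = r / (2 * (B + 1) * (\<mu> + 1))"
  have \<eta>: "\<eta> > 0" using r B \<mu> by (simp add: \<eta>_def)
  have 1: "norm ((LINT x|M. F k x) - (LINT x|M. G x))
      \<le> B * (\<eta> * \<mu> + \<eta> powr (1 - p) * pmass p M (\<lambda>x. f k x - g x))" for k
  proof -
    have d: "(\<lambda>x. f k x - g x) \<in> LP p M" using p by (intro LP_diff f) auto
    have i: "integrable M (\<lambda>x. norm (f k x - g x))"
      using LP_integrable[OF M _ d] p by auto
    have c: "integrable M (\<lambda>x. \<eta>)" by (rule finite_measure.integrable_const[OF M])
    have "norm ((LINT x|M. F k x) - (LINT x|M. G x)) \<le> (LINT x|M. norm (F k x - G x))"
      using integral_norm_bound[of M "\<lambda>x. F k x - G x"] F by simp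
    also have "\<dots> \<le> (LINT x|M. B * norm (f k x - g x))"
      by (rule integral_mono_AE) (use F i le in auto)
    also have "\<dots> = B * (LINT x|M. norm (f k x - g x))" by simp
    also have "\<dots> \<le> B * (LINT x|M. \<eta> + \<eta> powr (1 - p) * norm (f k x - g x) powr p)"
    proof (intro mult_left_mono integral_mono)
      show "integrable M (\<lambda>x. \<eta> + \<eta> powr (1 - p) * norm (f k x - g x) powr p)"
        using LP_integrable_powr[OF d] c by auto
      show "norm (f k x - g x) \<le> \<eta> + \<eta> powr (1 - p) * norm (f k x - g x) powr p" for x
        using powr_mult_le_eta[of p 1 "norm (f k x - g x)" \<eta>] p \<eta> by simp
    qed (use i B in auto)
    also have "(LINT x|M. \<eta> + \<eta> powr (1 - p) * norm (f k x - g x) powr p)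
        = \<eta> * \<mu> + \<eta> powr (1 - p) * pmass p M (\<lambda>x. f k x - g x)"
      using LP_integrable_powr[OF d] c by (simp add: pmass_def \<mu>_def)
    finally show ?thesis .
  qed
  have "(\<lambda>k. B * (\<eta> * \<mu> + \<eta> powr (1 - p) * pmass p M (\<lambda>x. f k x - g x))) \<longlonglongrightarrow> B * (\<eta> * \<mu> + \<eta> powr (1 - p) * 0)"
    by (intro tendsto_intros f(3))
  moreover have "B * (\<eta> * \<mu> + \<eta> powr (1 - p) * 0) < r"
  proof -
    have "B * \<mu> \<le> (B + 1) * (\<mu> + 1)" using B \<mu> by (intro mult_mono) auto
    then have "\<eta> * (B * \<mu>) \<le> \<eta> * ((B + 1) * (\<mu> + 1))" using \<eta> by (intro mult_left_mono) auto
    also have "\<dots> = r / 2" using B \<mu> by (simp add: \<eta>_def divide_simps add_nonneg_eq_0_iff)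
    finally show ?thesis using r by (simp add: mult_ac)
  qed
  ultimately have "\<forall>\<^sub>F k in sequentially. B * (\<eta> * \<mu> + \<eta> powr (1 - p) * pmass p M (\<lambda>x. f k x - g x)) < r"
    using order_tendstoD(2) by blast
  then have "\<forall>\<^sub>F k in sequentially. norm ((LINT x|M. F k x) - (LINT x|M. G x)) < r"
    by (rule eventually_mono) (use 1 in \<open>meson le_less_trans\<close>)
  then show "\<exists>n0. \<forall>n\<ge>n0. norm ((LINT x|M. F n x) - (LINT x|M. G x)) < r"
    by (simp add: eventually_sequentially)
qed

text \<open>Along a subsequence whose increments decay like \<open>4\<^sup>-\<^sup>k\<close> in norm, the series of the
  \<open>p\<close>-th powers of the increments, weighted by \<open>2\<^sup>k\<^sup>p\<close>, is integrable; it dominates everything.\<close>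

lemma LP_Cauchy_subsequence:
  fixes f :: "nat \<Rightarrow> 'm \<Rightarrow> 'b::euclidean_space"
  assumes p: "1 < p" and f: "\<And>n. f n \<in> LP p M"
    and Cauchy: "\<And>\<epsilon>. 0 < \<epsilon> \<Longrightarrow> \<exists>N. \<forall>m\<ge>N. \<forall>n\<ge>N. pmass p M (\<lambda>x. f m x - f n x) < \<epsilon>"
  obtains r g G where "strict_mono r" "g \<in> LP p M"
    "(\<lambda>k. pmass p M (\<lambda>x. f (r k) x - g x)) \<longlonglongrightarrow> 0"
    "AE x in M. (\<lambda>k. f (r k) x) \<longlonglongrightarrow> g x"
    "integrable M G" "AE x in M. \<forall>k. norm (f (r k) x) powr p \<le> G x"
proof -
  have "\<forall>k. \<exists>N. \<forall>m\<ge>N. \<forall>n\<ge>N. pmass p M (\<lambda>x. f m x - f n x) < (1 / 4 ^ k) powr p"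
    by (intro allI Cauchy) simp
  then obtain N where N: "\<And>k m n. m \<ge> N k \<Longrightarrow> n \<ge> N k \<Longrightarrow> pmass p M (\<lambda>x. f m x - f n x) < (1 / 4 ^ k) powr p"
    by metis
  \<comment> \<open>Partial sums dominate every single \<open>N k\<close>, and the summand k makes
    the selection strictly increasing.\<close>
  define r where "r k = (\<Sum>i\<le>k. N i) + k" for k
  have "strict_mono r" unfolding strict_mono_Suc_iff by (simp add: r_def)
  have rN: "N k \<le> r k" for k unfolding r_def
    using member_le_sum[of k "{..k}" N] by (simp add: trans_le_add1)
  define a where "a k x = f (r (Suc k)) x - f (r k) x" for k x
  have aLP: "a k \<in> LP p M" for k unfolding a_def using p by (intro LP_diff f) auto
  have a_le: "pmass p M (a k) \<le> (1 / 4 ^ k) powr p" for k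
    using N[OF _ rN[of k], of "r (Suc k)"] rN[of k] strict_monoD[OF \<open>strict_mono r\<close>, of k "Suc k"]
    by (auto simp: a_def[abs_def])
  define s where "s k x = (2 ^ k) powr p * norm (a k x) powr p" for k x
  have s_int: "integrable M (s k)" for k
    unfolding s_def using LP_integrable_powr[OF aLP] by auto
  have s_nn: "0 \<le> s k x" for k x by (simp add: s_def)
  have s_le: "(LINT x|M. s k x) \<le> ((1 / 2) powr p) ^ k" for k
  proof -
    have "(LINT x|M. s k x) = (2 ^ k) powr p * pmass p M (a k)" by (simp add: s_def pmass_def)
    also have "\<dots> \<le> (2 ^ k) powr p * (1 / 4 ^ k) powr p" by (intro mult_left_mono a_le) auto
    also have "\<dots> = (2 ^ k * (1 / 4 ^ k)) powr p" by (simp only: powr_mult)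
    also have "2 ^ k * (1 / 4 ^ k) = (2 / 4 :: real) ^ k"
      by (simp only: power_divide times_divide_eq_right mult_1_right)
    also have "(2 / 4 :: real) = 1 / 2" by simp
    also have "((1 / 2 :: real) ^ k) powr p = ((1 / 2) powr p) ^ k"
      by (induction k) (simp_all only: powr_mult power_Suc power_0 powr_one_eq_one)
    finally show ?thesis .
  qed
  have summ: "summable (\<lambda>k. ((1 / 2) powr p) ^ k :: real)"
    using p powr_less_mono2[of p "1/2" 1] by (intro summable_geometric) auto
  have s_sum: "summable (\<lambda>k. LINT x|M. s k x)"
    by (rule summable_comparison_test'[OF summ, of 0]) (use s_le s_nn in \<open>simp add: integral_nonneg_AE\<close>)
  have AEs: "AE x in M. summable (\<lambda>k. s k x)"
  proof -
    have "(\<integral>\<^sup>+x. (\<Sum>k. ennreal (s k x)) \<partial>M) = (\<Sum>k. \<integral>\<^sup>+x. ennreal (s k x) \<partial>M)"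
      by (rule nn_integral_suminf) (use s_int in auto)
    also have "\<dots> = (\<Sum>k. ennreal (LINT x|M. s k x))"
      using s_int s_nn by (simp add: nn_integral_eq_integral)
    also have "\<dots> = ennreal (\<Sum>k. LINT x|M. s k x)"
      by (rule suminf_ennreal_eq[OF _ summable_sums[OF s_sum]]) (simp add: s_nn integral_nonneg_AE)
    finally have "(\<integral>\<^sup>+x. (\<Sum>k. ennreal (s k x)) \<partial>M) \<noteq> \<infinity>" by simp
    then have "AE x in M. (\<Sum>k. ennreal (s k x)) \<noteq> \<infinity>"
      by (intro nn_integral_PInf_AE) (use s_int in auto)
    then show ?thesis by (auto elim!: eventually_mono intro!: summable_suminf_not_top s_nn)
  qed
  define S where "S x = (\<Sum>k. s k x)" for x
  have S_int: "integrable M S" unfolding S_def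
    by (rule integrable_suminf[OF s_int]) (use AEs s_sum s_nn in auto)
  define g where "g x = lim (\<lambda>k. f (r k) x)" for x
  have g_meas: "g \<in> borel_measurable M" unfolding g_def
    by (rule borel_measurable_lim_metric) (use f LP_measurable in blast)
  \<comment> \<open>A single summand is at most S, so the k-th increment is at most
    \<open>(1/2) ^ k * S x powr (1/p)\<close>. The geometric tail then gives pointwise convergence
    together with a rate whose p-th power is a multiple of the integrable S. This one estimate
    yields both L^p convergence and the envelope.\<close>
  have key: "(\<lambda>k. f (r k) x) \<longlonglongrightarrow> g x \<and> 0 \<le> S x \<and>
      (\<forall>k. norm (f (r k) x - g x) powr p \<le> (2 * (1/2) ^ k) powr p * S x)"
    if x: "summable (\<lambda>k. s k x)" for x
  proof -
    define t where "t = S x powr (1 / p)"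
    have S0: "0 \<le> S x" unfolding S_def using s_nn by (intro suminf_nonneg x) auto
    have at: "norm (a k x) \<le> (1/2) ^ k * t" for k
    proof -
      have "s k x \<le> S x" unfolding S_def
        using sum_le_suminf[OF x, of "{k}"] s_nn by simp
      then have "((2 ^ k) * norm (a k x)) powr p \<le> S x" by (simp add: s_def powr_mult)
      then have "(((2 ^ k) * norm (a k x)) powr p) powr (1 / p) \<le> t"
        unfolding t_def using p by (intro powr_mono2) auto
      then show ?thesis using p by (simp add: powr_powr power_one_over field_simps)
    qed
    have gs: "summable (\<lambda>k. (1/2) ^ k * t)" by (intro summable_mult2 summable_geometric) auto
    have na: "summable (\<lambda>k. norm (a k x))"
      by (rule summable_comparison_test'[OF gs, of 0]) (use at in auto)
    have sa: "summable (\<lambda>k. a k x)" by (rule summable_norm_cancel[OF na])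
    have tel: "f (r k) x = f (r 0) x + (\<Sum>i<k. a i x)" for k
      unfolding a_def by (simp add: sum_lessThan_telescope[of "\<lambda>i. f (r i) x"])
    have "(\<lambda>k. f (r 0) x + (\<Sum>i<k. a i x)) \<longlonglongrightarrow> f (r 0) x + (\<Sum>i. a i x)"
      by (intro tendsto_intros summable_LIMSEQ sa)
    then have lim: "(\<lambda>k. f (r k) x) \<longlonglongrightarrow> f (r 0) x + (\<Sum>i. a i x)" by (simp only: tel[symmetric])
    then have g: "g x = f (r 0) x + (\<Sum>i. a i x)" unfolding g_def by (rule limI)
    have "norm (f (r k) x - g x) \<le> (2 * (1/2) ^ k) * t" for k
    proof -
      have "g x - f (r k) x = (\<Sum>i. a (i + k) x)"
        using suminf_split_initial_segment[OF sa, of k] unfolding g tel[of k] by simp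
      then have "norm (f (r k) x - g x) = norm (\<Sum>i. a (i + k) x)" by (metis norm_minus_commute)
      also have "\<dots> \<le> (\<Sum>i. norm (a (i + k) x))"
        using summable_ignore_initial_segment[OF na, of k] by (rule summable_norm)
      also have "\<dots> \<le> (\<Sum>i. (1/2) ^ (i + k) * t)"
        by (intro suminf_le at summable_ignore_initial_segment[OF na]
            summable_ignore_initial_segment[OF gs])
      also have "\<dots> = (\<Sum>i. (1/2) ^ i * ((1/2) ^ k * t))" by (simp add: power_add mult_ac)
      also have "\<dots> = (\<Sum>i. (1/2) ^ i) * ((1/2) ^ k * t)"
        by (rule suminf_mult2[symmetric]) (auto intro: summable_geometric)
      also have "(\<Sum>i. (1/2::real) ^ i) = 2" by (simp add: suminf_geometric)
      finally show ?thesis by simp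
    qed
    then have "norm (f (r k) x - g x) powr p \<le> ((2 * (1/2) ^ k) * t) powr p" for k
      using p by (intro powr_mono2) auto
    moreover have "t powr p = S x" unfolding t_def using p S0 by (simp add: powr_powr)
    ultimately show ?thesis using lim S0 unfolding g by (simp add: powr_mult)
  qed
  have AEkey: "AE x in M. (\<lambda>k. f (r k) x) \<longlonglongrightarrow> g x \<and> 0 \<le> S x \<and>
      (\<forall>k. norm (f (r k) x - g x) powr p \<le> (2 * (1/2) ^ k) powr p * S x)"
    using AEs by (rule eventually_mono) (rule key)
  have AE_le: "AE x in M. norm (f (r k) x - g x) powr p \<le> (2 * (1/2) ^ k) powr p * S x" for k
    using AEkey by (rule eventually_mono) blast
  have d1: "(\<lambda>x. f (r k) x - g x) \<in> LP p M" for k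
    by (rule LP_bound[where G="\<lambda>x. (2 * (1/2) ^ k) powr p * S x"])
      (use AE_le S_int g_meas f[THEN LP_measurable] in auto)
  have gLP: "g \<in> LP p M"
    using LP_diff[OF _ f[of "r 0"] d1[of 0]] p by simp
  have lim0: "(\<lambda>k. pmass p M (\<lambda>x. f (r k) x - g x)) \<longlonglongrightarrow> 0"
  proof (rule tendsto_sandwich[OF _ _ tendsto_const])
    show "\<forall>\<^sub>F k in sequentially. pmass p M (\<lambda>x. f (r k) x - g x) \<le> (2 * (1/2) ^ k) powr p * (LINT x|M. S x)"
    proof (intro always_eventually allI)
      fix k
      have "pmass p M (\<lambda>x. f (r k) x - g x) \<le> (LINT x|M. (2 * (1/2) ^ k) powr p * S x)"
        by (rule pmass_mono[OF d1]) (use AE_le S_int in auto)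
      then show "pmass p M (\<lambda>x. f (r k) x - g x) \<le> (2 * (1/2) ^ k) powr p * (LINT x|M. S x)" by simp
    qed
    have "(\<lambda>k. 2 * (1/2::real) ^ k) \<longlonglongrightarrow> 2 * 0" by (intro tendsto_intros LIMSEQ_power_zero) auto
    then have "(\<lambda>k. (2 * (1/2::real) ^ k) powr p) \<longlonglongrightarrow> 0"
      by (intro tendsto_zero_powrI[where b=p]) (use p in auto)
    from tendsto_mult_right[OF this, of "LINT x|M. S x"]
    show "(\<lambda>k. (2 * (1/2) ^ k) powr p * (LINT x|M. S x)) \<longlonglongrightarrow> 0" by simp
  qed (simp add: pmass_nonneg)
  show ?thesis
  proof (rule that[OF \<open>strict_mono r\<close> gLP lim0])
    show "AE x in M. (\<lambda>k. f (r k) x) \<longlonglongrightarrow> g x" using AEkey by (rule eventually_mono) blast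
    show "integrable M (\<lambda>x. 2 powr p * (2 powr p * S x + norm (g x) powr p))"
      using S_int LP_integrable_powr[OF gLP] by auto
    show "AE x in M. \<forall>k. norm (f (r k) x) powr p \<le> 2 powr p * (2 powr p * S x + norm (g x) powr p)"
      using AEkey
    proof (rule eventually_mono, intro allI)
      fix x k
      assume x: "(\<lambda>k. f (r k) x) \<longlonglongrightarrow> g x \<and> 0 \<le> S x \<and>
        (\<forall>k. norm (f (r k) x - g x) powr p \<le> (2 * (1/2) ^ k) powr p * S x)"
      have "(2 * (1/2) ^ k) powr p \<le> 2 powr p"
        using p by (intro powr_mono2) (auto simp: power_le_one)
      then have "(2 * (1/2) ^ k) powr p * S x \<le> 2 powr p * S x" using x by (intro mult_right_mono) auto
      then have "norm (f (r k) x - g x) powr p \<le> 2 powr p * S x" using x by (meson order_trans)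
      then have *: "2 powr p * (norm (f (r k) x - g x) powr p + norm (g x) powr p)
          \<le> 2 powr p * (2 powr p * S x + norm (g x) powr p)" by (intro mult_left_mono) auto
      have "norm (f (r k) x) powr p \<le> 2 powr p * (norm (f (r k) x - g x) powr p + norm (g x) powr p)"
        using norm_add_powr_le[of p "f (r k) x - g x" "g x"] p by simp
      then show "norm (f (r k) x) powr p \<le> 2 powr p * (2 powr p * S x + norm (g x) powr p)"
        using * by (rule order_trans)
    qed
  qed
qed

text \<open>A convergent sequence is Cauchy, so the previous extraction applies; its limit agrees
  almost everywhere with the given one because the distance of the two limits is below a null
  sequence.\<close>

lemma LP_convergent_subsequence:
  fixes f :: "nat \<Rightarrow> 'm \<Rightarrow> 'b::euclidean_space"
  assumes p: "1 < p" and f: "\<And>n. f n \<in> LP p M" "g \<in> LP p M"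
    and lim: "(\<lambda>k. pmass p M (\<lambda>x. f k x - g x)) \<longlonglongrightarrow> 0"
  obtains r G where "strict_mono r" "AE x in M. (\<lambda>k. f (r k) x) \<longlonglongrightarrow> g x"
    "integrable M G" "AE x in M. \<forall>k. norm (f (r k) x) powr p \<le> G x"
proof -
  have p0: "0 \<le> p" using p by simp
  have Cauchy: "\<exists>N. \<forall>m\<ge>N. \<forall>n\<ge>N. pmass p M (\<lambda>x. f m x - f n x) < \<epsilon>" if "0 < \<epsilon>" for \<epsilon>
  proof -
    have "\<epsilon> / (2 * 2 powr p) > 0" using that by simp
    with order_tendstoD(2)[OF lim] obtain N where
      N: "\<And>k. k \<ge> N \<Longrightarrow> pmass p M (\<lambda>x. f k x - g x) < \<epsilon> / (2 * 2 powr p)"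
      unfolding eventually_sequentially by blast
    have "pmass p M (\<lambda>x. f m x - f n x) < \<epsilon>" if "m \<ge> N" "n \<ge> N" for m n
    proof -
      have "pmass p M (\<lambda>x. f m x - f n x)
          \<le> 2 powr p * (pmass p M (\<lambda>x. f m x - g x) + pmass p M (\<lambda>x. f n x - g x))"
        using pmass_triangle[OF p0 f(1)[of m] f(2) f(1)[of n]]
        by (simp add: pmass_minus_commute[of p M g])
      also have "\<dots> < 2 powr p * (\<epsilon> / (2 * 2 powr p) + \<epsilon> / (2 * 2 powr p))"
        using N[OF that(1)] N[OF that(2)] by (intro mult_strict_left_mono add_strict_mono) auto
      also have "\<dots> = \<epsilon>" by (simp add: field_simps)
      finally show ?thesis .
    qed
    then show ?thesis by blast
  qed
  obtain r g' G where r: "strict_mono r" "g' \<in> LP p M"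
    "(\<lambda>k. pmass p M (\<lambda>x. f (r k) x - g' x)) \<longlonglongrightarrow> 0"
    "AE x in M. (\<lambda>k. f (r k) x) \<longlonglongrightarrow> g' x"
    "integrable M G" "AE x in M. \<forall>k. norm (f (r k) x) powr p \<le> G x"
    by (rule LP_Cauchy_subsequence[OF p f(1)], erule Cauchy, blast)
  have "pmass p M (\<lambda>x. g' x - g x) \<le> 0"
  proof (rule pmass_le_limit)
    show "pmass p M (\<lambda>x. g' x - g x)
        \<le> 2 powr p * (pmass p M (\<lambda>x. f (r k) x - g' x) + pmass p M (\<lambda>x. f (r k) x - g x))" for k
      using pmass_triangle[OF p0 r(2) f(1)[of "r k"] f(2)]
      by (simp add: pmass_minus_commute[of p M g'])
    have "(\<lambda>k. pmass p M (\<lambda>x. f (r k) x - g x)) \<longlonglongrightarrow> 0"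
      using LIMSEQ_subseq_LIMSEQ[OF lim r(1)] by (simp add: o_def)
    then have "(\<lambda>k. 2 powr p * (pmass p M (\<lambda>x. f (r k) x - g' x) + pmass p M (\<lambda>x. f (r k) x - g x)))
        \<longlonglongrightarrow> 2 powr p * (0 + 0)"
      by (intro tendsto_intros r(3))
    then show "(\<lambda>k. 2 powr p * (pmass p M (\<lambda>x. f (r k) x - g' x) + pmass p M (\<lambda>x. f (r k) x - g x)))
        \<longlonglongrightarrow> 0" by simp
  qed
  then have "AE x in M. g' x - g x = 0"
    using pmass_eq_0D[OF LP_diff[OF p0 r(2) f(2)]] pmass_nonneg[of p M "\<lambda>x. g' x - g x"] by simp
  then have "AE x in M. (\<lambda>k. f (r k) x) \<longlonglongrightarrow> g x" using r(4) by auto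
  then show ?thesis using that r by blast
qed

section \<open>The fundamental lemma of the calculus of variations\<close>

definition bump :: "'a::euclidean_space \<Rightarrow> 'a \<Rightarrow> 'a \<Rightarrow> real" where
  "bump a b x = (\<Prod>i\<in>Basis. flat 0 (x \<bullet> i - a \<bullet> i) * flat 0 (b \<bullet> i - x \<bullet> i))"

lemma flat_0_le_1: "flat 0 t \<le> 1"
  by (simp add: flat_def)

lemma bump_bounds: "0 \<le> bump a b x" "bump a b x \<le> 1"
  unfolding bump_def
  by (auto intro!: prod_nonneg prod_le_1 mult_le_one mult_nonneg_nonneg flat_0_le_1 flat_nonneg)

lemma bump_pos: "x \<in> box a b \<Longrightarrow> 0 < bump a b x"
  unfolding bump_def by (intro prod_pos) (auto simp: flat_def mem_box)

lemma bump_eq_0: "x \<notin> box a b \<Longrightarrow> bump a b x = 0"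
  unfolding bump_def by (auto simp: flat_def mem_box)

lemma smooth_bump: "smooth (bump a b)"
proof -
  have "smooth (\<lambda>x. flat 0 (x \<bullet> i - a \<bullet> i) * flat 0 (b \<bullet> i - x \<bullet> i))" for i
    by (rule smooth_mult[OF smooth_compose[OF smooth_flat smooth_diff[OF smooth_inner_left smooth_const]]
          smooth_compose[OF smooth_flat smooth_diff[OF smooth_const smooth_inner_left]]])
  then show ?thesis unfolding bump_def[abs_def] by (rule smooth_prod)
qed

lemma test_function_bump:
  assumes "cbox a b \<subseteq> \<Omega>"
  shows "test_function \<Omega> (bump a b)"
proof (rule test_function_supportI[OF smooth_bump compact_cbox assms])
  show "bump a b x = 0" if "x \<notin> cbox a b" for x
    using that box_subset_cbox[of a b] by (intro bump_eq_0) auto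
qed

lemma test_function_bump_power:
  assumes "cbox a b \<subseteq> \<Omega>"
  shows "test_function \<Omega> (\<lambda>x. 1 - (1 - bump a b x) ^ j)"
proof (rule test_function_supportI[OF _ compact_cbox assms])
  show "smooth (\<lambda>x. 1 - (1 - bump a b x) ^ j)"
    by (rule smooth_diff[OF smooth_const smooth_power[OF smooth_diff[OF smooth_const smooth_bump]]])
  show "1 - (1 - bump a b x) ^ j = 0" if "x \<notin> cbox a b" for x
  proof -
    have "x \<notin> box a b" using that box_subset_cbox[of a b] by blast
    then show ?thesis by (simp add: bump_eq_0)
  qed
qed

text \<open>Boxes are stable under intersection and generate the Borel sets, so vanishing integrals
  spread to all Borel sets by a Dynkin argument, then to all Lebesgue sets. A function with
  vanishing integral over every measurable set is null.\<close>

lemma integral_over_boxes_eq_0_imp_AE: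
  fixes f :: "'a::euclidean_space \<Rightarrow> 'b::euclidean_space"
  assumes f: "integrable lebesgue f"
    and box0: "\<And>a b. set_lebesgue_integral lebesgue (box a b) f = 0"
  shows "AE x in lebesgue. f x = 0"
proof -
  have si: "set_integrable lebesgue A f" if "A \<in> sets lebesgue" for A
    using integrable_mult_indicator[OF that f] by (simp add: set_integrable_def)
  \<comment> \<open>The complement step of the Dynkin argument requires the integral over the whole
    space, which is obtained by exhaustion with growing boxes.\<close>
  have UNIV0: "integral\<^sup>L lebesgue f = 0"
  proof -
    define B where "B n = box (- real n *\<^sub>R One) (real n *\<^sub>R One :: 'a)" for n
    have "(\<lambda>n. LINT x|lebesgue. indicator (B n) x *\<^sub>R f x) \<longlonglongrightarrow> (LINT x|lebesgue. f x)"
    proof (rule integral_dominated_convergence[where w="\<lambda>x. norm (f x)"])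
      show "AE x in lebesgue. (\<lambda>n. indicator (B n) x *\<^sub>R f x) \<longlonglongrightarrow> f x"
      proof (rule AE_I2)
        fix x :: 'a
        obtain N :: nat where N: "norm x < real N" using reals_Archimedean2 by blast
        have "x \<in> B n" if "n \<ge> N" for n
        proof -
          have "\<bar>x \<bullet> i\<bar> < real n" if "i \<in> Basis" for i
            using N \<open>n \<ge> N\<close> Basis_le_norm[OF that, of x] by linarith
          then show ?thesis unfolding B_def mem_box by (auto simp: abs_less_iff minus_less_iff)
        qed
        then have "eventually (\<lambda>n. indicator (B n) x *\<^sub>R f x = f x) sequentially"
          unfolding eventually_sequentially by (intro exI[of _ N]) simp
        then show "(\<lambda>n. indicator (B n) x *\<^sub>R f x) \<longlonglongrightarrow> f x" by (rule tendsto_eventually)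
      qed
      show "(\<lambda>x. indicator (B n) x *\<^sub>R f x) \<in> borel_measurable lebesgue" for n
        by (rule borel_measurable_scaleR[OF borel_measurable_indicator borel_measurable_integrable[OF f]])
          (auto simp: B_def)
    qed (use f in \<open>auto simp: indicator_def\<close>)
    moreover have "(LINT x|lebesgue. indicator (B n) x *\<^sub>R f x) = 0" for n
      using box0 unfolding B_def set_lebesgue_integral_def by blast
    ultimately show ?thesis by (simp add: LIMSEQ_const_iff)
  qed
  have borel0: "set_lebesgue_integral lebesgue A f = 0" if "A \<in> sets borel" for A
  proof -
    have "Int_stable (range (\<lambda>(a, b). box a b :: 'a set))"
      by (auto simp: Int_stable_def box_Int_box)
    moreover have "range (\<lambda>(a, b). box a b :: 'a set) \<subseteq> Pow UNIV" by auto
    moreover have "A \<in> sigma_sets UNIV (range (\<lambda>(a, b). box a b :: 'a set))"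
      using that unfolding borel_eq_box by simp
    ultimately show ?thesis
    proof (induction rule: sigma_sets_induct_disjoint)
      case (basic A)
      then show ?case using box0 by auto
    next
      case empty
      then show ?case by (simp add: set_lebesgue_integral_def)
    next
      case (compl A)
      have [measurable]: "A \<in> sets borel" using compl by (simp add: borel_eq_box)
      have "set_lebesgue_integral lebesgue (UNIV - A) f
          = (LINT x|lebesgue. f x - indicator A x *\<^sub>R f x)"
        unfolding set_lebesgue_integral_def
        by (intro Bochner_Integration.integral_cong) (auto simp: indicator_def)
      also have "\<dots> = 0"
        using f si[of A] compl UNIV0 by (simp add: set_integrable_def set_lebesgue_integral_def)
      finally show ?case .
    next
      case (union A)
      then have m: "A i \<in> sets borel" for i by (simp add: borel_eq_box subset_eq)
      have "set_lebesgue_integral lebesgue (\<Union>i. A i) f = (\<Sum>i. set_lebesgue_integral lebesgue (A i) f)"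
        by (rule lebesgue_integral_countable_add)
          (use m union in \<open>auto simp: disjoint_family_on_def intro!: si\<close>)
      then show ?case using union by simp
    qed
  qed
  interpret sigma_finite_measure "lebesgue :: 'a measure"
  proof
    have "(\<Union>n::nat. cball (0::'a) (real n)) = UNIV"
      by (auto intro: real_arch_simple)
    then show "\<exists>A. countable A \<and> A \<subseteq> sets (lebesgue :: 'a measure) \<and> \<Union> A = space lebesgue
        \<and> (\<forall>a\<in>A. emeasure lebesgue a \<noteq> \<infinity>)"
      by (intro exI[of _ "range (\<lambda>n::nat. cball (0::'a) (real n))"])
        (use emeasure_lborel_cball_finite[of "0::'a"] in \<open>auto simp: less_top\<close>)
  qed
  show ?thesis
  proof (rule density_zero[OF f])
    \<comment> \<open>A Lebesgue set differs from a Borel set S only inside a Borel null set, so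
      both give the same integral.\<close>
    fix A :: "'a set" assume "A \<in> sets lebesgue"
    then obtain S N N' where A: "A = S \<union> N" "N \<subseteq> N'" "N' \<in> null_sets lborel" "S \<in> sets lborel"
      by (rule sets_completionE)
    have "set_lebesgue_integral lebesgue A f = set_lebesgue_integral lebesgue S f"
      unfolding set_lebesgue_integral_def
    proof (rule integral_cong_AE)
      show "AE x in lebesgue. indicator A x *\<^sub>R f x = indicator S x *\<^sub>R f x"
        using AE_completion[OF AE_not_in[OF A(3)]] A by (auto elim!: eventually_mono simp: indicator_def)
      show "(\<lambda>x. indicator A x *\<^sub>R f x) \<in> borel_measurable lebesgue"
        "(\<lambda>x. indicator S x *\<^sub>R f x) \<in> borel_measurable lebesgue"
        using si[OF \<open>A \<in> sets lebesgue\<close>] si[of S] A(4) by (auto simp: set_integrable_def)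
    qed
    also have "\<dots> = 0" using A by (intro borel0) auto
    finally show "set_lebesgue_integral lebesgue A f = 0" .
  qed
qed

text \<open>An open set is a countable union of closed boxes, and the faces of a box are negligible.
  Statements on open boxes are what bumps deliver, since they are positive exactly there.\<close>

lemma AE_lebesgue_on_boxI:
  fixes \<Omega> :: "'a::euclidean_space set"
  assumes \<Omega>: "open \<Omega>" and box: "\<And>a b. cbox a b \<subseteq> \<Omega> \<Longrightarrow> AE x in lebesgue_on \<Omega>. x \<in> box a b \<longrightarrow> P x"
  shows "AE x in lebesgue_on \<Omega>. P x"
proof -
  have \<Omega>s: "\<Omega> \<inter> space lebesgue \<in> sets lebesgue" using \<Omega> by auto
  have cbox: "AE x in lebesgue. x \<in> cbox a b \<longrightarrow> P x" if ab: "cbox a b \<subseteq> \<Omega>" for a b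
  proof -
    have neg: "AE x in lebesgue. x \<notin> cbox a b - box a b"
      using negligible_frontier_interval[of a b] by (intro AE_not_in) (simp add: negligible_iff_null_sets)
    have "AE x in lebesgue. x \<in> \<Omega> \<longrightarrow> x \<in> box a b \<longrightarrow> P x"
      using box[OF ab] by (simp add: AE_restrict_space_iff[OF \<Omega>s])
    with neg show ?thesis by (rule eventually_elim2) (use ab in blast)
  qed
  obtain \<D> where \<D>: "countable \<D>" "\<D> \<subseteq> Pow \<Omega>" "\<And>X. X \<in> \<D> \<Longrightarrow> \<exists>a b. X = cbox a b" "\<Union>\<D> = \<Omega>"
    using open_countable_Union_open_cbox[OF \<Omega>] by metis
  have "AE x in lebesgue. \<forall>X\<in>\<D>. x \<in> X \<longrightarrow> P x"
    using \<D>(1) by (rule AE_ball_countable[THEN iffD2]) (use \<D>(2,3) cbox in blast)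
  then have "AE x in lebesgue. x \<in> \<Omega> \<longrightarrow> P x"
    by (rule eventually_mono) (use \<D>(4) in blast)
  then show ?thesis by (simp add: AE_restrict_space_iff[OF \<Omega>s])
qed

section \<open>Local integrability and products with test functions\<close>

lemma locally_integrable_bounded_support:
  fixes g :: "'a::euclidean_space \<Rightarrow> 'b::euclidean_space" and f :: "'a \<Rightarrow> 'c::euclidean_space"
  assumes \<Omega>: "open \<Omega>" and g: "locally_integrable_on g \<Omega>" and K: "compact K" "K \<subseteq> \<Omega>" "\<And>x. x \<notin> K \<Longrightarrow> f x = 0"
    and f: "f \<in> borel_measurable (lebesgue_on \<Omega>)" "\<And>x. norm (f x) \<le> B * norm (g x)"
  shows "integrable (lebesgue_on \<Omega>) f"
proof (rule Bochner_Integration.integrable_bound[OF _ f(1)])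
  have \<Omega>s: "\<Omega> \<inter> space lebesgue \<in> sets lebesgue" using \<Omega> by auto
  have "integrable lebesgue (\<lambda>x. indicator K x *\<^sub>R g x)"
    using g K by (auto simp: locally_integrable_on_def set_integrable_def)
  moreover have "(\<lambda>x. indicator \<Omega> x *\<^sub>R (indicator K x *\<^sub>R g x)) = (\<lambda>x. indicator K x *\<^sub>R g x)"
    using K(2) by (auto simp: indicator_def fun_eq_iff)
  ultimately show "integrable (lebesgue_on \<Omega>) (\<lambda>x. B *\<^sub>R (indicator K x *\<^sub>R g x))"
    by (intro integrable_scaleR_right) (simp add: integrable_restrict_space[OF \<Omega>s])
  show "AE x in lebesgue_on \<Omega>. norm (f x) \<le> norm (B *\<^sub>R (indicator K x *\<^sub>R g x))"
  proof (rule AE_I2)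
    fix x
    have "B * norm (g x) \<le> \<bar>B\<bar> * norm (g x)" by (intro mult_right_mono) auto
    then show "norm (f x) \<le> norm (B *\<^sub>R (indicator K x *\<^sub>R g x))"
      using f(2)[of x] K(3)[of x] by (cases "x \<in> K") auto
  qed
qed

lemma smooth_measurable:
  assumes "smooth f"
  shows "f \<in> borel_measurable (lebesgue_on \<Omega>)" "grad f \<in> borel_measurable (lebesgue_on \<Omega>)"
  using borel_measurable_continuous_onI[OF smooth_imp_continuous[OF assms]]
    borel_measurable_continuous_onI[OF smooth_imp_continuous_grad[OF assms]]
  by (auto intro!: measurable_restrict_space1 measurable_completion)

text \<open>Local integrability speaks about compact subsets only; measurability on the whole domain
  is glued together from a countable cover by closed boxes.\<close>

lemma locally_integrable_measurable:
  fixes g :: "'a::euclidean_space \<Rightarrow> 'b::euclidean_space"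
  assumes \<Omega>: "open \<Omega>" and g: "locally_integrable_on g \<Omega>"
  shows "g \<in> borel_measurable (lebesgue_on \<Omega>)"
proof -
  let ?M = "lebesgue_on \<Omega>"
  obtain \<D> where \<D>: "countable \<D>" "\<D> \<subseteq> Pow \<Omega>" "\<And>X. X \<in> \<D> \<Longrightarrow> \<exists>a b. X = cbox a b" "\<Union>\<D> = \<Omega>"
    using open_countable_Union_open_cbox[OF \<Omega>] by metis
  have gX: "g \<in> borel_measurable (restrict_space ?M X)" if XD: "X \<in> \<D>" for X
  proof -
    obtain a b where X: "X = cbox a b" "X \<subseteq> \<Omega>" using XD \<D>(2) \<D>(3)[OF XD] by auto
    have "set_integrable lebesgue X g" using g X by (auto simp: locally_integrable_on_def)
    then have "integrable (lebesgue_on X) g"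
      using X by (subst integrable_restrict_space) (auto simp: set_integrable_def)
    moreover have "restrict_space ?M X = lebesgue_on X"
      using X \<Omega> by (subst restrict_restrict_space) (auto simp: Int_absorb1)
    ultimately show ?thesis by (simp only: borel_measurable_integrable)
  qed
  have XM: "X \<inter> space ?M \<in> sets ?M" if "X \<in> \<D>" for X
  proof -
    have "X \<in> sets lebesgue" "X \<subseteq> \<Omega>" using \<D>(3)[OF that] \<D>(2) that by auto
    then show ?thesis using \<Omega> by (auto simp: sets_restrict_space_iff Int_absorb2)
  qed
  have "space ?M \<subseteq> \<Union>\<D>" using \<D>(4) by simp
  show ?thesis by (rule measurable_piecewise_restrict[OF \<D>(1) XM \<open>space ?M \<subseteq> \<Union>\<D>\<close> gX])
qed

lemma locally_integrable_test_function:
  fixes g :: "'a::euclidean_space \<Rightarrow> 'b::euclidean_space" and v :: "'a \<Rightarrow> real"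
  assumes \<Omega>: "open \<Omega>" and \<phi>: "test_function \<Omega> \<phi>"
  shows "locally_integrable_on g \<Omega> \<Longrightarrow> integrable (lebesgue_on \<Omega>) (\<lambda>x. \<phi> x *\<^sub>R g x)"
    "locally_integrable_on v \<Omega> \<Longrightarrow> integrable (lebesgue_on \<Omega>) (\<lambda>x. v x *\<^sub>R grad \<phi> x)"
proof -
  note t = test_functionD[OF \<phi>]
  obtain B where B: "\<And>x. \<bar>\<phi> x\<bar> \<le> B" "\<And>x. norm (grad \<phi> x) \<le> B" using test_function_bounded[OF \<phi>] by blast
  note m = smooth_measurable[OF t(1)] locally_integrable_measurable[OF \<Omega>]
  show "integrable (lebesgue_on \<Omega>) (\<lambda>x. \<phi> x *\<^sub>R g x)" if "locally_integrable_on g \<Omega>"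
    by (rule locally_integrable_bounded_support[OF \<Omega> that t(2,3) _ borel_measurable_scaleR[OF m(1) m(3)[OF that]], of B])
      (drule not_in_support, use B in \<open>auto intro: mult_right_mono\<close>)
  show "integrable (lebesgue_on \<Omega>) (\<lambda>x. v x *\<^sub>R grad \<phi> x)" if "locally_integrable_on v \<Omega>"
    by (rule locally_integrable_bounded_support[OF \<Omega> that t(2,3) _ borel_measurable_scaleR[OF m(3)[OF that] m(2)], of B])
      (drule support_grad, use B in \<open>auto simp: mult.commute[of B] intro: mult_left_mono\<close>)
qed

text \<open>Testing with \<open>1 - (1 - \<eta>)\<^sup>j\<close>, where \<open>\<eta>\<close> is positive exactly on a box, gives vanishing
  integrals over boxes as \<open>j \<rightarrow> \<infinity>\<close>.\<close>

lemma fundamental_lemma: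
  fixes h :: "'a::euclidean_space \<Rightarrow> 'b::euclidean_space"
  assumes \<Omega>: "open \<Omega>" and h: "locally_integrable_on h \<Omega>"
    and test0: "\<And>\<phi>. test_function \<Omega> \<phi> \<Longrightarrow> (LINT x|lebesgue_on \<Omega>. \<phi> x *\<^sub>R h x) = 0"
  shows "AE x in lebesgue_on \<Omega>. h x = 0"
proof -
  have \<Omega>s: "\<Omega> \<inter> space lebesgue \<in> sets lebesgue" using \<Omega> by auto
  have int: "integrable lebesgue (\<lambda>x. indicator (cbox a b) x *\<^sub>R h x)" if "cbox a b \<subseteq> \<Omega>" for a b
    using h that by (auto simp: locally_integrable_on_def set_integrable_def)
  have box0: "(LINT x|lebesgue. indicator (box a b) x *\<^sub>R h x) = 0" if ab: "cbox a b \<subseteq> \<Omega>" for a b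
  proof -
    define F where "F j x = (1 - (1 - bump a b x) ^ j) *\<^sub>R (indicator (cbox a b) x *\<^sub>R h x)" for j x
    have "(\<lambda>j. LINT x|lebesgue. F j x) \<longlonglongrightarrow> (LINT x|lebesgue. indicator (box a b) x *\<^sub>R h x)"
    proof (rule integral_dominated_convergence[where w="\<lambda>x. norm (indicator (cbox a b) x *\<^sub>R h x)"])
      have hm: "(\<lambda>x. indicator (cbox a b) x *\<^sub>R h x) \<in> borel_measurable lebesgue"
        using int[OF ab] by (rule borel_measurable_integrable)
      have "(\<lambda>x. indicator (box a b) x *\<^sub>R (indicator (cbox a b) x *\<^sub>R h x)) \<in> borel_measurable lebesgue"
        by (rule borel_measurable_scaleR[OF borel_measurable_indicator hm]) auto
      moreover have "(\<lambda>x. indicator (box a b) x *\<^sub>R (indicator (cbox a b) x *\<^sub>R h x))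
          = (\<lambda>x. indicator (box a b) x *\<^sub>R h x)"
        using box_subset_cbox[of a b] by (auto simp: indicator_def fun_eq_iff)
      ultimately show "(\<lambda>x. indicator (box a b) x *\<^sub>R h x) \<in> borel_measurable lebesgue" by simp
      have "(\<lambda>x. 1 - (1 - bump a b x) ^ j) \<in> borel_measurable lebesgue" for j
        using borel_measurable_continuous_onI[OF smooth_imp_continuous[OF
            test_functionD(1)[OF test_function_bump_power[OF ab, of j]]]]
        by (intro measurable_completion) simp
      then show "F j \<in> borel_measurable lebesgue" for j
        unfolding F_def by (rule borel_measurable_scaleR[OF _ hm])
      show "integrable lebesgue (\<lambda>x. norm (indicator (cbox a b) x *\<^sub>R h x))"
        using int[OF ab] by (rule integrable_norm)
      show "AE x in lebesgue. (\<lambda>j. F j x) \<longlonglongrightarrow> indicator (box a b) x *\<^sub>R h x"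
      proof (rule AE_I2)
        fix x
        show "(\<lambda>j. F j x) \<longlonglongrightarrow> indicator (box a b) x *\<^sub>R h x"
        proof (cases "x \<in> box a b")
          case True
          have "(\<lambda>j. (1 - bump a b x) ^ j) \<longlonglongrightarrow> 0"
            using bump_bounds[of a b x] bump_pos[OF True] by (intro LIMSEQ_power_zero) auto
          then have "(\<lambda>j. F j x) \<longlonglongrightarrow> (1 - 0) *\<^sub>R (indicator (cbox a b) x *\<^sub>R h x)"
            unfolding F_def by (intro tendsto_scaleR tendsto_diff tendsto_const)
          then show ?thesis using True box_subset_cbox[of a b] by (auto simp: indicator_def)
        qed (simp add: F_def bump_eq_0)
      qed
      show "AE x in lebesgue. norm (F j x) \<le> norm (indicator (cbox a b) x *\<^sub>R h x)" for j
      proof (rule AE_I2)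
        fix x
        have "0 \<le> (1 - bump a b x) ^ j" "(1 - bump a b x) ^ j \<le> 1"
          using bump_bounds[of a b x] by (auto intro: power_le_one)
        then have "\<bar>1 - (1 - bump a b x) ^ j\<bar> \<le> 1" by auto
        then show "norm (F j x) \<le> norm (indicator (cbox a b) x *\<^sub>R h x)"
          unfolding F_def norm_scaleR[of "1 - _"] by (intro mult_left_le_one_le) auto
      qed
    qed
    moreover have "(LINT x|lebesgue. F j x) = 0" for j
    proof -
      have "F j x = indicator \<Omega> x *\<^sub>R (1 - (1 - bump a b x) ^ j) *\<^sub>R h x" for x
      proof (cases "x \<in> cbox a b")
        case False
        then have "bump a b x = 0" using box_subset_cbox[of a b] by (intro bump_eq_0) blast
        then show ?thesis by (simp add: F_def)
      qed (use ab in \<open>auto simp: F_def indicator_def\<close>)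
      then show ?thesis
        using test0[OF test_function_bump_power[OF ab, of j]] by (simp add: integral_restrict_space[OF \<Omega>s])
    qed
    ultimately show ?thesis by (simp add: LIMSEQ_const_iff)
  qed
  show ?thesis
  proof (rule AE_lebesgue_on_boxI[OF \<Omega>])
    fix c d assume cd: "cbox c d \<subseteq> \<Omega>"
    have "(\<lambda>x. indicator (box c d) x *\<^sub>R indicator (cbox c d) x *\<^sub>R h x) = (\<lambda>x. indicator (box c d) x *\<^sub>R h x)"
      using box_subset_cbox[of c d] by (auto simp: indicator_def fun_eq_iff)
    then have i: "integrable lebesgue (\<lambda>x. indicator (box c d) x *\<^sub>R h x)"
      using integrable_mult_indicator[OF _ int[OF cd], of "box c d"] by simp
    have "AE x in lebesgue. indicator (box c d) x *\<^sub>R h x = 0"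
    proof (rule integral_over_boxes_eq_0_imp_AE[OF i])
      fix a b
      \<comment> \<open>Cutting an arbitrary box with \<open>box c d\<close> gives a box whose
        closure still lies in the domain, so \<open>box0\<close> applies. The empty intersection is
        separate because the closed box is the closure of the open one only if the latter is
        nonempty.\<close>
      obtain a' b' where ab': "box a b \<inter> box c d = box a' b'" using box_Int_box by blast
      have eq: "indicator (box a b) x *\<^sub>R indicator (box c d) x *\<^sub>R h x = indicator (box a' b') x *\<^sub>R h x" for x
        using ab' by (auto simp: indicator_def)
      show "set_lebesgue_integral lebesgue (box a b) (\<lambda>x. indicator (box c d) x *\<^sub>R h x) = 0"
      proof (cases "box a' b' = {}")
        case False
        have "cbox a' b' = closure (box a' b')" using closure_box[OF False] by simp
        also have "\<dots> \<subseteq> closure (box c d)" using ab' by (intro closure_mono) auto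
        also have "\<dots> \<subseteq> cbox c d" by (intro closure_minimal box_subset_cbox closed_cbox)
        finally show ?thesis unfolding set_lebesgue_integral_def eq using cd by (intro box0) blast
      next
        case True
        show ?thesis unfolding set_lebesgue_integral_def eq True by simp
      qed
    qed
    then have "AE x in lebesgue. x \<in> \<Omega> \<longrightarrow> x \<in> box c d \<longrightarrow> h x = 0"
      by (rule eventually_mono) (auto simp: indicator_def)
    then show "AE x in lebesgue_on \<Omega>. x \<in> box c d \<longrightarrow> h x = 0" by (simp add: AE_restrict_space_iff[OF \<Omega>s])
  qed
qed

section \<open>Weak gradients\<close>

text \<open>The difference of two weak gradients tests to 0 against everything. This makes the
  choice in \<open>weak_grad\<close> harmless: any weak gradient that can be exhibited equals the
  chosen one almost everywhere.\<close>

lemma weak_grad_unique: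
  assumes \<Omega>: "open \<Omega>" and g: "is_weak_grad \<Omega> u g" "is_weak_grad \<Omega> u g'"
  shows "AE x in lebesgue_on \<Omega>. g x = g' x"
proof -
  have l: "locally_integrable_on g \<Omega>" "locally_integrable_on g' \<Omega>" using g by (auto simp: is_weak_grad_def)
  have "AE x in lebesgue_on \<Omega>. g x - g' x = 0"
  proof (rule fundamental_lemma[OF \<Omega>])
    show "locally_integrable_on (\<lambda>x. g x - g' x) \<Omega>"
      using l by (auto simp: locally_integrable_on_def)
    fix \<phi> :: "'a \<Rightarrow> real" assume \<phi>: "test_function \<Omega> \<phi>"
    have "(LINT x|lebesgue_on \<Omega>. \<phi> x *\<^sub>R g x) = (LINT x|lebesgue_on \<Omega>. \<phi> x *\<^sub>R g' x)"
      using g \<phi> unfolding is_weak_grad_def by (metis neg_equal_iff_equal)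
    then show "(LINT x|lebesgue_on \<Omega>. \<phi> x *\<^sub>R (g x - g' x)) = 0"
      using locally_integrable_test_function(1)[OF \<Omega> \<phi> l(1)] locally_integrable_test_function(1)[OF \<Omega> \<phi> l(2)]
      by (simp add: scaleR_diff_right)
  qed
  then show ?thesis by simp
qed

lemma is_weak_grad_diff:
  assumes \<Omega>: "open \<Omega>" and g: "is_weak_grad \<Omega> u g" "is_weak_grad \<Omega> v h"
  shows "is_weak_grad \<Omega> (\<lambda>x. u x - v x) (\<lambda>x. g x - h x)"
proof -
  have l: "locally_integrable_on u \<Omega>" "locally_integrable_on v \<Omega>" "locally_integrable_on g \<Omega>" "locally_integrable_on h \<Omega>"
    using g by (auto simp: is_weak_grad_def)
  show ?thesis unfolding is_weak_grad_def
  proof (intro conjI allI impI)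
    show "locally_integrable_on (\<lambda>x. u x - v x) \<Omega>" "locally_integrable_on (\<lambda>x. g x - h x) \<Omega>"
      using l by (auto simp: locally_integrable_on_def)
    fix \<psi> :: "'a \<Rightarrow> real" assume \<psi>: "test_function \<Omega> \<psi>"
    note i = locally_integrable_test_function[OF \<Omega> \<psi>]
    show "(LINT x|lebesgue_on \<Omega>. (u x - v x) *\<^sub>R grad \<psi> x) = - (LINT x|lebesgue_on \<Omega>. \<psi> x *\<^sub>R (g x - h x))"
      using g \<psi> i(1)[OF l(3)] i(1)[OF l(4)] i(2)[OF l(1)] i(2)[OF l(2)]
      by (simp add: is_weak_grad_def scaleR_diff_left scaleR_diff_right)
  qed
qed

lemma integrable_imp_locally_integrable_on:
  fixes f :: "'a::euclidean_space \<Rightarrow> 'b::euclidean_space"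
  assumes "open \<Omega>" "integrable (lebesgue_on \<Omega>) f"
  shows "locally_integrable_on f \<Omega>"
  unfolding locally_integrable_on_def
proof (intro allI impI)
  fix K assume K: "compact K \<and> K \<subseteq> \<Omega>"
  have "\<Omega> \<inter> space lebesgue \<in> sets lebesgue" using assms(1) by auto
  then have "set_integrable lebesgue \<Omega> f"
    using assms(2) by (simp add: integrable_restrict_space set_integrable_def)
  then show "f absolutely_integrable_on K"
    by (rule set_integrable_subset) (use K borel_compact[of K] in auto)
qed

section \<open>Sobolev functions vanishing on the boundary\<close>

text \<open>Dominated convergence with a fixed h and bounded factors that tend to 0. It handles the
  part of a chain rule in which only the outer derivative varies.\<close>

lemma tendsto_pmass_mult_0:
  fixes h :: "'m \<Rightarrow> 'b::euclidean_space"
  assumes p: "0 \<le> p" and h: "h \<in> LP p M"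
    and c: "\<And>k. c k \<in> borel_measurable M" "\<And>k x. \<bar>c k x\<bar> \<le> 1" "AE x in M. (\<lambda>k. c k x) \<longlonglongrightarrow> 0" and "p > 0"
  shows "(\<lambda>k. pmass p M (\<lambda>x. c k x *\<^sub>R h x)) \<longlonglongrightarrow> 0"
proof -
  have "(\<lambda>k. LINT x|M. norm (c k x *\<^sub>R h x) powr p) \<longlonglongrightarrow> (LINT x|M. 0)"
  proof (rule integral_dominated_convergence[where w="\<lambda>x. norm (h x) powr p"])
    show "AE x in M. (\<lambda>k. norm (c k x *\<^sub>R h x) powr p) \<longlonglongrightarrow> 0"
      using c(3)
    proof (rule eventually_mono)
      fix x assume "(\<lambda>k. c k x) \<longlonglongrightarrow> 0"
      then have "(\<lambda>k. norm (c k x *\<^sub>R h x)) \<longlonglongrightarrow> norm (0 *\<^sub>R h x)" by (intro tendsto_intros)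
      then show "(\<lambda>k. norm (c k x *\<^sub>R h x) powr p) \<longlonglongrightarrow> 0"
        by (intro tendsto_zero_powrI[where b=p]) (use \<open>p > 0\<close> in auto)
    qed
    show "AE x in M. norm (norm (c k x *\<^sub>R h x) powr p) \<le> norm (h x) powr p" for k
    proof (rule AE_I2)
      fix x
      have "norm (c k x *\<^sub>R h x) \<le> norm (h x)"
        using c(2)[of k x] by (simp add: mult_left_le_one_le)
      then show "norm (norm (c k x *\<^sub>R h x) powr p) \<le> norm (h x) powr p" using p by (simp add: powr_mono2)
    qed
    show "(\<lambda>x. norm (c k x *\<^sub>R h x) powr p) \<in> borel_measurable M" for k
      using c(1)[of k] LP_measurable[OF h] by measurable
  qed (use LP_integrable_powr[OF h] in auto)
  then show ?thesis by (simp add: pmass_def)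
qed

text \<open>Tangent inequalities at both points squeeze the remainder between 0 and p times the
  inner product of \<open>flux p y - flux p a\<close> with y - a. Continuity of the flux makes this
  of smaller order, so the origin needs no separate treatment.\<close>

lemma norm_powr_has_derivative:
  fixes a :: "'a::euclidean_space"
  assumes p: "1 < p"
  shows "((\<lambda>x. norm x powr p) has_derivative (\<lambda>v. p * (flux p a \<bullet> v))) (at a)"
  unfolding has_derivative_at_within
proof
  show "bounded_linear (\<lambda>v. p * (flux p a \<bullet> v))"
    by (intro bounded_linear_const_mult bounded_linear_inner_right)
  have le: "\<bar>norm y powr p - norm a powr p - p * (flux p a \<bullet> (y - a))\<bar> \<le> p * norm (flux p y - flux p a) * norm (y - a)" for y
  proof -
    have "0 \<le> norm y powr p - norm a powr p - p * (flux p a \<bullet> (y - a))"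
      using flux_tangent[OF p, of a y] by simp
    moreover have "norm y powr p - norm a powr p - p * (flux p a \<bullet> (y - a))
        \<le> p * ((flux p y - flux p a) \<bullet> (y - a))"
    proof -
      have "flux p y \<bullet> (a - y) = - (flux p y \<bullet> (y - a))" by (simp add: inner_diff_right)
      then have "norm y powr p - p * (flux p y \<bullet> (y - a)) \<le> norm a powr p"
        using flux_tangent[OF p, of y a] by simp
      then show ?thesis by (simp add: inner_diff_left right_diff_distrib)
    qed
    moreover have "(flux p y - flux p a) \<bullet> (y - a) \<le> norm (flux p y - flux p a) * norm (y - a)"
      by (rule norm_cauchy_schwarz)
    then have "p * ((flux p y - flux p a) \<bullet> (y - a)) \<le> p * (norm (flux p y - flux p a) * norm (y - a))"
      using p by (intro mult_left_mono) auto
    ultimately show ?thesis by (simp add: mult.assoc)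
  qed
  have "isCont (flux p) a"
    using continuous_flux[OF p, where 'a='a] by (simp add: continuous_on_eq_continuous_at)
  then have "((\<lambda>y. p * norm (flux p y - flux p a)) \<longlongrightarrow> p * norm (flux p a - flux p a)) (at a)"
    unfolding isCont_def by (intro tendsto_intros)
  then have lim: "((\<lambda>y. p * norm (flux p y - flux p a)) \<longlongrightarrow> 0) (at a)" by simp
  show "((\<lambda>y. (norm y powr p - norm a powr p - p * (flux p a \<bullet> (y - a))) /\<^sub>R norm (y - a)) \<longlongrightarrow> 0) (at a)"
  proof (rule Lim_null_comparison[OF _ lim])
    show "\<forall>\<^sub>F y in at a. norm ((norm y powr p - norm a powr p - p * (flux p a \<bullet> (y - a))) /\<^sub>R norm (y - a))
        \<le> p * norm (flux p y - flux p a)"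
      unfolding eventually_at_filter
      by (intro always_eventually allI impI)
        (use le in \<open>simp add: divide_inverse_commute[symmetric] pos_divide_le_eq\<close>)
  qed
qed

locale bounded_open =
  fixes \<Omega> :: "'a::euclidean_space set" and p :: real
  assumes open_dom: "open \<Omega>" and bounded_dom: "bounded \<Omega>" and p_gt_1: "1 < p"
begin

abbreviation "M \<equiv> lebesgue_on \<Omega>"

lemma p0: "0 \<le> p" "0 < p"
  using p_gt_1 by auto

lemma finite_M: "finite_measure M"
  by (rule finite_measure_lebesgue_on)
    (use open_dom bounded_dom in \<open>auto intro: lmeasurable_open\<close>)

lemma integrable_const_M: "integrable M (\<lambda>x. c)"
  by (rule finite_measure.integrable_const[OF finite_M])

lemma continuous_measurable:
  fixes f :: "'a \<Rightarrow> 'b::euclidean_space"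
  shows "continuous_on UNIV f \<Longrightarrow> f \<in> borel_measurable M"
  using borel_measurable_continuous_onI[of f]
  by (intro measurable_restrict_space1 measurable_completion) simp

lemma test_function_LP:
  assumes "test_function \<Omega> \<phi>"
  shows "\<phi> \<in> LP p M" "grad \<phi> \<in> LP p M"
proof -
  obtain B where B: "\<And>x. \<bar>\<phi> x\<bar> \<le> B \<and> norm (grad \<phi> x) \<le> B" using test_function_bounded[OF assms] by blast
  show "\<phi> \<in> LP p M" "grad \<phi> \<in> LP p M"
    using B by (auto intro!: LP_bounded[OF finite_M p0(1), of _ B] smooth_measurable
        test_functionD(1)[OF assms])
qed

text \<open>Carrying the weak gradient along as a second argument avoids the choice in
  \<open>weak_grad\<close>: \<open>sob u g\<close> says that \<open>u\<close> is in \<open>W1p0 p \<Omega>\<close> with weak gradient \<open>g\<close>.\<close>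

definition sob :: "('a \<Rightarrow> real) \<Rightarrow> ('a \<Rightarrow> 'a) \<Rightarrow> bool" where
  "sob u g \<longleftrightarrow> u \<in> LP p M \<and> g \<in> LP p M \<and> (\<forall>\<epsilon>>0. \<exists>\<phi>. test_function \<Omega> \<phi> \<and>
     pmass p M (\<lambda>x. \<phi> x - u x) < \<epsilon> \<and> pmass p M (\<lambda>x. grad \<phi> x - g x) < \<epsilon>)"

lemma sobD: "sob u g \<Longrightarrow> u \<in> LP p M" "sob u g \<Longrightarrow> g \<in> LP p M"
  by (auto simp: sob_def)

lemma sob_measurable:
  "sob u g \<Longrightarrow> u \<in> borel_measurable M" "sob u g \<Longrightarrow> g \<in> borel_measurable M"
  using sobD LP_measurable by blast+

lemma sob_seq:
  assumes "sob u g"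
  shows "\<exists>\<phi>. (\<forall>k. test_function \<Omega> (\<phi> k)) \<and> (\<lambda>k. pmass p M (\<lambda>x. \<phi> k x - u x)) \<longlonglongrightarrow> 0 \<and>
    (\<lambda>k. pmass p M (\<lambda>x. grad (\<phi> k) x - g x)) \<longlonglongrightarrow> 0"
proof -
  have "\<forall>k. \<exists>\<phi>. test_function \<Omega> \<phi> \<and> pmass p M (\<lambda>x. \<phi> x - u x) < 1 / real (Suc k) \<and>
      pmass p M (\<lambda>x. grad \<phi> x - g x) < 1 / real (Suc k)"
    using assms unfolding sob_def by simp
  then obtain \<phi> where \<phi>: "\<And>k. test_function \<Omega> (\<phi> k)" "\<And>k. pmass p M (\<lambda>x. \<phi> k x - u x) < 1 / real (Suc k)"
      "\<And>k. pmass p M (\<lambda>x. grad (\<phi> k) x - g x) < 1 / real (Suc k)" by metis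
  have "(\<lambda>k. pmass p M (\<lambda>x. \<phi> k x - u x)) \<longlonglongrightarrow> 0"
    by (rule tendsto_sandwich[OF _ _ tendsto_const LIMSEQ_Suc[OF lim_1_over_n]])
      (use \<phi>(2) in \<open>auto intro!: always_eventually less_imp_le simp: pmass_nonneg simp del: of_nat_Suc\<close>)
  moreover have "(\<lambda>k. pmass p M (\<lambda>x. grad (\<phi> k) x - g x)) \<longlonglongrightarrow> 0"
    by (rule tendsto_sandwich[OF _ _ tendsto_const LIMSEQ_Suc[OF lim_1_over_n]])
      (use \<phi>(3) in \<open>auto intro!: always_eventually less_imp_le simp: pmass_nonneg simp del: of_nat_Suc\<close>)
  ultimately show ?thesis using \<phi>(1) by blast
qed

lemma sob_test: "test_function \<Omega> \<phi> \<Longrightarrow> sob \<phi> (grad \<phi>)"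
  unfolding sob_def using test_function_LP[of \<phi>]
  by (auto simp: pmass_def p0 intro!: exI[of _ \<phi>])

lemma sob_closed:
  assumes s: "\<And>k. sob (u k) (g k)" and l: "v \<in> LP p M" "h \<in> LP p M"
    and lim: "(\<lambda>k. pmass p M (\<lambda>x. u k x - v x)) \<longlonglongrightarrow> 0" "(\<lambda>k. pmass p M (\<lambda>x. g k x - h x)) \<longlonglongrightarrow> 0"
  shows "sob v h"
  unfolding sob_def
proof (intro conjI l allI impI)
  fix \<epsilon> :: real assume "\<epsilon> > 0"
  define \<eta> where "\<eta> = \<epsilon> / (2 * 2 powr p)"
  have \<eta>: "\<eta> > 0" "2 powr p * (\<eta> + \<eta>) = \<epsilon>" using \<open>\<epsilon> > 0\<close> by (auto simp: \<eta>_def field_simps)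
  have "\<forall>\<^sub>F k in sequentially. pmass p M (\<lambda>x. u k x - v x) < \<eta> \<and> pmass p M (\<lambda>x. g k x - h x) < \<eta>"
    by (intro eventually_conj order_tendstoD(2)[OF lim(1)] order_tendstoD(2)[OF lim(2)] \<eta>)
  then obtain k where k: "pmass p M (\<lambda>x. u k x - v x) < \<eta>" "pmass p M (\<lambda>x. g k x - h x) < \<eta>"
    unfolding eventually_sequentially by blast
  obtain \<phi> where \<phi>: "test_function \<Omega> \<phi>" "pmass p M (\<lambda>x. \<phi> x - u k x) < \<eta>"
    "pmass p M (\<lambda>x. grad \<phi> x - g k x) < \<eta>"
    using s[of k] \<eta>(1) unfolding sob_def by blast
  have "pmass p M (\<lambda>x. \<phi> x - v x) < 2 powr p * (\<eta> + \<eta>)"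
    by (rule le_less_trans[OF pmass_triangle[OF p0(1) test_function_LP(1)[OF \<phi>(1)] sobD(1)[OF s[of k]] l(1)]])
      (use k \<phi> in \<open>intro mult_strict_left_mono add_strict_mono; simp\<close>)
  moreover have "pmass p M (\<lambda>x. grad \<phi> x - h x) < 2 powr p * (\<eta> + \<eta>)"
    by (rule le_less_trans[OF pmass_triangle[OF p0(1) test_function_LP(2)[OF \<phi>(1)] sobD(2)[OF s[of k]] l(2)]])
      (use k \<phi> in \<open>intro mult_strict_left_mono add_strict_mono; simp\<close>)
  ultimately show "\<exists>\<phi>. test_function \<Omega> \<phi> \<and> pmass p M (\<lambda>x. \<phi> x - v x) < \<epsilon> \<and> pmass p M (\<lambda>x. grad \<phi> x - h x) < \<epsilon>"
    using \<phi>(1) \<eta>(2) by auto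
qed

lemma sob_add:
  assumes "sob u g" "sob v h"
  shows "sob (\<lambda>x. u x + v x) (\<lambda>x. g x + h x)"
  unfolding sob_def
proof (intro conjI allI impI)
  show "(\<lambda>x. u x + v x) \<in> LP p M" "(\<lambda>x. g x + h x) \<in> LP p M"
    using LP_add[OF p0(1)] sobD[OF assms(1)] sobD[OF assms(2)] by blast+
  fix \<epsilon> :: real assume "\<epsilon> > 0"
  define \<eta> where "\<eta> = \<epsilon> / (2 * 2 powr p)"
  have \<eta>: "\<eta> > 0" "2 powr p * (\<eta> + \<eta>) = \<epsilon>" using \<open>\<epsilon> > 0\<close> by (auto simp: \<eta>_def field_simps)
  obtain \<phi> where \<phi>: "test_function \<Omega> \<phi>" "pmass p M (\<lambda>x. \<phi> x - u x) < \<eta>" "pmass p M (\<lambda>x. grad \<phi> x - g x) < \<eta>"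
    using assms(1) \<eta>(1) unfolding sob_def by blast
  obtain \<psi> where \<psi>: "test_function \<Omega> \<psi>" "pmass p M (\<lambda>x. \<psi> x - v x) < \<eta>" "pmass p M (\<lambda>x. grad \<psi> x - h x) < \<eta>"
    using assms(2) \<eta>(1) unfolding sob_def by blast
  note LP = LP_diff[OF p0(1) test_function_LP(1)[OF \<phi>(1)] sobD(1)[OF assms(1)]]
    LP_diff[OF p0(1) test_function_LP(1)[OF \<psi>(1)] sobD(1)[OF assms(2)]]
    LP_diff[OF p0(1) test_function_LP(2)[OF \<phi>(1)] sobD(2)[OF assms(1)]]
    LP_diff[OF p0(1) test_function_LP(2)[OF \<psi>(1)] sobD(2)[OF assms(2)]]
  have "pmass p M (\<lambda>x. (\<phi> x - u x) + (\<psi> x - v x)) < 2 powr p * (\<eta> + \<eta>)"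
    by (rule le_less_trans[OF pmass_add_le[OF p0(1) LP(1,2)]])
      (use \<phi> \<psi> in \<open>intro mult_strict_left_mono add_strict_mono; simp\<close>)
  then have 1: "pmass p M (\<lambda>x. (\<phi> x + \<psi> x) - (u x + v x)) < \<epsilon>" unfolding \<eta>(2) by (simp add: add_diff_add)
  have "pmass p M (\<lambda>x. (grad \<phi> x - g x) + (grad \<psi> x - h x)) < 2 powr p * (\<eta> + \<eta>)"
    by (rule le_less_trans[OF pmass_add_le[OF p0(1) LP(3,4)]])
      (use \<phi> \<psi> in \<open>intro mult_strict_left_mono add_strict_mono; simp\<close>)
  then have 2: "pmass p M (\<lambda>x. grad (\<lambda>x. \<phi> x + \<psi> x) x - (g x + h x)) < \<epsilon>"
    unfolding \<eta>(2) grad_add[OF test_functionD(1)[OF \<phi>(1)] test_functionD(1)[OF \<psi>(1)]]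
    by (simp add: add_diff_add)
  show "\<exists>\<phi>. test_function \<Omega> \<phi> \<and> pmass p M (\<lambda>x. \<phi> x - (u x + v x)) < \<epsilon> \<and>
      pmass p M (\<lambda>x. grad \<phi> x - (g x + h x)) < \<epsilon>"
    using 1 2 test_function_add[OF \<phi>(1) \<psi>(1)] by blast
qed

lemma sob_cmult:
  assumes "sob u g"
  shows "sob (\<lambda>x. c * u x) (\<lambda>x. c *\<^sub>R g x)"
proof -
  obtain \<phi> where \<phi>: "\<And>k. test_function \<Omega> (\<phi> k)"
    "(\<lambda>k. pmass p M (\<lambda>x. \<phi> k x - u x)) \<longlonglongrightarrow> 0" "(\<lambda>k. pmass p M (\<lambda>x. grad (\<phi> k) x - g x)) \<longlonglongrightarrow> 0"
    using sob_seq[OF assms] by blast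
  show ?thesis
  proof (rule sob_closed)
    show "sob (\<lambda>x. c * \<phi> k x) (grad (\<lambda>x. c * \<phi> k x))" for k
      by (intro sob_test test_function_cmult \<phi>)
    show "(\<lambda>x. c * u x) \<in> LP p M" "(\<lambda>x. c *\<^sub>R g x) \<in> LP p M"
      using LP_cmult LP_scaleR sobD[OF assms] by blast+
    have "pmass p M (\<lambda>x. c * \<phi> k x - c * u x) = \<bar>c\<bar> powr p * pmass p M (\<lambda>x. \<phi> k x - u x)" for k
      using pmass_scaleR[of p M c "\<lambda>x. \<phi> k x - u x"] by (simp add: right_diff_distrib)
    then show "(\<lambda>k. pmass p M (\<lambda>x. c * \<phi> k x - c * u x)) \<longlonglongrightarrow> 0"
      using tendsto_mult_right_zero[OF \<phi>(2)] by simp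
    have "pmass p M (\<lambda>x. grad (\<lambda>x. c * \<phi> k x) x - c *\<^sub>R g x) = \<bar>c\<bar> powr p * pmass p M (\<lambda>x. grad (\<phi> k) x - g x)" for k
      using pmass_scaleR[of p M c "\<lambda>x. grad (\<phi> k) x - g x"]
      by (simp add: scaleR_diff_right grad_cmult[OF test_functionD(1)[OF \<phi>(1)]])
    then show "(\<lambda>k. pmass p M (\<lambda>x. grad (\<lambda>x. c * \<phi> k x) x - c *\<^sub>R g x)) \<longlonglongrightarrow> 0"
      using tendsto_mult_right_zero[OF \<phi>(3)] by simp
  qed
qed

lemma sob_diff:
  assumes "sob u g" "sob v h"
  shows "sob (\<lambda>x. u x - v x) (\<lambda>x. g x - h x)"
  using sob_add[OF assms(1) sob_cmult[OF assms(2), of "-1"]] by simp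

lemma sob_zero: "sob (\<lambda>_. 0) (\<lambda>_. 0)"
  using sob_diff[OF sob_test sob_test, OF test_function_zero test_function_zero] by simp

text \<open>Applying the smooth truncation to approximating test functions gives test functions
  again, because w \<ge> 0 keeps the support. What remains is convergence of the functions, by the
  Lipschitz bound, and of the gradients, by the product splitting below.\<close>

lemma sob_pospart:
  assumes s: "sob u g" and w: "smooth w" "\<And>x. 0 \<le> w x" "w \<in> LP p M" "grad w \<in> LP p M" and \<epsilon>: "0 < \<epsilon>"
  shows "sob (\<lambda>x. pospart \<epsilon> (u x - w x)) (\<lambda>x. pospart' \<epsilon> (u x - w x) *\<^sub>R (g x - grad w x))"
proof -
  obtain \<phi> where \<phi>: "\<And>k. test_function \<Omega> (\<phi> k)"
    "(\<lambda>k. pmass p M (\<lambda>x. \<phi> k x - u x)) \<longlonglongrightarrow> 0" "(\<lambda>k. pmass p M (\<lambda>x. grad (\<phi> k) x - g x)) \<longlonglongrightarrow> 0"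
    using sob_seq[OF s] by blast
  \<comment> \<open>Almost everywhere convergence of the approximants is required for the outer
    derivative, which multiplies the fixed function D in the gradient.\<close>
  obtain r where r: "strict_mono r" "AE x in M. (\<lambda>k. \<phi> (r k) x) \<longlonglongrightarrow> u x"
    by (rule LP_convergent_subsequence[OF p_gt_1 test_function_LP(1)[OF \<phi>(1)] sobD(1)[OF s] \<phi>(2)]) blast
  have lim: "(\<lambda>k. pmass p M (\<lambda>x. \<phi> (r k) x - u x)) \<longlonglongrightarrow> 0"
    "(\<lambda>k. pmass p M (\<lambda>x. grad (\<phi> (r k)) x - g x)) \<longlonglongrightarrow> 0"
    using LIMSEQ_subseq_LIMSEQ[OF \<phi>(2) r(1)] LIMSEQ_subseq_LIMSEQ[OF \<phi>(3) r(1)] by (auto simp: o_def)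
  note um = sob_measurable[OF s] LP_measurable[OF w(3)] LP_measurable[OF w(4)]
  note \<phi>LP = test_function_LP[OF \<phi>(1)]
  have pm[measurable]: "pospart \<epsilon> \<in> borel_measurable borel" "pospart' \<epsilon> \<in> borel_measurable borel"
    by (intro borel_measurable_continuous_onI smooth_imp_continuous smooth_pospart continuous_pospart')+
  define D where "D x = g x - grad w x" for x
  have DLP: "D \<in> LP p M" unfolding D_def by (rule LP_diff[OF p0(1) sobD(2)[OF s] w(4)])
  define c where "c k x = pospart' \<epsilon> (\<phi> k x - w x)" for k x
  have c01: "0 \<le> c k x" "c k x \<le> 1" for k x using pospart'_bounds[OF \<epsilon>] by (auto simp: c_def)
  have cm: "c k \<in> borel_measurable M" for k
    unfolding c_def using um LP_measurable[OF \<phi>LP(1)[of k]] by measurable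
  have gr: "grad (\<lambda>x. pospart \<epsilon> (\<phi> k x - w x)) x = c k x *\<^sub>R (grad (\<phi> k) x - grad w x)" for k x
    unfolding c_def using \<epsilon>
    by (intro grad_compose_diff test_functionD(1)[OF \<phi>(1)] w(1) pospart_has_real_derivative) auto
  show ?thesis
  proof (rule sob_closed)
    show "sob (\<lambda>x. pospart \<epsilon> (\<phi> (r k) x - w x)) (grad (\<lambda>x. pospart \<epsilon> (\<phi> (r k) x - w x)))" for k
      by (intro sob_test test_function_pospart \<phi> w \<epsilon>)
    have d: "(\<lambda>x. u x - w x) \<in> LP p M" by (rule LP_diff[OF p0(1) sobD(1)[OF s] w(3)])
    show 1: "(\<lambda>x. pospart \<epsilon> (u x - w x)) \<in> LP p M"
    proof (rule LP_mono[OF p0(1) _ d])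
      show "(\<lambda>x. pospart \<epsilon> (u x - w x)) \<in> borel_measurable M" using um by measurable
      show "AE x in M. norm (pospart \<epsilon> (u x - w x)) \<le> norm (u x - w x)"
        using pospart_lipschitz[OF \<epsilon>, of _ 0] pospart_nonpos[OF \<epsilon>, of 0] by (intro AE_I2) simp
    qed
    show 2: "(\<lambda>x. pospart' \<epsilon> (u x - w x) *\<^sub>R (g x - grad w x)) \<in> LP p M"
    proof (rule LP_mono[OF p0(1) _ DLP])
      show "(\<lambda>x. pospart' \<epsilon> (u x - w x) *\<^sub>R (g x - grad w x)) \<in> borel_measurable M" using um by measurable
      show "AE x in M. norm (pospart' \<epsilon> (u x - w x) *\<^sub>R (g x - grad w x)) \<le> norm (D x)"
        using pospart'_bounds[OF \<epsilon>] by (intro AE_I2) (simp add: D_def mult_left_le_one_le)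
    qed
    show "(\<lambda>k. pmass p M (\<lambda>x. pospart \<epsilon> (\<phi> (r k) x - w x) - pospart \<epsilon> (u x - w x))) \<longlonglongrightarrow> 0"
    proof (rule tendsto_sandwich[OF _ _ tendsto_const lim(1)])
      show "\<forall>\<^sub>F k in sequentially. pmass p M (\<lambda>x. pospart \<epsilon> (\<phi> (r k) x - w x) - pospart \<epsilon> (u x - w x))
          \<le> pmass p M (\<lambda>x. \<phi> (r k) x - u x)"
      proof (intro always_eventually allI)
        fix k
        have dl: "(\<lambda>x. \<phi> (r k) x - u x) \<in> LP p M" by (rule LP_diff[OF p0(1) \<phi>LP(1) sobD(1)[OF s]])
        have le: "\<bar>pospart \<epsilon> (\<phi> (r k) x - w x) - pospart \<epsilon> (u x - w x)\<bar> \<le> \<bar>\<phi> (r k) x - u x\<bar>" for x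
          using pospart_lipschitz[OF \<epsilon>, of "\<phi> (r k) x - w x" "u x - w x"] by simp
        have m: "(\<lambda>x. pospart \<epsilon> (\<phi> (r k) x - w x) - pospart \<epsilon> (u x - w x)) \<in> borel_measurable M"
          using um LP_measurable[OF \<phi>LP(1)[of "r k"]] by measurable
        show "pmass p M (\<lambda>x. pospart \<epsilon> (\<phi> (r k) x - w x) - pospart \<epsilon> (u x - w x))
          \<le> pmass p M (\<lambda>x. \<phi> (r k) x - u x)"
          unfolding pmass_def[of p M "\<lambda>x. \<phi> (r k) x - u x"]
          by (rule pmass_mono[OF LP_mono[OF p0(1) m dl] LP_integrable_powr[OF dl]])
            (use le p0 in \<open>auto intro!: powr_mono2\<close>)
      qed
    qed (simp add: pmass_nonneg)
    define a where "a k x = c (r k) x - pospart' \<epsilon> (u x - w x)" for k x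
    have a1: "\<bar>a k x\<bar> \<le> 1" for k x
      using c01[of "r k" x] pospart'_bounds[OF \<epsilon>, of "u x - w x"] by (auto simp: a_def)
    have am: "a k \<in> borel_measurable M" for k
      unfolding a_def using um cm[of "r k"] by measurable
    have "AE x in M. (\<lambda>k. a k x) \<longlonglongrightarrow> 0"
      using r(2)
    proof (rule eventually_mono)
      fix x assume "(\<lambda>k. \<phi> (r k) x) \<longlonglongrightarrow> u x"
      then have "(\<lambda>k. \<phi> (r k) x - w x) \<longlonglongrightarrow> u x - w x" by (intro tendsto_intros)
      moreover have "isCont (pospart' \<epsilon>) (u x - w x)"
        using continuous_pospart'[of \<epsilon>] by (simp add: continuous_on_eq_continuous_at)
      ultimately have "(\<lambda>k. c (r k) x) \<longlonglongrightarrow> pospart' \<epsilon> (u x - w x)"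
        unfolding c_def using isCont_tendsto_compose by blast
      then show "(\<lambda>k. a k x) \<longlonglongrightarrow> 0" unfolding a_def by (simp add: LIM_zero)
    qed
    then have l2: "(\<lambda>k. pmass p M (\<lambda>x. a k x *\<^sub>R D x)) \<longlonglongrightarrow> 0"
      by (intro tendsto_pmass_mult_0[OF p0(1) DLP am a1 _ p0(2)])
    show "(\<lambda>k. pmass p M (\<lambda>x. grad (\<lambda>x. pospart \<epsilon> (\<phi> (r k) x - w x)) x
        - pospart' \<epsilon> (u x - w x) *\<^sub>R (g x - grad w x))) \<longlonglongrightarrow> 0"
    proof (rule tendsto_sandwich[OF _ _ tendsto_const])
      show "(\<lambda>k. 2 powr p * (pmass p M (\<lambda>x. grad (\<phi> (r k)) x - g x) + pmass p M (\<lambda>x. a k x *\<^sub>R D x))) \<longlonglongrightarrow> 0"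
        using tendsto_mult_right_zero[OF tendsto_add_zero[OF lim(2) l2]] .
      show "\<forall>\<^sub>F k in sequentially. pmass p M (\<lambda>x. grad (\<lambda>x. pospart \<epsilon> (\<phi> (r k) x - w x)) x
        - pospart' \<epsilon> (u x - w x) *\<^sub>R (g x - grad w x))
        \<le> 2 powr p * (pmass p M (\<lambda>x. grad (\<phi> (r k)) x - g x) + pmass p M (\<lambda>x. a k x *\<^sub>R D x))"
      proof (intro always_eventually allI)
        fix k
        have dl: "(\<lambda>x. grad (\<phi> (r k)) x - g x) \<in> LP p M" by (rule LP_diff[OF p0(1) \<phi>LP(2) sobD(2)[OF s]])
        have m: "(\<lambda>x. c (r k) x *\<^sub>R (grad (\<phi> (r k)) x - g x)) \<in> borel_measurable M"
          by (rule borel_measurable_scaleR[OF cm LP_measurable[OF dl]])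
        have cdl: "(\<lambda>x. c (r k) x *\<^sub>R (grad (\<phi> (r k)) x - g x)) \<in> LP p M"
          by (rule LP_mono[OF p0(1) m dl]) (use c01 in \<open>auto simp: mult_left_le_one_le\<close>)
        have adl: "(\<lambda>x. a k x *\<^sub>R D x) \<in> LP p M"
          by (rule LP_mono[OF p0(1) borel_measurable_scaleR[OF am LP_measurable[OF DLP]] DLP])
            (use a1 in \<open>auto simp: mult_left_le_one_le\<close>)
        \<comment> \<open>The error is split into a part with converging gradients and a factor
          bounded by 1, and a part in which D is fixed and only the outer derivative varies; the
          second is covered by \<open>tendsto_pmass_mult_0\<close>.\<close>
        have eq: "grad (\<lambda>x. pospart \<epsilon> (\<phi> (r k) x - w x)) x - pospart' \<epsilon> (u x - w x) *\<^sub>R (g x - grad w x)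
            = c (r k) x *\<^sub>R (grad (\<phi> (r k)) x - g x) + a k x *\<^sub>R D x" for x
          unfolding gr a_def D_def by (simp add: algebra_simps)
        have "pmass p M (\<lambda>x. c (r k) x *\<^sub>R (grad (\<phi> (r k)) x - g x)) \<le> pmass p M (\<lambda>x. grad (\<phi> (r k)) x - g x)"
          unfolding pmass_def[of p M "\<lambda>x. grad (\<phi> (r k)) x - g x"]
          by (rule pmass_mono[OF cdl LP_integrable_powr[OF dl]])
            (use c01 p0 in \<open>auto intro!: powr_mono2 simp: mult_left_le_one_le\<close>)
        then have "2 powr p * (pmass p M (\<lambda>x. c (r k) x *\<^sub>R (grad (\<phi> (r k)) x - g x)) + pmass p M (\<lambda>x. a k x *\<^sub>R D x))
           \<le> 2 powr p * (pmass p M (\<lambda>x. grad (\<phi> (r k)) x - g x) + pmass p M (\<lambda>x. a k x *\<^sub>R D x))"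
          by (intro mult_left_mono) auto
        then show "pmass p M (\<lambda>x. grad (\<lambda>x. pospart \<epsilon> (\<phi> (r k) x - w x)) x
            - pospart' \<epsilon> (u x - w x) *\<^sub>R (g x - grad w x))
            \<le> 2 powr p * (pmass p M (\<lambda>x. grad (\<phi> (r k)) x - g x) + pmass p M (\<lambda>x. a k x *\<^sub>R D x))"
          unfolding eq using pmass_add_le[OF p0(1) cdl adl] by linarith
      qed
    qed (simp add: pmass_nonneg)
  qed
qed

text \<open>The smooth truncations approach the positive part uniformly, hence in L^p on a finite
  measure, while the gradients converge by domination. Since w is not assumed to vanish at the
  boundary, the excess of u over a strictly positive barrier is a legitimate test function.\<close>

lemma sob_truncate:
  assumes s: "sob u g" and w: "smooth w" "\<And>x. 0 \<le> w x" "w \<in> LP p M" "grad w \<in> LP p M"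
  shows "sob (\<lambda>x. max 0 (u x - w x)) (\<lambda>x. if u x > w x then g x - grad w x else 0)"
proof (rule sob_closed)
  define \<epsilon> where "\<epsilon> k = 1 / real (Suc k)" for k
  have \<epsilon>: "0 < \<epsilon> k" for k by (simp add: \<epsilon>_def)
  define D where "D x = g x - grad w x" for x
  have DLP: "D \<in> LP p M" unfolding D_def by (rule LP_diff[OF p0(1) sobD(2)[OF s] w(4)])
  note um[measurable] = sob_measurable[OF s] LP_measurable[OF w(3)] LP_measurable[OF w(4)]
  show s\<epsilon>: "sob (\<lambda>x. pospart (\<epsilon> k) (u x - w x)) (\<lambda>x. pospart' (\<epsilon> k) (u x - w x) *\<^sub>R (g x - grad w x))" for k
    by (intro sob_pospart s w \<epsilon>)
  have d: "(\<lambda>x. u x - w x) \<in> LP p M" by (rule LP_diff[OF p0(1) sobD(1)[OF s] w(3)])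
  show 1: "(\<lambda>x. max 0 (u x - w x)) \<in> LP p M"
    by (rule LP_mono[OF p0(1) _ d]) auto
  show "(\<lambda>x. if u x > w x then g x - grad w x else 0) \<in> LP p M"
    by (rule LP_mono[OF p0(1) _ DLP]) (auto simp: D_def)
  show "(\<lambda>k. pmass p M (\<lambda>x. pospart (\<epsilon> k) (u x - w x) - max 0 (u x - w x))) \<longlonglongrightarrow> 0"
  proof (rule tendsto_sandwich[OF _ _ tendsto_const])
    have "(\<lambda>k. \<epsilon> k powr p) \<longlonglongrightarrow> 0"
      unfolding \<epsilon>_def by (rule tendsto_zero_powrI[OF LIMSEQ_Suc[OF lim_1_over_n] tendsto_const])
        (use p0 in auto)
    then show "(\<lambda>k. \<epsilon> k powr p * measure M (space M)) \<longlonglongrightarrow> 0" by (rule tendsto_mult_left_zero)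
    show "\<forall>\<^sub>F k in sequentially. pmass p M (\<lambda>x. pospart (\<epsilon> k) (u x - w x) - max 0 (u x - w x)) \<le> \<epsilon> k powr p * measure M (space M)"
    proof (intro always_eventually allI)
      fix k
      have "pmass p M (\<lambda>x. pospart (\<epsilon> k) (u x - w x) - max 0 (u x - w x)) \<le> (LINT x|M. \<epsilon> k powr p)"
        by (rule pmass_mono[OF LP_diff[OF p0(1) sobD(1)[OF s\<epsilon>] 1] integrable_const_M])
          (use pospart_approx[OF \<epsilon>] p0 in \<open>auto intro!: powr_mono2\<close>)
      then show "pmass p M (\<lambda>x. pospart (\<epsilon> k) (u x - w x) - max 0 (u x - w x)) \<le> \<epsilon> k powr p * measure M (space M)"
        by (simp add: mult.commute)
    qed
  qed (simp add: pmass_nonneg)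
  define a where "a k x = pospart' (\<epsilon> k) (u x - w x) - (if u x > w x then 1 else 0)" for k x
  have eq: "pospart' (\<epsilon> k) (u x - w x) *\<^sub>R (g x - grad w x) - (if u x > w x then g x - grad w x else 0)
      = a k x *\<^sub>R D x" for k x by (simp add: a_def D_def algebra_simps)
  have pm[measurable]: "pospart' (\<epsilon> k) \<in> borel_measurable borel" for k
    by (intro borel_measurable_continuous_onI continuous_pospart')
  have "(\<lambda>k. pmass p M (\<lambda>x. a k x *\<^sub>R D x)) \<longlonglongrightarrow> 0"
  proof (rule tendsto_pmass_mult_0[OF p0(1) DLP _ _ _ p0(2)])
    show "a k \<in> borel_measurable M" for k unfolding a_def by measurable
    show "\<bar>a k x\<bar> \<le> 1" for k x using pospart'_bounds[OF \<epsilon>[of k], of "u x - w x"] by (auto simp: a_def)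
    show "AE x in M. (\<lambda>k. a k x) \<longlonglongrightarrow> 0"
    proof (rule AE_I2)
      fix x
      show "(\<lambda>k. a k x) \<longlonglongrightarrow> 0"
        using tendsto_diff[OF pospart'_tendsto[of "u x - w x"] tendsto_const[of "if u x > w x then 1 else 0"]]
        unfolding a_def \<epsilon>_def by (cases "u x > w x") auto
    qed
  qed
  then show "(\<lambda>k. pmass p M (\<lambda>x. pospart' (\<epsilon> k) (u x - w x) *\<^sub>R (g x - grad w x)
      - (if u x > w x then g x - grad w x else 0))) \<longlonglongrightarrow> 0" unfolding eq .
qed

lemma sob_max_0:
  assumes "sob u g"
  shows "sob (\<lambda>x. max 0 (u x)) (\<lambda>x. if u x > 0 then g x else 0)"
proof -
  have "grad (\<lambda>_. 0) x = 0" for x :: 'a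
  proof (rule grad_eqI)
    have "(\<bullet>) 0 = (\<lambda>_::'a. 0::real)" by auto
    then show "((\<lambda>_. 0) has_derivative (\<bullet>) 0) (at x)" by simp
  qed
  then have g0: "grad (\<lambda>_::'a. 0) = (\<lambda>_. 0)" by (rule ext)
  show ?thesis
    using sob_truncate[OF assms smooth_const[of 0]] LP_const[OF finite_M, of "0::real"]
      LP_const[OF finite_M, of "0::'a"] by (simp add: g0 cong: if_cong)
qed

text \<open>Integrate the divergence of \<open>(x \<bullet> e) |\<phi>|\<^sup>p e\<close>.\<close>

lemma poincare_test:
  obtains C where "0 < C" "\<And>\<phi>. test_function \<Omega> \<phi> \<Longrightarrow> pmass p M \<phi> \<le> C * pmass p M (grad \<phi>)"
proof -
  obtain e :: 'a where e: "e \<in> Basis" by (metis SOME_Basis)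
  obtain R where R: "R > 0" "\<And>x. x \<in> \<Omega> \<Longrightarrow> norm x \<le> R"
    using bounded_dom unfolding bounded_pos by blast
  \<comment> \<open>On the domain the weight x \<bullet> e is at most R in absolute value, so the
    mixed term contains at most \<open>p * R * \<eta> = 1/2\<close> of |\<phi>|^p. This is absorbed
    by the full |\<phi>|^p that comes from differentiating the weight.\<close>
  define \<eta> where "\<eta> = 1 / (2 * p * R)"
  have \<eta>: "\<eta> > 0" "p * R * \<eta> = 1 / 2" using p0 R by (auto simp: \<eta>_def)
  define C where "C = 2 * (p * R * \<eta> powr (1 - p))"
  have "C > 0" using p0 R \<eta> by (simp add: C_def)
  moreover have "pmass p M \<phi> \<le> C * pmass p M (grad \<phi>)" if \<phi>: "test_function \<Omega> \<phi>" for \<phi>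
  proof -
    note t = test_functionD[OF \<phi>]
    note LP = test_function_LP[OF \<phi>]
    define f' where "f' x v = (x \<bullet> e) * (p * (flux p (\<phi> x) \<bullet> (grad \<phi> x \<bullet> v))) + (v \<bullet> e) * norm (\<phi> x) powr p" for x v
    have d: "((\<lambda>x. (x \<bullet> e) * norm (\<phi> x) powr p) has_derivative f' x) (at x)" for x
    proof -
      have 1: "((\<lambda>x. x \<bullet> e) has_derivative (\<lambda>v. v \<bullet> e)) (at x)" by (auto intro!: derivative_eq_intros)
      have 2: "((\<lambda>x. norm (\<phi> x) powr p) has_derivative (\<lambda>v. p * (flux p (\<phi> x) \<bullet> (grad \<phi> x \<bullet> v)))) (at x)"
        by (rule has_derivative_compose[OF smooth_has_derivative_grad[OF t(1)] norm_powr_has_derivative[OF p_gt_1]])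
      show ?thesis unfolding f'_def by (rule has_derivative_mult[OF 1 2])
    qed
    have c\<phi>: "continuous_on UNIV \<phi>" "continuous_on UNIV (grad \<phi>)"
      using t(1) by (auto intro: smooth_imp_continuous smooth_imp_continuous_grad)
    have cf: "continuous_on UNIV (\<lambda>x. flux p (\<phi> x))"
      by (rule continuous_on_compose2[OF continuous_flux[OF p_gt_1] c\<phi>(1)]) auto
    have c: "continuous_on UNIV (\<lambda>x. f' x e)"
      unfolding f'_def using p0
      by (intro continuous_on_add continuous_on_mult continuous_on_inner continuous_on_const
          continuous_on_id cf c\<phi> continuous_on_powr' continuous_on_norm) auto
    have int: "integrable M (\<lambda>x. f' x e)" and int0: "(LINT x|M. f' x e) = 0"
      by (rule integral_directional_derivative_eq_0[OF open_dom t(2,3) _ d c],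
          drule not_in_support, simp)+
    have le: "\<bar>(x \<bullet> e) * (p * (flux p (\<phi> x) \<bullet> (grad \<phi> x \<bullet> e)))\<bar>
        \<le> (1/2) * norm (\<phi> x) powr p + (C / 2) * norm (grad \<phi> x) powr p" if "x \<in> \<Omega>" for x
    proof -
      have "\<bar>x \<bullet> e\<bar> \<le> R" using R(2)[OF that] Basis_le_norm[OF e, of x] by linarith
      have "norm (grad \<phi> x \<bullet> e) \<le> norm (grad \<phi> x)" using Basis_le_norm[OF e] by simp
      then have "\<bar>flux p (\<phi> x) \<bullet> (grad \<phi> x \<bullet> e)\<bar> \<le> norm (\<phi> x) powr (p - 1) * norm (grad \<phi> x)"
        using flux_inner_le[of p "\<phi> x" "grad \<phi> x \<bullet> e"] by (meson mult_left_mono order_trans powr_ge_zero)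
      also have "\<dots> \<le> \<eta> * norm (\<phi> x) powr p + \<eta> powr (1 - p) * norm (grad \<phi> x) powr p"
        using p_gt_1 \<eta> by (intro powr_mult_le_eta) auto
      finally have "\<bar>x \<bullet> e\<bar> * \<bar>p * (flux p (\<phi> x) \<bullet> (grad \<phi> x \<bullet> e))\<bar>
          \<le> R * (p * (\<eta> * norm (\<phi> x) powr p + \<eta> powr (1 - p) * norm (grad \<phi> x) powr p))"
        using \<open>\<bar>x \<bullet> e\<bar> \<le> R\<close> p0 R(1) by (intro mult_mono) (auto simp: abs_mult)
      also have "\<dots> = (p * R * \<eta>) * norm (\<phi> x) powr p + (C / 2) * norm (grad \<phi> x) powr p"
        by (simp add: C_def algebra_simps)
      finally show ?thesis unfolding \<eta>(2) by (simp add: abs_mult)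
    qed
    have "0 = (LINT x|M. f' x e)" using int0 by simp
    also have "(LINT x|M. f' x e) \<ge> (LINT x|M. (1/2) * norm (\<phi> x) powr p - (C / 2) * norm (grad \<phi> x) powr p)"
    proof (rule integral_mono[OF _ int])
      show "integrable M (\<lambda>x. (1/2) * norm (\<phi> x) powr p - (C / 2) * norm (grad \<phi> x) powr p)"
        using LP_integrable_powr[OF LP(1)] LP_integrable_powr[OF LP(2)] by auto
      fix x assume "x \<in> space M"
      then have "x \<in> \<Omega>" by simp
      have ee: "e \<bullet> e = 1" using e by simp
      show "(1/2) * norm (\<phi> x) powr p - (C / 2) * norm (grad \<phi> x) powr p \<le> f' x e"
        unfolding f'_def ee using le[OF \<open>x \<in> \<Omega>\<close>] by (simp add: abs_le_iff)
    qed
    also have "(LINT x|M. (1/2) * norm (\<phi> x) powr p - (C / 2) * norm (grad \<phi> x) powr p)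
        = (1/2) * pmass p M \<phi> - (C / 2) * pmass p M (grad \<phi>)"
      using LP_integrable_powr[OF LP(1)] LP_integrable_powr[OF LP(2)] by (simp add: pmass_def)
    finally show ?thesis by simp
  qed
  ultimately show ?thesis by (rule that)
qed

text \<open>Passage to the limit along approximating test functions; the two extra factors
  \<open>2 powr p\<close> come from going from u to the approximant and from its gradient back to
  g.\<close>

lemma poincare:
  obtains C where "0 < C" "\<And>u g. sob u g \<Longrightarrow> pmass p M u \<le> C * pmass p M g"
proof -
  obtain C where C: "0 < C" "\<And>\<phi>. test_function \<Omega> \<phi> \<Longrightarrow> pmass p M \<phi> \<le> C * pmass p M (grad \<phi>)"
    using poincare_test by blast
  have "pmass p M u \<le> (2 powr p * C * 2 powr p) * pmass p M g" if s: "sob u g" for u g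
  proof -
    obtain \<phi> where \<phi>: "\<And>k. test_function \<Omega> (\<phi> k)"
      "(\<lambda>k. pmass p M (\<lambda>x. \<phi> k x - u x)) \<longlonglongrightarrow> 0" "(\<lambda>k. pmass p M (\<lambda>x. grad (\<phi> k) x - g x)) \<longlonglongrightarrow> 0"
      using sob_seq[OF s] by blast
    show ?thesis
    proof (rule pmass_le_limit)
      fix k
      have "pmass p M u \<le> 2 powr p * (pmass p M (\<lambda>x. u x - \<phi> k x) + pmass p M (\<phi> k))"
        using pmass_add_le[OF p0(1) LP_diff[OF p0(1) sobD(1)[OF s] test_function_LP(1)[OF \<phi>(1)[of k]]]
            test_function_LP(1)[OF \<phi>(1)[of k]]] by simp
      also have "\<dots> \<le> 2 powr p * (pmass p M (\<lambda>x. \<phi> k x - u x) + C * pmass p M (grad (\<phi> k)))"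
        using C(2)[OF \<phi>(1)[of k]] by (simp add: pmass_minus_commute[of p M u])
      also have "pmass p M (grad (\<phi> k)) \<le> 2 powr p * (pmass p M (\<lambda>x. grad (\<phi> k) x - g x) + pmass p M g)"
        using pmass_add_le[OF p0(1) LP_diff[OF p0(1) test_function_LP(2)[OF \<phi>(1)[of k]] sobD(2)[OF s]] sobD(2)[OF s]]
        by simp
      finally show "pmass p M u \<le> 2 powr p * (pmass p M (\<lambda>x. \<phi> k x - u x)
          + C * (2 powr p * (pmass p M (\<lambda>x. grad (\<phi> k) x - g x) + pmass p M g)))"
        using C(1) by simp
    next
      have "(\<lambda>k. 2 powr p * (pmass p M (\<lambda>x. \<phi> k x - u x)
          + C * (2 powr p * (pmass p M (\<lambda>x. grad (\<phi> k) x - g x) + pmass p M g))))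
        \<longlonglongrightarrow> 2 powr p * (0 + C * (2 powr p * (0 + pmass p M g)))"
        by (intro tendsto_intros \<phi>)
      then show "(\<lambda>k. 2 powr p * (pmass p M (\<lambda>x. \<phi> k x - u x)
          + C * (2 powr p * (pmass p M (\<lambda>x. grad (\<phi> k) x - g x) + pmass p M g))))
        \<longlonglongrightarrow> 2 powr p * C * 2 powr p * pmass p M g" by (simp add: mult_ac)
    qed
  qed
  then show ?thesis using that[of "2 powr p * C * 2 powr p"] C(1) by simp
qed

text \<open>Classical integration by parts holds for the approximants, and a fixed test function
  with its gradient is bounded, so both sides pass to the L^p limit.\<close>

lemma sob_is_weak_grad:
  assumes s: "sob u g"
  shows "is_weak_grad \<Omega> u g"
  unfolding is_weak_grad_def
proof (intro conjI allI impI)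
  have p1: "1 \<le> p" using p_gt_1 by simp
  note LPi = LP_integrable[OF finite_M p1]
  show "locally_integrable_on u \<Omega>" "locally_integrable_on g \<Omega>"
    using integrable_imp_locally_integrable_on[OF open_dom LPi] sobD[OF s] by blast+
  fix \<psi> assume \<psi>: "test_function \<Omega> \<psi>"
  obtain \<phi> where \<phi>: "\<And>k. test_function \<Omega> (\<phi> k)"
    "(\<lambda>k. pmass p M (\<lambda>x. \<phi> k x - u x)) \<longlonglongrightarrow> 0" "(\<lambda>k. pmass p M (\<lambda>x. grad (\<phi> k) x - g x)) \<longlonglongrightarrow> 0"
    using sob_seq[OF s] by blast
  obtain B where B: "0 \<le> B" "\<And>x. \<bar>\<psi> x\<bar> \<le> B" "\<And>x. norm (grad \<psi> x) \<le> B"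
    using test_function_bounded[OF \<psi>] by blast
  have li: "locally_integrable_on f \<Omega>" if "f \<in> LP p M" for f :: "'a \<Rightarrow> 'b::euclidean_space"
    by (rule integrable_imp_locally_integrable_on[OF open_dom LPi[OF that]])
  have i1: "integrable M (\<lambda>x. v x *\<^sub>R grad \<psi> x)" if "v \<in> LP p M" for v :: "'a \<Rightarrow> real"
    by (rule locally_integrable_test_function(2)[OF open_dom \<psi> li[OF that]])
  have i2: "integrable M (\<lambda>x. \<psi> x *\<^sub>R h x)" if "h \<in> LP p M" for h :: "'a \<Rightarrow> 'a"
    by (rule locally_integrable_test_function(1)[OF open_dom \<psi> li[OF that]])
  have l1: "(\<lambda>k. LINT x|M. \<phi> k x *\<^sub>R grad \<psi> x) \<longlonglongrightarrow> (LINT x|M. u x *\<^sub>R grad \<psi> x)"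
  proof (rule LP_tendsto_integral[OF finite_M p_gt_1 test_function_LP(1)[OF \<phi>(1)] sobD(1)[OF s] \<phi>(2)
        i1[OF test_function_LP(1)[OF \<phi>(1)]] i1[OF sobD(1)[OF s]] _ B(1)])
    fix k
    show "AE x in M. norm (\<phi> k x *\<^sub>R grad \<psi> x - u x *\<^sub>R grad \<psi> x) \<le> B * norm (\<phi> k x - u x)"
      using B(3) by (auto intro!: AE_I2 mult_right_mono simp: mult.commute[of B] scaleR_diff_left[symmetric] mult_left_mono)
  qed
  have l2: "(\<lambda>k. LINT x|M. \<psi> x *\<^sub>R grad (\<phi> k) x) \<longlonglongrightarrow> (LINT x|M. \<psi> x *\<^sub>R g x)"
  proof (rule LP_tendsto_integral[OF finite_M p_gt_1 test_function_LP(2)[OF \<phi>(1)] sobD(2)[OF s] \<phi>(3)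
        i2[OF test_function_LP(2)[OF \<phi>(1)]] i2[OF sobD(2)[OF s]] _ B(1)])
    fix k
    show "AE x in M. norm (\<psi> x *\<^sub>R grad (\<phi> k) x - \<psi> x *\<^sub>R g x) \<le> B * norm (grad (\<phi> k) x - g x)"
      using B(2) by (auto intro!: AE_I2 mult_right_mono simp: scaleR_diff_right[symmetric])
  qed
  have "(LINT x|M. \<phi> k x *\<^sub>R grad \<psi> x) = - (LINT x|M. \<psi> x *\<^sub>R grad (\<phi> k) x)" for k
  proof (rule euclidean_eqI)
    fix b :: 'a assume "b \<in> Basis"
    have "(LINT x|M. \<phi> k x *\<^sub>R grad \<psi> x) \<bullet> b = (LINT x|M. \<phi> k x * (grad \<psi> x \<bullet> b))"
      using integral_inner_left[OF i1[OF test_function_LP(1)[OF \<phi>(1)[of k]]], of b] by simp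
    also have "\<dots> = - (LINT x|M. \<psi> x * (grad (\<phi> k) x \<bullet> b))"
      by (rule test_function_integral_by_parts(3)[OF open_dom \<psi> smooth_has_derivative_grad
            smooth_imp_continuous_grad]; rule test_functionD(1)[OF \<phi>(1)])
    also have "(LINT x|M. \<psi> x * (grad (\<phi> k) x \<bullet> b)) = (LINT x|M. \<psi> x *\<^sub>R grad (\<phi> k) x) \<bullet> b"
      using integral_inner_left[OF i2[OF test_function_LP(2)[OF \<phi>(1)[of k]]], of b] by simp
    finally show "(LINT x|M. \<phi> k x *\<^sub>R grad \<psi> x) \<bullet> b = (- (LINT x|M. \<psi> x *\<^sub>R grad (\<phi> k) x)) \<bullet> b" by simp
  qed
  then have "(\<lambda>k. - (LINT x|M. \<psi> x *\<^sub>R grad (\<phi> k) x)) \<longlonglongrightarrow> (LINT x|M. u x *\<^sub>R grad \<psi> x)" using l1 by simp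
  then show "(LINT x|M. u x *\<^sub>R grad \<psi> x) = - (LINT x|M. \<psi> x *\<^sub>R g x)"
    using tendsto_minus[OF l2] by (rule LIMSEQ_unique)
qed

section \<open>Identification of \<open>sob\<close> with the space \<open>W1p0\<close>\<close>

lemma Lp_eq_LP: "Lp p \<Omega> = LP p M"
  by (simp add: Lp_def LP_def)

lemma weak_grad_AE:
  assumes "is_weak_grad \<Omega> u g"
  shows "is_weak_grad \<Omega> u (weak_grad \<Omega> u)" "AE x in M. weak_grad \<Omega> u x = g x"
proof -
  show 1: "is_weak_grad \<Omega> u (weak_grad \<Omega> u)"
    unfolding weak_grad_def using assms by (rule someI[of "is_weak_grad \<Omega> u"])
  show "AE x in M. weak_grad \<Omega> u x = g x" by (rule weak_grad_unique[OF open_dom 1 assms])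
qed

lemma weak_grad_LP:
  assumes "is_weak_grad \<Omega> u g" "g \<in> LP p M"
  shows "weak_grad \<Omega> u \<in> LP p M"
proof -
  note w = weak_grad_AE[OF assms(1)]
  have m: "weak_grad \<Omega> u \<in> borel_measurable M"
    by (rule locally_integrable_measurable[OF open_dom]) (use w(1) in \<open>simp add: is_weak_grad_def\<close>)
  have "AE x in M. g x = weak_grad \<Omega> u x" using w(2) by (rule eventually_mono) simp
  then show ?thesis by (rule LP_AE_cong[OF assms(2) m])
qed

text \<open>The norm refers to the weak gradient chosen for the difference. Uniqueness replaces it
  by the difference of gradients, so smallness of the norm becomes smallness of the two masses in
  \<open>sob\<close>.\<close>

lemma W1p_norm_diff_test:
  assumes u: "u \<in> LP p M" "g \<in> LP p M" "is_weak_grad \<Omega> u g" and \<phi>: "test_function \<Omega> \<phi>"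
  shows "W1p_norm p \<Omega> (\<lambda>x. u x - \<phi> x) =
    (pmass p M (\<lambda>x. \<phi> x - u x) + pmass p M (\<lambda>x. grad \<phi> x - g x)) powr (1 / p)"
proof -
  let ?w = "weak_grad \<Omega> (\<lambda>x. u x - \<phi> x)"
  have wk: "is_weak_grad \<Omega> (\<lambda>x. u x - \<phi> x) (\<lambda>x. g x - grad \<phi> x)"
    by (rule is_weak_grad_diff[OF open_dom u(3) sob_is_weak_grad[OF sob_test[OF \<phi>]]])
  note d = LP_diff[OF p0(1) u(1) test_function_LP(1)[OF \<phi>]] LP_diff[OF p0(1) u(2) test_function_LP(2)[OF \<phi>]]
  note w = weak_grad_LP[OF wk d(2)]
  have "(LINT x|M. \<bar>u x - \<phi> x\<bar> powr p + norm (?w x) powr p) = pmass p M (\<lambda>x. u x - \<phi> x) + pmass p M ?w"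
    using LP_integrable_powr[OF d(1)] LP_integrable_powr[OF w] by (simp add: pmass_def)
  also have "pmass p M ?w = pmass p M (\<lambda>x. g x - grad \<phi> x)"
    by (rule pmass_cong_AE[OF LP_measurable[OF w] LP_measurable[OF d(2)] weak_grad_AE(2)[OF wk]])
  finally show ?thesis unfolding W1p_norm_def
    by (simp add: pmass_minus_commute[of p M u] pmass_minus_commute[of p M g])
qed

lemma sob_imp_W1p0:
  assumes s: "sob u g"
  shows "u \<in> W1p0 p \<Omega>" "AE x in M. weak_grad \<Omega> u x = g x"
proof -
  note wg = sob_is_weak_grad[OF s]
  show "AE x in M. weak_grad \<Omega> u x = g x" by (rule weak_grad_AE(2)[OF wg])
  obtain \<phi> where \<phi>: "\<And>k. test_function \<Omega> (\<phi> k)"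
    "(\<lambda>k. pmass p M (\<lambda>x. \<phi> k x - u x)) \<longlonglongrightarrow> 0" "(\<lambda>k. pmass p M (\<lambda>x. grad (\<phi> k) x - g x)) \<longlonglongrightarrow> 0"
    using sob_seq[OF s] by blast
  have "(\<lambda>k. W1p_norm p \<Omega> (\<lambda>x. u x - \<phi> k x)) \<longlonglongrightarrow> 0"
    unfolding W1p_norm_diff_test[OF sobD(1)[OF s] sobD(2)[OF s] wg \<phi>(1)]
    using tendsto_add_zero[OF \<phi>(2,3)] p0
    by (intro tendsto_zero_powrI[where b="1/p"]) (auto simp: pmass_nonneg intro!: always_eventually add_nonneg_nonneg)
  then show "u \<in> W1p0 p \<Omega>"
    unfolding W1p0_def W1p_def Lp_eq_LP using sobD(1)[OF s] wg weak_grad_LP[OF wg sobD(2)[OF s]] \<phi>(1) by blast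
qed

text \<open>With the converse above, the test functions of a weak solution are exactly the first
  components of \<open>sob\<close>, so equations proved for \<open>sob\<close> pairs cover all of
  them.\<close>

lemma W1p0_imp_sob:
  assumes "u \<in> W1p0 p \<Omega>"
  shows "sob u (weak_grad \<Omega> u)"
proof -
  let ?G = "weak_grad \<Omega> u"
  have u: "u \<in> LP p M" "?G \<in> LP p M" "\<exists>g. is_weak_grad \<Omega> u g"
    using assms by (auto simp: W1p0_def W1p_def Lp_eq_LP)
  then have G: "is_weak_grad \<Omega> u ?G" using weak_grad_AE(1) by blast
  obtain \<phi> where \<phi>: "\<And>k. test_function \<Omega> (\<phi> k)" "(\<lambda>k. W1p_norm p \<Omega> (\<lambda>x. u x - \<phi> k x)) \<longlonglongrightarrow> 0"
    using assms by (auto simp: W1p0_def)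
  have "(\<lambda>k. W1p_norm p \<Omega> (\<lambda>x. u x - \<phi> k x) powr p) \<longlonglongrightarrow> 0"
    by (rule tendsto_zero_powrI[OF \<phi>(2) tendsto_const]) (use p0 in \<open>auto simp: W1p_norm_def\<close>)
  then have lim: "(\<lambda>k. pmass p M (\<lambda>x. \<phi> k x - u x) + pmass p M (\<lambda>x. grad (\<phi> k) x - ?G x)) \<longlonglongrightarrow> 0"
    unfolding W1p_norm_diff_test[OF u(1,2) G \<phi>(1)] using p0 by (simp add: powr_powr pmass_nonneg)
  show ?thesis
  proof (rule sob_closed[OF sob_test[OF \<phi>(1)] u(1,2)])
    show "(\<lambda>k. pmass p M (\<lambda>x. \<phi> k x - u x)) \<longlonglongrightarrow> 0"
      by (rule tendsto_sandwich[OF _ _ tendsto_const lim]) (auto simp: pmass_nonneg)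
    show "(\<lambda>k. pmass p M (\<lambda>x. grad (\<phi> k) x - ?G x)) \<longlonglongrightarrow> 0"
      by (rule tendsto_sandwich[OF _ _ tendsto_const lim]) (auto simp: pmass_nonneg)
  qed
qed

end

section \<open>The convex singular problem: existence of minimizers\<close>

text \<open>The real \<open>powr\<close> takes the same value at s and -s. Powers of functions may
  thus be treated as powers of norms before any sign is known.\<close>

lemma norm_powr_real: "norm (s::real) powr a = s powr a"
  using uminus_powr_eq[of s a] by (cases "0 \<le> s") auto

lemma powr_midpoint_concave:
  fixes s t a :: real
  assumes "0 < a" "a < 1" "0 \<le> s" "0 \<le> t"
  shows "(s powr a + t powr a) / 2 \<le> ((1/2) * (s + t)) powr a"
proof (cases "s + t = 0")
  case False
  define m where "m = (1/2) * (s + t)"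
  have m: "m > 0" using False assms by (simp add: m_def)
  have "s powr a + t powr a \<le> (m powr a + a * m powr (a - 1) * (s - m)) + (m powr a + a * m powr (a - 1) * (t - m))"
    using powr_tangent_concave[OF assms(1,2) m] assms by (intro add_mono) auto
  also have "\<dots> = 2 * m powr a + a * m powr (a - 1) * (s + t - 2 * m)" by (simp add: algebra_simps)
  also have "\<dots> = 2 * m powr a" by (simp add: m_def)
  finally show ?thesis by (simp add: m_def)
qed (use assms in \<open>auto simp: add_nonneg_eq_0_iff\<close>)

locale energy = bounded_open +
  fixes q \<beta> lam \<delta> :: real
  assumes q: "1 < q" "q < p" and \<beta>: "0 < \<beta>" and lam: "0 < lam" and \<delta>: "0 < \<delta>" "\<delta> < 1"
begin

definition source :: "('a \<Rightarrow> real) \<Rightarrow> bool" where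
  "source h \<longleftrightarrow> h \<in> borel_measurable M \<and> (\<exists>B. AE x in M. 0 \<le> h x \<and> h x \<le> B)"

definition admissible :: "('a \<Rightarrow> real) \<Rightarrow> ('a \<Rightarrow> 'a) \<Rightarrow> bool" where
  "admissible u g \<longleftrightarrow> sob u g \<and> (AE x in M. 0 \<le> u x)"

definition J :: "('a \<Rightarrow> real) \<Rightarrow> ('a \<Rightarrow> real) \<Rightarrow> ('a \<Rightarrow> 'a) \<Rightarrow> real" where
  "J h u g = pmass p M g / p + \<beta> * (pmass q M g / q)
     - lam / (1 - \<delta>) * (LINT x|M. u x powr (1 - \<delta>)) - (LINT x|M. h x * u x)"

definition minimizer :: "('a \<Rightarrow> real) \<Rightarrow> ('a \<Rightarrow> real) \<Rightarrow> ('a \<Rightarrow> 'a) \<Rightarrow> bool" where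
  "minimizer h u g \<longleftrightarrow> admissible u g \<and> (\<forall>v k. admissible v k \<longrightarrow> J h u g \<le> J h v k)"

lemma sourceD: "source h \<Longrightarrow> h \<in> borel_measurable M"
  by (simp add: source_def)

lemma source_bound:
  assumes "source h"
  obtains B where "0 \<le> B" "AE x in M. 0 \<le> h x \<and> h x \<le> B"
proof -
  obtain B where "AE x in M. 0 \<le> h x \<and> h x \<le> B" using assms by (auto simp: source_def)
  then have "AE x in M. 0 \<le> h x \<and> h x \<le> max 0 B" by (rule eventually_mono) auto
  then show ?thesis by (intro that[of "max 0 B"]) auto
qed

lemma q0: "0 \<le> q" "q \<le> p"
  using q by auto

lemma LP_q: "(f :: 'a \<Rightarrow> 'b::euclidean_space) \<in> LP p M \<Longrightarrow> f \<in> LP q M"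
  by (rule LP_le[OF finite_M q0])

lemma integrable_sob: "sob u g \<Longrightarrow> integrable M u"
  using LP_integrable[OF finite_M _ sobD(1)] p_gt_1 by simp

lemma integrable_source:
  assumes "source h" "sob u g"
  shows "integrable M (\<lambda>x. h x * u x)"
proof -
  obtain B where B: "0 \<le> B" "AE x in M. 0 \<le> h x \<and> h x \<le> B" by (rule source_bound[OF assms(1)])
  show ?thesis
  proof (rule Bochner_Integration.integrable_bound[OF integrable_mult_right[OF integrable_sob[OF assms(2)], of B]])
    show "(\<lambda>x. h x * u x) \<in> borel_measurable M"
      using sourceD[OF assms(1)] sob_measurable(1)[OF assms(2)] by (rule borel_measurable_times)
    show "AE x in M. norm (h x * u x) \<le> norm (B * u x)"
      using B(2) by (rule eventually_mono) (auto simp: abs_mult intro!: mult_right_mono)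
  qed
qed

lemma integrable_sing:
  assumes "sob u g"
  shows "integrable M (\<lambda>x. u x powr (1 - \<delta>))"
  using LP_integrable_powr_le[OF finite_M _ _ sobD(1)[OF assms], of "1 - \<delta>"] \<delta> p_gt_1
  by (simp add: norm_powr_real flip: real_norm_def)

section \<open>Coercivity and quantitative convexity of \<open>J\<close>\<close>

text \<open>The two subtracted integrands grow at most linearly in u. A small multiple of |u|^p plus
  a constant dominates them, and the Poincare inequality turns it into half of the p-energy.\<close>

lemma coercive:
  assumes h: "source h"
  shows "\<exists>K. \<forall>u g. admissible u g \<longrightarrow> pmass p M g / (2 * p) - K \<le> J h u g"
proof -
  obtain B where B: "0 \<le> B" "AE x in M. 0 \<le> h x \<and> h x \<le> B" by (rule source_bound[OF h])
  obtain C where C: "0 < C" "\<And>u g. sob u g \<Longrightarrow> pmass p M u \<le> C * pmass p M g" using poincare by blast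
  define c where "c = lam / (1 - \<delta>)"
  have c: "0 < c" using lam \<delta> by (simp add: c_def)
  \<comment> \<open>Chosen so that \<open>(c + B) * \<eta> * C = 1 / (2 * p)\<close>, which is half
    of the coefficient 1/p of the p-energy.\<close>
  define \<eta> where "\<eta> = 1 / (2 * p * C * (c + B))"
  have \<eta>: "0 < \<eta>" using p0 C c B by (auto simp: \<eta>_def intro!: mult_pos_pos add_pos_nonneg)
  have \<eta>e: "(c + B) * \<eta> * C = 1 / (2 * p)" using p0 C c B by (simp add: \<eta>_def divide_simps)
  define L where "L = c + (c + B) * \<eta> powr (1 / (1 - p))"
  define \<mu> where "\<mu> = measure M (space M)"
  have "pmass p M g / (2 * p) - L * \<mu> \<le> J h u g" if cu: "admissible u g" for u g
  proof -
    have s: "sob u g" and u0: "AE x in M. 0 \<le> u x" using cu by (auto simp: admissible_def)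
    have i1: "integrable M (\<lambda>x. u x powr (1 - \<delta>))" by (rule integrable_sing[OF s])
    have i2: "integrable M (\<lambda>x. h x * u x)" by (rule integrable_source[OF h s])
    have ip: "integrable M (\<lambda>x. norm (u x) powr p)" by (rule LP_integrable_powr[OF sobD(1)[OF s]])
    have "c * (LINT x|M. u x powr (1 - \<delta>)) + (LINT x|M. h x * u x)
        = (LINT x|M. c * u x powr (1 - \<delta>) + h x * u x)" using i1 i2 by simp
    also have "\<dots> \<le> (LINT x|M. (c + B) * \<eta> * norm (u x) powr p + L)"
    proof (rule integral_mono_AE)
      show "AE x in M. c * u x powr (1 - \<delta>) + h x * u x \<le> (c + B) * \<eta> * norm (u x) powr p + L"
        using u0 B(2)
      proof (rule eventually_elim2)
        fix x assume x: "0 \<le> u x" "0 \<le> h x \<and> h x \<le> B"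
        have "u x powr (1 - \<delta>) \<le> 1 + u x"
          using powr_le_one_plus[of "1 - \<delta>" 1 "u x"] \<delta> x by simp
        then have "c * u x powr (1 - \<delta>) \<le> c * (1 + u x)" using c by (intro mult_left_mono) auto
        moreover have "h x * u x \<le> B * u x" using x by (intro mult_right_mono) auto
        ultimately have "c * u x powr (1 - \<delta>) + h x * u x \<le> c + (c + B) * u x" by (simp add: algebra_simps)
        also have "(c + B) * u x \<le> (c + B) * (\<eta> * u x powr p + \<eta> powr (1 / (1 - p)))"
          using le_eta_powr[OF p_gt_1 \<eta> x(1)] c B by (intro mult_left_mono) auto
        finally show "c * u x powr (1 - \<delta>) + h x * u x \<le> (c + B) * \<eta> * norm (u x) powr p + L"
          using x by (simp add: L_def algebra_simps)
      qed
    qed (intro Bochner_Integration.integrable_add integrable_mult_right i1 i2 ip integrable_const_M)+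
    also have "\<dots> = (c + B) * \<eta> * pmass p M u + L * \<mu>"
      by (subst Bochner_Integration.integral_add[OF integrable_mult_right[OF ip] integrable_const_M])
        (simp add: pmass_def \<mu>_def)
    also have "(c + B) * \<eta> * pmass p M u \<le> (c + B) * \<eta> * (C * pmass p M g)"
      using C(2)[OF s] c B \<eta> by (intro mult_left_mono) auto
    also have "\<dots> = pmass p M g / (2 * p)" using \<eta>e by (simp add: mult.assoc[symmetric])
    finally have "c * (LINT x|M. u x powr (1 - \<delta>)) + (LINT x|M. h x * u x) \<le> pmass p M g / (2 * p) + L * \<mu>"
      by simp
    moreover have "0 \<le> \<beta> * (pmass q M g / q)" using \<beta> q pmass_nonneg[of q M g] by simp
    moreover have "pmass p M g / p = 2 * (pmass p M g / (2 * p))" by simp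
    ultimately show ?thesis unfolding J_def c_def[symmetric] by linarith
  qed
  then show ?thesis by blast
qed

lemma admissible_add_cmult:
  assumes "admissible u g" "admissible v k" "0 \<le> a" "0 \<le> b"
  shows "admissible (\<lambda>x. a * u x + b * v x) (\<lambda>x. a *\<^sub>R g x + b *\<^sub>R k x)"
proof -
  have "AE x in M. 0 \<le> u x" "AE x in M. 0 \<le> v x" using assms by (auto simp: admissible_def)
  then have "AE x in M. 0 \<le> a * u x + b * v x"
    by (rule eventually_elim2) (use assms in auto)
  then show ?thesis using assms sob_add[OF sob_cmult sob_cmult] by (auto simp: admissible_def)
qed

lemma integrable_midgap:
  assumes "1 < m" "f \<in> LP m M" "g \<in> LP m M"
  shows "integrable M (\<lambda>x. midgap m (f x) (g x))"
    "(LINT x|M. midgap m (f x) (g x)) = (pmass m M f + pmass m M g) / 2 - pmass m M (\<lambda>x. (1/2) *\<^sub>R (f x + g x))"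
proof -
  have i: "integrable M (\<lambda>x. norm (f x) powr m)" "integrable M (\<lambda>x. norm (g x) powr m)"
    "integrable M (\<lambda>x. norm ((1/2) *\<^sub>R (f x + g x)) powr m)"
    using assms LP_integrable_powr LP_scaleR[OF LP_add[OF _ assms(2,3)], of "1/2"] by fastforce+
  then show "integrable M (\<lambda>x. midgap m (f x) (g x))"
    "(LINT x|M. midgap m (f x) (g x)) = (pmass m M f + pmass m M g) / 2 - pmass m M (\<lambda>x. (1/2) *\<^sub>R (f x + g x))"
    unfolding midgap_def pmass_def by (simp_all del: norm_scaleR)
qed

text \<open>Only the gap of the p-energy is kept. The q-gap and the gap of the concave power both
  have the favourable sign, and the source term is linear.\<close>

lemma J_midpoint:
  assumes h: "source h" and c: "admissible u g" "admissible v k"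
  shows "J h (\<lambda>x. (1/2) * (u x + v x)) (\<lambda>x. (1/2) *\<^sub>R (g x + k x))
    \<le> (J h u g + J h v k) / 2 - (LINT x|M. midgap p (g x) (k x)) / p"
proof -
  have s: "sob u g" "sob v k" and n: "AE x in M. 0 \<le> u x" "AE x in M. 0 \<le> v x"
    using c by (auto simp: admissible_def)
  have sm: "sob (\<lambda>x. (1/2) * (u x + v x)) (\<lambda>x. (1/2) *\<^sub>R (g x + k x))"
    by (intro sob_cmult sob_add s)
  have P: "pmass p M (\<lambda>x. (1/2) *\<^sub>R (g x + k x)) / p
     = (pmass p M g / p + pmass p M k / p) / 2 - (LINT x|M. midgap p (g x) (k x)) / p"
    unfolding integrable_midgap(2)[OF p_gt_1 sobD(2)[OF s(1)] sobD(2)[OF s(2)]]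
    by (simp add: diff_divide_distrib add_divide_distrib)
  have "0 \<le> (LINT x|M. midgap q (g x) (k x))"
    by (intro integral_nonneg_AE AE_I2 midgap_nonneg q)
  then have "pmass q M (\<lambda>x. (1/2) *\<^sub>R (g x + k x)) \<le> (pmass q M g + pmass q M k) / 2"
    unfolding integrable_midgap(2)[OF q(1) LP_q[OF sobD(2)[OF s(1)]] LP_q[OF sobD(2)[OF s(2)]]] by simp
  then have "\<beta> * (pmass q M (\<lambda>x. (1/2) *\<^sub>R (g x + k x)) / q) \<le> \<beta> * ((pmass q M g + pmass q M k) / 2 / q)"
    using \<beta> q by (intro mult_left_mono divide_right_mono) auto
  also have "\<dots> = (\<beta> * (pmass q M g / q) + \<beta> * (pmass q M k / q)) / 2"
    by (simp add: add_divide_distrib algebra_simps)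
  finally have Q: "\<beta> * (pmass q M (\<lambda>x. (1/2) *\<^sub>R (g x + k x)) / q) \<le> (\<beta> * (pmass q M g / q) + \<beta> * (pmass q M k / q)) / 2" .
  have "(LINT x|M. (u x powr (1 - \<delta>) + v x powr (1 - \<delta>)) / 2) \<le> (LINT x|M. ((1/2) * (u x + v x)) powr (1 - \<delta>))"
  proof (rule integral_mono_AE)
    show "AE x in M. (u x powr (1 - \<delta>) + v x powr (1 - \<delta>)) / 2 \<le> ((1/2) * (u x + v x)) powr (1 - \<delta>)"
      using n by (rule eventually_elim2) (rule powr_midpoint_concave, use \<delta> in auto)
  qed (use integrable_sing[OF s(1)] integrable_sing[OF s(2)] integrable_sing[OF sm] in auto)
  then have "((LINT x|M. u x powr (1 - \<delta>)) + (LINT x|M. v x powr (1 - \<delta>))) / 2 \<le> (LINT x|M. ((1/2) * (u x + v x)) powr (1 - \<delta>))"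
    using integrable_sing[OF s(1)] integrable_sing[OF s(2)] by simp
  then have "lam / (1 - \<delta>) * (((LINT x|M. u x powr (1 - \<delta>)) + (LINT x|M. v x powr (1 - \<delta>))) / 2)
     \<le> lam / (1 - \<delta>) * (LINT x|M. ((1/2) * (u x + v x)) powr (1 - \<delta>))"
    using lam \<delta> by (intro mult_left_mono) auto
  then have S1: "lam / (1 - \<delta>) * (((LINT x|M. u x powr (1 - \<delta>)) + (LINT x|M. v x powr (1 - \<delta>))) / 2)
     \<le> lam / (1 - \<delta>) * (LINT x|M. ((1/2) * (u x + v x)) powr (1 - \<delta>))" .
  have S2: "lam / (1 - \<delta>) * (((LINT x|M. u x powr (1 - \<delta>)) + (LINT x|M. v x powr (1 - \<delta>))) / 2)
    = (lam / (1 - \<delta>) * (LINT x|M. u x powr (1 - \<delta>)) + lam / (1 - \<delta>) * (LINT x|M. v x powr (1 - \<delta>))) / 2"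
    by (simp add: distrib_left add_divide_distrib)
  have S: "(lam / (1 - \<delta>) * (LINT x|M. u x powr (1 - \<delta>)) + lam / (1 - \<delta>) * (LINT x|M. v x powr (1 - \<delta>))) / 2
     \<le> lam / (1 - \<delta>) * (LINT x|M. ((1/2) * (u x + v x)) powr (1 - \<delta>))" by (rule S1[unfolded S2])
  have "(LINT x|M. h x * ((1/2) * (u x + v x))) = (LINT x|M. (1/2) * (h x * u x + h x * v x))"
    by (intro Bochner_Integration.integral_cong) (auto simp: algebra_simps)
  also have "\<dots> = ((LINT x|M. h x * u x) + (LINT x|M. h x * v x)) / 2"
    using integrable_source[OF h s(1)] integrable_source[OF h s(2)] by simp
  finally have H: "(LINT x|M. h x * ((1/2) * (u x + v x))) = ((LINT x|M. h x * u x) + (LINT x|M. h x * v x)) / 2" .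
  show ?thesis unfolding J_def P H using Q S by argo
qed

text \<open>The midpoint of two near minimizers is admissible and cannot lie below m, so
  \<open>J_midpoint\<close> forces a small integrated gap. With the energies bounded by coercivity,
  \<open>norm_diff_powr_le_midgap\<close> makes the gradients close. The lemma serves three times:
  existence, uniqueness and convergence of the iteration.\<close>

lemma near_minimizers_close:
  assumes h: "source h" and m: "\<And>v k. admissible v k \<Longrightarrow> m \<le> J h v k" and \<epsilon>: "0 < \<epsilon>"
  shows "\<exists>d>0. \<forall>u g v k. admissible u g \<and> admissible v k \<and> J h u g \<le> m + d \<and> J h v k \<le> m + d \<longrightarrow>
    pmass p M (\<lambda>x. g x - k x) < \<epsilon> \<and> pmass p M (\<lambda>x. u x - v x) < \<epsilon>"
proof -
  obtain K where K: "\<And>u g. admissible u g \<Longrightarrow> pmass p M g / (2 * p) - K \<le> J h u g" using coercive[OF h] by blast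
  obtain C where C: "0 < C" "\<And>u g. sob u g \<Longrightarrow> pmass p M u \<le> C * pmass p M g" using poincare by blast
  define R where "R = max 1 (2 * p * (m + 1 + K))"
  have R: "1 \<le> R" by (simp add: R_def)
  have bd: "pmass p M g \<le> R" if "admissible u g" "J h u g \<le> m + 1" for u g
  proof -
    have "pmass p M g / (2 * p) \<le> m + 1 + K" using K[OF that(1)] that(2) by simp
    then show ?thesis using p0 by (simp add: R_def field_simps le_max_iff_disj)
  qed
  \<comment> \<open>Dividing by 1 + C serves both conclusions, for gradients directly and for
    functions through Poincare. This budget is halved between the \<eta>-term and the gap
    term.\<close>
  define \<epsilon>' where "\<epsilon>' = \<epsilon> / (1 + C)"
  have \<epsilon>': "0 < \<epsilon>'" "\<epsilon>' \<le> \<epsilon>" "C * \<epsilon>' < \<epsilon>" using \<epsilon> C by (auto simp: \<epsilon>'_def field_simps)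
  define \<eta> where "\<eta> = \<epsilon>' / (4 * R)"
  have \<eta>: "0 < \<eta>" "\<eta> * (2 * R) = \<epsilon>' / 2" using \<epsilon>' R by (auto simp: \<eta>_def)
  obtain D where D: "0 \<le> D" "\<And>a b :: 'a. norm (a - b) powr p \<le> \<eta> * (norm a powr p + norm b powr p) + D * midgap p a b"
    using norm_diff_powr_le_midgap[OF p_gt_1 \<eta>(1)] by blast
  \<comment> \<open>The cap 1 keeps both pairs within the energy bound R; the summand 1 next to D
    covers D = 0.\<close>
  define d where "d = min 1 (\<epsilon>' / (4 * p * (D + 1)))"
  have d: "0 < d" "d \<le> 1" using \<epsilon>' p0 D by (auto simp: d_def)
  have dD: "D * (p * d) < \<epsilon>' / 2"
  proof -
    have "d \<le> \<epsilon>' / (4 * p * (D + 1))" by (simp add: d_def)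
    then have "D * (p * d) \<le> D * (p * (\<epsilon>' / (4 * p * (D + 1))))"
      using D p0 by (intro mult_left_mono) auto
    also have "\<dots> = (D / (D + 1)) * (\<epsilon>' / 4)" using p0 by simp
    also have "\<dots> \<le> 1 * (\<epsilon>' / 4)" using D \<epsilon>' by (intro mult_right_mono) (auto simp: field_simps)
    finally show ?thesis using \<epsilon>' by simp
  qed
  have "pmass p M (\<lambda>x. g x - k x) < \<epsilon> \<and> pmass p M (\<lambda>x. u x - v x) < \<epsilon>"
    if c: "admissible u g" "admissible v k" and le: "J h u g \<le> m + d" "J h v k \<le> m + d" for u g v k
  proof -
    have s: "sob u g" "sob v k" using c by (auto simp: admissible_def)
    note LPs = sobD(2)[OF s(1)] sobD(2)[OF s(2)]
    have "admissible (\<lambda>x. (1/2) * (u x + v x)) (\<lambda>x. (1/2) *\<^sub>R (g x + k x))"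
      using admissible_add_cmult[OF c, of "1/2" "1/2"] by (simp add: distrib_left scaleR_add_right)
    from m[OF this] have "m \<le> (J h u g + J h v k) / 2 - (LINT x|M. midgap p (g x) (k x)) / p"
      using J_midpoint[OF h c] by simp
    then have "(LINT x|M. midgap p (g x) (k x)) / p \<le> d" using le by argo
    then have mg: "(LINT x|M. midgap p (g x) (k x)) \<le> p * d" using p0 by (simp add: field_simps)
    have pm: "pmass p M g \<le> R" "pmass p M k \<le> R" using bd c le d by force+
    have "pmass p M (\<lambda>x. g x - k x)
      \<le> (LINT x|M. \<eta> * (norm (g x) powr p + norm (k x) powr p) + D * midgap p (g x) (k x))"
      by (rule pmass_mono[OF LP_diff[OF p0(1) LPs]])
        (use D(2) LP_integrable_powr[OF LPs(1)] LP_integrable_powr[OF LPs(2)]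
          integrable_midgap(1)[OF p_gt_1 LPs] in auto)
    also have "\<dots> = \<eta> * (pmass p M g + pmass p M k) + D * (LINT x|M. midgap p (g x) (k x))"
      using LP_integrable_powr[OF LPs(1)] LP_integrable_powr[OF LPs(2)] integrable_midgap(1)[OF p_gt_1 LPs]
      by (simp add: pmass_def)
    also have "\<dots> \<le> \<eta> * (2 * R) + D * (p * d)"
      using pm mg \<eta>(1) D(1) by (intro add_mono mult_left_mono) auto
    also have "\<dots> < \<epsilon>'" using \<eta>(2) dD by simp
    finally have 1: "pmass p M (\<lambda>x. g x - k x) < \<epsilon>'" .
    have "pmass p M (\<lambda>x. u x - v x) \<le> C * pmass p M (\<lambda>x. g x - k x)" by (intro C(2) sob_diff s)
    also have "\<dots> \<le> C * \<epsilon>'" using 1 C(1) by (intro mult_left_mono) auto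
    finally show ?thesis using 1 \<epsilon>' by simp
  qed
  then show ?thesis using d(1) by blast
qed

lemma minimizer_exists:
  assumes h: "source h"
  shows "\<exists>u g. minimizer h u g"
proof -
  define A where "A = {J h u g | u g. admissible u g}"
  obtain K where K: "\<And>u g. admissible u g \<Longrightarrow> pmass p M g / (2 * p) - K \<le> J h u g" using coercive[OF h] by blast
  have K': "- K \<le> J h u g" if "admissible u g" for u g
    using K[OF that] p0 pmass_nonneg[of p M g] by (smt (verit) divide_nonneg_nonneg)
  have bdd: "bdd_below A" unfolding A_def by (rule bdd_belowI[of _ "- K"]) (use K' in auto)
  have ne: "A \<noteq> {}" unfolding A_def using sob_zero by (auto simp: admissible_def)
  define m where "m = Inf A"
  have m: "m \<le> J h v k" if "admissible v k" for v k
    unfolding m_def by (rule cInf_lower[OF _ bdd]) (use that in \<open>auto simp: A_def\<close>)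
  have "\<exists>u g. admissible u g \<and> J h u g < m + 1 / real (Suc n)" for n
  proof -
    have "Inf A < m + 1 / real (Suc n)" by (simp add: m_def)
    then show ?thesis using cInf_lessD[OF ne] unfolding A_def by blast
  qed
  then obtain u g where ug: "\<And>n. admissible (u n) (g n)" "\<And>n. J h (u n) (g n) < m + 1 / real (Suc n)" by metis
  have s: "sob (u n) (g n)" and u0: "AE x in M. 0 \<le> u n x" for n using ug(1)[of n] by (auto simp: admissible_def)
  have Cauchy: "\<exists>N. \<forall>i\<ge>N. \<forall>j\<ge>N. pmass p M (\<lambda>x. g i x - g j x) < \<epsilon> \<and> pmass p M (\<lambda>x. u i x - u j x) < \<epsilon>"
    if \<epsilon>: "0 < \<epsilon>" for \<epsilon>
  proof -
    obtain d where d: "d > 0" "\<And>u g v k. admissible u g \<Longrightarrow> admissible v k \<Longrightarrow> J h u g \<le> m + d \<Longrightarrow> J h v k \<le> m + d \<Longrightarrow>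
      pmass p M (\<lambda>x. g x - k x) < \<epsilon> \<and> pmass p M (\<lambda>x. u x - v x) < \<epsilon>"
    proof -
      have "\<exists>d>0. \<forall>u g v k. admissible u g \<and> admissible v k \<and> J h u g \<le> m + d \<and> J h v k \<le> m + d \<longrightarrow>
          pmass p M (\<lambda>x. g x - k x) < \<epsilon> \<and> pmass p M (\<lambda>x. u x - v x) < \<epsilon>"
        by (rule near_minimizers_close[OF h _ \<epsilon>]) (rule m)
      then show ?thesis using that by blast
    qed
    obtain N where N: "1 / real (Suc N) < d" using d(1) by (metis nat_approx_posE)
    have "J h (u i) (g i) \<le> m + d" if "i \<ge> N" for i
    proof -
      have "1 / real (Suc i) \<le> 1 / real (Suc N)" using that by (simp add: frac_le)
      then show ?thesis using ug(2)[of i] N by simp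
    qed
    then show ?thesis using d(2) ug(1) by blast
  qed
  obtain r1 U G1 where r1: "strict_mono r1" "U \<in> LP p M" "(\<lambda>i. pmass p M (\<lambda>x. u (r1 i) x - U x)) \<longlonglongrightarrow> 0"
    "AE x in M. (\<lambda>i. u (r1 i) x) \<longlonglongrightarrow> U x" "integrable M G1" "AE x in M. \<forall>i. norm (u (r1 i) x) powr p \<le> G1 x"
  proof (rule LP_Cauchy_subsequence[OF p_gt_1 sobD(1)[OF s]])
    show "\<exists>N. \<forall>i\<ge>N. \<forall>j\<ge>N. pmass p M (\<lambda>x. u i x - u j x) < \<epsilon>" if "0 < \<epsilon>" for \<epsilon> using Cauchy[OF that] by blast
  qed blast
  \<comment> \<open>A second extraction makes the gradients converge pointwise along the subsequence
    already chosen for the functions. The envelopes dominate p-th powers, hence by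
    \<open>powr_le_one_plus\<close> also the q-energy and the singular term, so \<open>J\<close>
    itself converges.\<close>
  obtain r2 G G2 where r2: "strict_mono r2" "G \<in> LP p M" "(\<lambda>i. pmass p M (\<lambda>x. g (r1 (r2 i)) x - G x)) \<longlonglongrightarrow> 0"
    "AE x in M. (\<lambda>i. g (r1 (r2 i)) x) \<longlonglongrightarrow> G x" "integrable M G2" "AE x in M. \<forall>i. norm (g (r1 (r2 i)) x) powr p \<le> G2 x"
  proof (rule LP_Cauchy_subsequence[OF p_gt_1 sobD(2)[OF s]])
    fix \<epsilon> :: real assume "0 < \<epsilon>"
    from Cauchy[OF this] obtain N where N: "\<And>i j. i \<ge> N \<Longrightarrow> j \<ge> N \<Longrightarrow> pmass p M (\<lambda>x. g i x - g j x) < \<epsilon>" by blast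
    have "i \<le> r1 i" for i by (rule seq_suble[OF r1(1)])
    then show "\<exists>N. \<forall>i\<ge>N. \<forall>j\<ge>N. pmass p M (\<lambda>x. g (r1 i) x - g (r1 j) x) < \<epsilon>"
      using N by (meson order_trans)
  qed blast
  define r where "r i = r1 (r2 i)" for i
  have r: "strict_mono r" using r1(1) r2(1) by (simp add: r_def strict_mono_def)
  have U: "(\<lambda>i. pmass p M (\<lambda>x. u (r i) x - U x)) \<longlonglongrightarrow> 0"
    using LIMSEQ_subseq_LIMSEQ[OF r1(3) r2(1)] by (simp add: r_def o_def)
  have UAE: "AE x in M. (\<lambda>i. u (r i) x) \<longlonglongrightarrow> U x"
    using r1(4)
  proof (rule eventually_mono)
    fix x assume "(\<lambda>i. u (r1 i) x) \<longlonglongrightarrow> U x"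
    from LIMSEQ_subseq_LIMSEQ[OF this r2(1)] show "(\<lambda>i. u (r i) x) \<longlonglongrightarrow> U x" by (simp add: r_def o_def)
  qed
  have Udom: "AE x in M. \<forall>i. norm (u (r i) x) powr p \<le> G1 x"
    using r1(6) by (rule eventually_mono) (simp add: r_def)
  have u0': "AE x in M. \<forall>i. 0 \<le> u (r i) x" using u0 by (simp add: AE_all_countable)
  have sU: "sob U G" by (rule sob_closed[OF s r1(2) r2(2) U r2(3)[folded r_def]])
  have U0: "AE x in M. 0 \<le> U x"
    using UAE u0' by (rule eventually_elim2) (metis LIMSEQ_le_const)
  have cU: "admissible U G" using sU U0 by (simp add: admissible_def)
  have dct: "(\<lambda>i. pmass m M (g (r i))) \<longlonglongrightarrow> pmass m M G" if m: "0 < m" "m \<le> p" for m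
    unfolding pmass_def
  proof (rule integral_dominated_convergence[where w="\<lambda>x. 1 + G2 x"])
    show "AE x in M. (\<lambda>i. norm (g (r i) x) powr m) \<longlonglongrightarrow> norm (G x) powr m"
      using r2(4) by (rule eventually_mono) (use m in \<open>auto simp: r_def intro!: tendsto_powr' tendsto_norm\<close>)
    show "AE x in M. norm (norm (g (r i) x) powr m) \<le> 1 + G2 x" for i
      using r2(6)
    proof (rule eventually_mono)
      fix x assume "\<forall>i. norm (g (r1 (r2 i)) x) powr p \<le> G2 x"
      then show "norm (norm (g (r i) x) powr m) \<le> 1 + G2 x"
        using powr_le_one_plus[of m p "norm (g (r i) x)"] m by (auto simp: r_def intro: order_trans)
    qed
    show "integrable M (\<lambda>x. 1 + G2 x)" by (intro Bochner_Integration.integrable_add integrable_const_M r2(5))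
  qed (use LP_measurable[OF r2(2)] sob_measurable(2)[OF s] in auto)
  have S: "(\<lambda>i. LINT x|M. u (r i) x powr (1 - \<delta>)) \<longlonglongrightarrow> (LINT x|M. U x powr (1 - \<delta>))"
  proof (rule integral_dominated_convergence[where w="\<lambda>x. 1 + G1 x"])
    show "AE x in M. (\<lambda>i. u (r i) x powr (1 - \<delta>)) \<longlonglongrightarrow> U x powr (1 - \<delta>)"
      using UAE u0' by (rule eventually_elim2) (use \<delta> in \<open>auto intro!: tendsto_powr'\<close>)
    show "AE x in M. norm (u (r i) x powr (1 - \<delta>)) \<le> 1 + G1 x" for i
      using Udom
    proof (rule eventually_mono)
      fix x assume "\<forall>i. norm (u (r i) x) powr p \<le> G1 x"
      then have "norm (u (r i) x) powr (1 - \<delta>) \<le> 1 + G1 x"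
        using powr_le_one_plus[of "1 - \<delta>" p "norm (u (r i) x)"] \<delta> p_gt_1 by (auto intro: order_trans)
      then have "u (r i) x powr (1 - \<delta>) \<le> 1 + G1 x" by (simp only: norm_powr_real)
      then show "norm (u (r i) x powr (1 - \<delta>)) \<le> 1 + G1 x" by simp
    qed
    show "integrable M (\<lambda>x. 1 + G1 x)" by (intro Bochner_Integration.integrable_add integrable_const_M r1(5))
  qed (use LP_measurable[OF r1(2)] sob_measurable(1)[OF s] in auto)
  obtain B where B: "0 \<le> B" "AE x in M. 0 \<le> h x \<and> h x \<le> B" by (rule source_bound[OF h])
  have H: "(\<lambda>i. LINT x|M. h x * u (r i) x) \<longlonglongrightarrow> (LINT x|M. h x * U x)"
  proof (rule LP_tendsto_integral[OF finite_M p_gt_1 sobD(1)[OF s] r1(2) U integrable_source[OF h s]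
        integrable_source[OF h sU] _ B(1)])
    show "AE x in M. norm (h x * u (r i) x - h x * U x) \<le> B * norm (u (r i) x - U x)" for i
      using B(2) by (rule eventually_mono)
        (auto simp: abs_mult simp flip: right_diff_distrib intro!: mult_right_mono)
  qed
  have "(\<lambda>i. J h (u (r i)) (g (r i))) \<longlonglongrightarrow> J h U G"
    unfolding J_def using dct[of p] dct[of q] q p0
    by (intro tendsto_diff tendsto_add tendsto_mult tendsto_divide tendsto_const S H) auto
  moreover have "(\<lambda>i. m + 1 / real (Suc (r i))) \<longlonglongrightarrow> m + 0"
    using LIMSEQ_subseq_LIMSEQ[OF LIMSEQ_Suc[OF lim_1_over_n] r] by (intro tendsto_intros) (simp add: o_def)
  ultimately have "J h U G \<le> m + 0"
    by (rule LIMSEQ_le) (use ug(2) less_imp_le in blast)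
  then have "minimizer h U G" using cU m unfolding minimizer_def by force
  then show ?thesis by blast
qed

text \<open>A competitor whose energy is no larger is a near minimizer for every tolerance, so its
  distance to u is below every positive number.\<close>

lemma minimizer_unique:
  assumes h: "source h" and u: "minimizer h u g" and v: "admissible v k" "J h v k \<le> J h u g"
  shows "AE x in M. u x = v x"
proof -
  have c: "admissible u g" and m: "\<And>w l. admissible w l \<Longrightarrow> J h u g \<le> J h w l" using u by (auto simp: minimizer_def)
  have s: "sob u g" "sob v k" using c v by (auto simp: admissible_def)
  have "pmass p M (\<lambda>x. u x - v x) < \<epsilon>" if "0 < \<epsilon>" for \<epsilon>
  proof -
    have "\<exists>d>0. \<forall>w l v k. admissible w l \<and> admissible v k \<and> J h w l \<le> J h u g + d \<and> J h v k \<le> J h u g + d \<longrightarrow>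
        pmass p M (\<lambda>x. l x - k x) < \<epsilon> \<and> pmass p M (\<lambda>x. w x - v x) < \<epsilon>"
      by (rule near_minimizers_close[OF h _ that]) (rule m)
    then obtain d where "d > 0" and d: "\<And>w l v k. admissible w l \<Longrightarrow> admissible v k \<Longrightarrow> J h w l \<le> J h u g + d \<Longrightarrow>
        J h v k \<le> J h u g + d \<Longrightarrow> pmass p M (\<lambda>x. w x - v x) < \<epsilon>" by blast
    show ?thesis by (rule d[OF c v(1)]) (use \<open>d > 0\<close> v(2) in auto)
  qed
  then have "pmass p M (\<lambda>x. u x - v x) = 0"
    using pmass_nonneg[of p M "\<lambda>x. u x - v x"] by (metis less_irrefl order_le_less)
  then show ?thesis
    using pmass_eq_0D[OF LP_diff[OF p0(1) sobD(1)[OF s(1)] sobD(1)[OF s(2)]]] by simp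
qed

end

section \<open>The Euler--Lagrange equation and comparison\<close>

context energy begin

definition pq_flux :: "'a \<Rightarrow> 'a" where
  "pq_flux a = flux p a + \<beta> *\<^sub>R flux q a"

text \<open>The weak form of -\<Delta>_p u - \<beta> \<Delta>_q u for gradient g, tested with a
  function of gradient k.\<close>

definition A :: "('a \<Rightarrow> 'a) \<Rightarrow> ('a \<Rightarrow> 'a) \<Rightarrow> real" where
  "A g k = (LINT x|M. pq_flux (g x) \<bullet> k x)"

lemma pq_flux_inner: "pq_flux a \<bullet> b = flux p a \<bullet> b + \<beta> * (flux q a \<bullet> b)"
  by (simp add: pq_flux_def inner_add_left)

lemma continuous_pq_flux: "continuous_on UNIV pq_flux"
  unfolding pq_flux_def[abs_def]
  by (intro continuous_on_add continuous_on_scaleR continuous_on_const continuous_flux p_gt_1 q)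

lemma pq_flux_measurable: "g \<in> borel_measurable M \<Longrightarrow> (\<lambda>x. pq_flux (g x)) \<in> borel_measurable M"
  using borel_measurable_continuous_onI[OF continuous_pq_flux] by measurable

lemma integrable_flux_pq:
  assumes "g \<in> LP p M" "k \<in> LP p M"
  shows "integrable M (\<lambda>x. flux p (g x) \<bullet> k x)" "integrable M (\<lambda>x. flux q (g x) \<bullet> k x)"
  using LP_integrable_flux_inner[OF p_gt_1 assms] LP_integrable_flux_inner[OF q(1) LP_q[OF assms(1)] LP_q[OF assms(2)]]
  by auto

lemma integrable_pq_flux:
  assumes "g \<in> LP p M" "k \<in> LP p M"
  shows "integrable M (\<lambda>x. pq_flux (g x) \<bullet> k x)"
  unfolding pq_flux_inner using integrable_flux_pq[OF assms] by auto

lemma A_split: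
  assumes "g \<in> LP p M" "k \<in> LP p M"
  shows "A g k = (LINT x|M. flux p (g x) \<bullet> k x) + \<beta> * (LINT x|M. flux q (g x) \<bullet> k x)"
  unfolding A_def pq_flux_inner using integrable_flux_pq[OF assms] by simp

text \<open>Variations bound the energy by the flux at the perturbed gradient; this is the missing
  limit t \<rightarrow> 0. Steps of size at most 1 allow an envelope independent of j.\<close>

lemma tendsto_A_perturb:
  assumes g: "g \<in> LP p M" and k: "k \<in> LP p M"
  shows "(\<lambda>j. A (\<lambda>x. g x + (1 / real (Suc j)) *\<^sub>R k x) k) \<longlonglongrightarrow> A g k"
  unfolding A_def
proof (rule integral_dominated_convergence)
  define W where "W m x = 2 powr m * (norm (g x) powr m + norm (k x) powr m) + norm (k x) powr m" for m x
  have W: "\<bar>flux m (g x + (1 / real (Suc j)) *\<^sub>R k x) \<bullet> k x\<bar> \<le> W m x" if m: "1 < m" for m x j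
  proof -
    have "norm (g x + (1 / real (Suc j)) *\<^sub>R k x) powr m
      \<le> 2 powr m * (norm (g x) powr m + norm ((1 / real (Suc j)) *\<^sub>R k x) powr m)"
      using m by (intro norm_add_powr_le) auto
    also have "norm ((1 / real (Suc j)) *\<^sub>R k x) powr m \<le> norm (k x) powr m"
      using m mult_right_mono[of "1 / real (Suc j)" 1 "norm (k x)"] by (intro powr_mono2) auto
    finally have "norm (g x + (1 / real (Suc j)) *\<^sub>R k x) powr m
      \<le> 2 powr m * (norm (g x) powr m + norm (k x) powr m)" by simp
    then show ?thesis using flux_inner_bound[OF m, of "g x + (1 / real (Suc j)) *\<^sub>R k x" "k x"] by (simp add: W_def)
  qed
  have Wi: "integrable M (W m)" if "1 < m" "m \<le> p" for m
    unfolding W_def using LP_integrable_powr_le[OF finite_M _ that(2) g] LP_integrable_powr_le[OF finite_M _ that(2) k] that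
    by (intro Bochner_Integration.integrable_add integrable_mult_right) auto
  show "integrable M (\<lambda>x. W p x + \<beta> * W q x)"
    using Wi[OF p_gt_1] Wi[OF q(1)] q by (intro Bochner_Integration.integrable_add integrable_mult_right) auto
  show "AE x in M. norm (pq_flux (g x + (1 / real (Suc j)) *\<^sub>R k x) \<bullet> k x) \<le> W p x + \<beta> * W q x" for j
  proof (rule AE_I2)
    fix x
    have "\<bar>\<beta> * (flux q (g x + (1 / real (Suc j)) *\<^sub>R k x) \<bullet> k x)\<bar> \<le> \<beta> * W q x"
      unfolding abs_mult using W[OF q(1), of x j] \<beta> by (simp add: mult_left_mono)
    then show "norm (pq_flux (g x + (1 / real (Suc j)) *\<^sub>R k x) \<bullet> k x) \<le> W p x + \<beta> * W q x"
      unfolding pq_flux_inner real_norm_def using W[OF p_gt_1, of x j] by linarith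
  qed
  show "AE x in M. (\<lambda>j. pq_flux (g x + (1 / real (Suc j)) *\<^sub>R k x) \<bullet> k x) \<longlonglongrightarrow> pq_flux (g x) \<bullet> k x"
  proof (rule AE_I2)
    fix x
    have "(\<lambda>j. g x + (1 / real (Suc j)) *\<^sub>R k x) \<longlonglongrightarrow> g x + 0 *\<^sub>R k x"
      by (intro tendsto_add tendsto_scaleR tendsto_const LIMSEQ_Suc[OF lim_1_over_n])
    moreover have "isCont pq_flux (g x)" using continuous_pq_flux by (simp add: continuous_on_eq_continuous_at)
    ultimately have "(\<lambda>j. pq_flux (g x + (1 / real (Suc j)) *\<^sub>R k x)) \<longlonglongrightarrow> pq_flux (g x)"
      using isCont_tendsto_compose[of "g x" pq_flux] by simp
    then show "(\<lambda>j. pq_flux (g x + (1 / real (Suc j)) *\<^sub>R k x) \<bullet> k x) \<longlonglongrightarrow> pq_flux (g x) \<bullet> k x"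
      by (intro tendsto_inner tendsto_const)
  qed
  note gm = LP_measurable[OF g] LP_measurable[OF k]
  show "(\<lambda>x. pq_flux (g x) \<bullet> k x) \<in> borel_measurable M"
    using pq_flux_measurable[OF gm(1)] gm by measurable
  have "(\<lambda>x. g x + (1 / real (Suc j)) *\<^sub>R k x) \<in> borel_measurable M" for j using gm by measurable
  from pq_flux_measurable[OF this] show "(\<lambda>x. pq_flux (g x + (1 / real (Suc j)) *\<^sub>R k x) \<bullet> k x) \<in> borel_measurable M" for j
    using gm by measurable
qed

section \<open>Variations of a minimizer and the equation it satisfies\<close>

text \<open>The tangent is taken at the perturbed gradient and evaluated at the old one, so the
  increase of energy is bounded from above for each finite t, with no remainder.\<close>

lemma pmass_diff_le_flux:
  assumes m: "1 < m" "m \<le> p" and g: "g \<in> LP p M" "k \<in> LP p M" and t: "0 < t"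
  shows "pmass m M (\<lambda>x. g x + t *\<^sub>R k x) / m - pmass m M g / m \<le> t * (LINT x|M. flux m (g x + t *\<^sub>R k x) \<bullet> k x)"
proof -
  have gt: "(\<lambda>x. g x + t *\<^sub>R k x) \<in> LP m M" and gm: "g \<in> LP m M" and km: "k \<in> LP m M"
    using LP_le[OF finite_M _ m(2)] m LP_add[OF p0(1) g(1) LP_scaleR[OF g(2)]] g by auto
  note i = LP_integrable_powr[OF gt] LP_integrable_powr[OF gm] LP_integrable_flux_inner[OF m(1) gt km]
  have "(LINT x|M. norm (g x + t *\<^sub>R k x) powr m - norm (g x) powr m) \<le> (LINT x|M. (m * t) * (flux m (g x + t *\<^sub>R k x) \<bullet> k x))"
  proof (rule integral_mono)
    fix x
    show "norm (g x + t *\<^sub>R k x) powr m - norm (g x) powr m \<le> (m * t) * (flux m (g x + t *\<^sub>R k x) \<bullet> k x)"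
      using flux_tangent[OF m(1), of "g x + t *\<^sub>R k x" "g x"] by (simp add: algebra_simps)
  qed (use i in auto)
  then have "pmass m M (\<lambda>x. g x + t *\<^sub>R k x) - pmass m M g \<le> (m * t) * (LINT x|M. flux m (g x + t *\<^sub>R k x) \<bullet> k x)"
    using i by (simp add: pmass_def)
  then show ?thesis using m by (simp add: field_simps)
qed

text \<open>Every term is linearized at \<open>u + t * \<phi>\<close> instead of u, where the power
  might be singular. The concave tangent bounds the singular integrand by an integrable difference
  of powers, so integrability and inequality come together; the common factor t is cancelled at the
  end.\<close>

lemma one_sided_variation:
  assumes h: "source h" and u: "minimizer h u g" and \<phi>: "sob \<phi> k" "AE x in M. 0 \<le> \<phi> x" and t: "0 < t"
  shows "integrable M (\<lambda>x. (u x + t * \<phi> x) powr (- \<delta>) * \<phi> x)"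
    "lam * (LINT x|M. (u x + t * \<phi> x) powr (- \<delta>) * \<phi> x) \<le> A (\<lambda>x. g x + t *\<^sub>R k x) k - (LINT x|M. h x * \<phi> x)"
proof -
  have cu: "admissible u g" and s: "sob u g" and u0: "AE x in M. 0 \<le> u x" using u by (auto simp: minimizer_def admissible_def)
  have c\<phi>: "admissible \<phi> k" using \<phi> by (simp add: admissible_def)
  have ct: "admissible (\<lambda>x. u x + t * \<phi> x) (\<lambda>x. g x + t *\<^sub>R k x)"
    using admissible_add_cmult[OF cu c\<phi>, of 1 t] t by simp
  then have st: "sob (\<lambda>x. u x + t * \<phi> x) (\<lambda>x. g x + t *\<^sub>R k x)" by (simp add: admissible_def)
  define D where "D x = (u x + t * \<phi> x) powr (1 - \<delta>) - u x powr (1 - \<delta>)" for x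
  have D: "integrable M D" unfolding D_def using integrable_sing[OF st] integrable_sing[OF s] by auto
  have le: "AE x in M. 0 \<le> (u x + t * \<phi> x) powr (- \<delta>) * \<phi> x \<and>
      (1 - \<delta>) * t * ((u x + t * \<phi> x) powr (- \<delta>) * \<phi> x) \<le> D x"
    using u0 \<phi>(2)
  proof (rule eventually_elim2)
    fix x assume x: "0 \<le> u x" "0 \<le> \<phi> x"
    show "0 \<le> (u x + t * \<phi> x) powr (- \<delta>) * \<phi> x \<and>
      (1 - \<delta>) * t * ((u x + t * \<phi> x) powr (- \<delta>) * \<phi> x) \<le> D x"
    \<comment> \<open>The concave tangent requires a positive base point. If it vanishes, both
      \<open>u x\<close> and \<open>\<phi> x\<close> are 0 and nothing is to be shown.\<close>
    proof (cases "u x + t * \<phi> x = 0")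
      case True
      then have "u x = 0" "\<phi> x = 0" using x t by (auto simp: add_nonneg_eq_0_iff)
      then show ?thesis by (simp add: D_def)
    next
      case False
      then have "0 < u x + t * \<phi> x" using x t by (simp add: less_le)
      from powr_tangent_concave[OF _ _ this x(1), of "1 - \<delta>"]
      show ?thesis using \<delta> x by (simp add: D_def algebra_simps)
    qed
  qed
  have m: "(\<lambda>x. (u x + t * \<phi> x) powr (- \<delta>) * \<phi> x) \<in> borel_measurable M"
    using sob_measurable(1)[OF s] sob_measurable(1)[OF \<phi>(1)] by measurable
  have c: "0 < (1 - \<delta>) * t" using \<delta> t by simp
  have i: "integrable M (\<lambda>x. ((1 - \<delta>) * t) * ((u x + t * \<phi> x) powr (- \<delta>) * \<phi> x))"
  proof (rule Bochner_Integration.integrable_bound[OF D])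
    show "AE x in M. norm ((1 - \<delta>) * t * ((u x + t * \<phi> x) powr - \<delta> * \<phi> x)) \<le> norm (D x)"
      using le
    proof (rule eventually_mono)
      fix x assume x: "0 \<le> (u x + t * \<phi> x) powr (- \<delta>) * \<phi> x \<and>
        (1 - \<delta>) * t * ((u x + t * \<phi> x) powr (- \<delta>) * \<phi> x) \<le> D x"
      have "0 \<le> (1 - \<delta>) * t * ((u x + t * \<phi> x) powr (- \<delta>) * \<phi> x)" by (rule mult_nonneg_nonneg[OF less_imp_le[OF c] conjunct1[OF x]])
      then show "norm ((1 - \<delta>) * t * ((u x + t * \<phi> x) powr - \<delta> * \<phi> x)) \<le> norm (D x)"
        using x unfolding real_norm_def by linarith
    qed
  qed (use m in measurable)
  then have i': "integrable M (\<lambda>x. (u x + t * \<phi> x) powr (- \<delta>) * \<phi> x)" using c \<delta> t by simp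
  show "integrable M (\<lambda>x. (u x + t * \<phi> x) powr (- \<delta>) * \<phi> x)" by (rule i')
  have "(1 - \<delta>) * t * (LINT x|M. (u x + t * \<phi> x) powr (- \<delta>) * \<phi> x)
      = (LINT x|M. ((1 - \<delta>) * t) * ((u x + t * \<phi> x) powr (- \<delta>) * \<phi> x))" by simp
  also have "\<dots> \<le> (LINT x|M. D x)"
    by (rule integral_mono_AE[OF i D]) (use le in \<open>auto elim!: eventually_mono\<close>)
  also have "\<dots> = (LINT x|M. (u x + t * \<phi> x) powr (1 - \<delta>)) - (LINT x|M. u x powr (1 - \<delta>))"
    unfolding D_def using integrable_sing[OF st] integrable_sing[OF s] by simp
  finally have S: "(1 - \<delta>) * t * (LINT x|M. (u x + t * \<phi> x) powr (- \<delta>) * \<phi> x)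
    \<le> (LINT x|M. (u x + t * \<phi> x) powr (1 - \<delta>)) - (LINT x|M. u x powr (1 - \<delta>))" .
  then have S1: "lam / (1 - \<delta>) * ((1 - \<delta>) * t * (LINT x|M. (u x + t * \<phi> x) powr (- \<delta>) * \<phi> x))
    \<le> lam / (1 - \<delta>) * ((LINT x|M. (u x + t * \<phi> x) powr (1 - \<delta>)) - (LINT x|M. u x powr (1 - \<delta>)))"
    using lam \<delta> by (intro mult_left_mono) auto
  have S2: "lam / (1 - \<delta>) * ((1 - \<delta>) * t * (LINT x|M. (u x + t * \<phi> x) powr (- \<delta>) * \<phi> x))
    = t * (lam * (LINT x|M. (u x + t * \<phi> x) powr (- \<delta>) * \<phi> x))" using \<delta> by simp
  have S': "t * (lam * (LINT x|M. (u x + t * \<phi> x) powr (- \<delta>) * \<phi> x))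
    \<le> lam / (1 - \<delta>) * (LINT x|M. (u x + t * \<phi> x) powr (1 - \<delta>)) - lam / (1 - \<delta>) * (LINT x|M. u x powr (1 - \<delta>))"
    by (rule S1[unfolded S2 right_diff_distrib])
  have H: "(LINT x|M. h x * (u x + t * \<phi> x)) = (LINT x|M. h x * u x) + t * (LINT x|M. h x * \<phi> x)"
  proof -
    have "(LINT x|M. h x * (u x + t * \<phi> x)) = (LINT x|M. h x * u x + t * (h x * \<phi> x))"
      by (intro Bochner_Integration.integral_cong) (auto simp: algebra_simps)
    then show ?thesis using integrable_source[OF h s] integrable_source[OF h \<phi>(1)] by simp
  qed
  note LPs = sobD(2)[OF s] sobD(2)[OF \<phi>(1)]
  have P: "pmass p M (\<lambda>x. g x + t *\<^sub>R k x) / p - pmass p M g / p \<le> t * (LINT x|M. flux p (g x + t *\<^sub>R k x) \<bullet> k x)"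
    by (rule pmass_diff_le_flux[OF p_gt_1 order_refl LPs t])
  have "\<beta> * (pmass q M (\<lambda>x. g x + t *\<^sub>R k x) / q - pmass q M g / q) \<le> \<beta> * (t * (LINT x|M. flux q (g x + t *\<^sub>R k x) \<bullet> k x))"
    using \<beta> by (intro mult_left_mono pmass_diff_le_flux[OF q(1) q0(2) LPs t]) auto
  then have Q: "\<beta> * (pmass q M (\<lambda>x. g x + t *\<^sub>R k x) / q) - \<beta> * (pmass q M g / q) \<le> t * (\<beta> * (LINT x|M. flux q (g x + t *\<^sub>R k x) \<bullet> k x))"
    by (simp add: right_diff_distrib mult_ac)
  have AA: "t * A (\<lambda>x. g x + t *\<^sub>R k x) k = t * (LINT x|M. flux p (g x + t *\<^sub>R k x) \<bullet> k x)
      + t * (\<beta> * (LINT x|M. flux q (g x + t *\<^sub>R k x) \<bullet> k x))"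
    unfolding A_split[OF sobD(2)[OF st] LPs(2)] by (rule distrib_left)
  have "J h u g \<le> J h (\<lambda>x. u x + t * \<phi> x) (\<lambda>x. g x + t *\<^sub>R k x)" using u ct by (simp add: minimizer_def)
  then have "t * (lam * (LINT x|M. (u x + t * \<phi> x) powr (- \<delta>) * \<phi> x))
      \<le> t * A (\<lambda>x. g x + t *\<^sub>R k x) k - t * (LINT x|M. h x * \<phi> x)"
    unfolding J_def H AA using S' P Q by linarith
  then have "t * (lam * (LINT x|M. (u x + t * \<phi> x) powr (- \<delta>) * \<phi> x))
      \<le> t * (A (\<lambda>x. g x + t *\<^sub>R k x) k - (LINT x|M. h x * \<phi> x))" by (simp only: right_diff_distrib)
  then show "lam * (LINT x|M. (u x + t * \<phi> x) powr (- \<delta>) * \<phi> x) \<le> A (\<lambda>x. g x + t *\<^sub>R k x) k - (LINT x|M. h x * \<phi> x)"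
    using t by (simp only: mult_le_cancel_left_pos)
qed

text \<open>On \<open>{u = 0 < \<phi>}\<close> the singular term contributes \<open>t\<^sup>-\<^sup>\<delta> \<phi>\<^sup>1\<^sup>-\<^sup>\<delta>\<close>, which would blow up as
  \<open>t \<rightarrow> 0\<close> if that set were not negligible.\<close>

lemma minimizer_pos_where_test_pos:
  assumes h: "source h" and u: "minimizer h u g" and \<phi>: "sob \<phi> k" "AE x in M. 0 \<le> \<phi> x"
  shows "AE x in M. 0 < \<phi> x \<longrightarrow> 0 < u x"
proof -
  have s: "sob u g" and u0: "AE x in M. 0 \<le> u x" using u by (auto simp: minimizer_def admissible_def)
  note um = sob_measurable(1)[OF s] sob_measurable(1)[OF \<phi>(1)]
  define Z where "Z x = (if u x = 0 then \<phi> x powr (1 - \<delta>) else 0)" for x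
  have Zm: "Z \<in> borel_measurable M" unfolding Z_def using um by measurable
  have Zi: "integrable M Z"
    by (rule Bochner_Integration.integrable_bound[OF integrable_sing[OF \<phi>(1)] Zm]) (auto simp: Z_def)
  define t where "t j = 1 / real (Suc j)" for j
  have t: "0 < t j" for j by (simp add: t_def)
  define R where "R j = A (\<lambda>x. g x + t j *\<^sub>R k x) k - (LINT x|M. h x * \<phi> x)" for j
  have Zle: "(LINT x|M. Z x) \<le> t j powr \<delta> * (R j / lam)" for j
  proof -
    note v = one_sided_variation[OF h u \<phi> t[of j]]
    have "(LINT x|M. t j powr (- \<delta>) * Z x) \<le> (LINT x|M. (u x + t j * \<phi> x) powr (- \<delta>) * \<phi> x)"
    proof (rule integral_mono_AE[OF integrable_mult_right[OF Zi] v(1)])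
      show "AE x in M. t j powr (- \<delta>) * Z x \<le> (u x + t j * \<phi> x) powr (- \<delta>) * \<phi> x"
        using \<phi>(2)
      proof (rule eventually_mono)
        fix x assume x: "0 \<le> \<phi> x"
        show "t j powr (- \<delta>) * Z x \<le> (u x + t j * \<phi> x) powr (- \<delta>) * \<phi> x"
          using x powr_mult_base[of "\<phi> x" "- \<delta>"] t[of j] by (auto simp: Z_def powr_mult mult_ac)
      qed
    qed
    also have "\<dots> \<le> R j / lam" using v(2) lam by (simp add: R_def field_simps)
    finally have "t j powr (- \<delta>) * (LINT x|M. Z x) \<le> R j / lam" by simp
    \<comment> \<open>The right-hand side now tends to 0, because \<open>R j\<close> converges while
      \<open>t j powr \<delta>\<close> vanishes.\<close>
    then have "t j powr \<delta> * (t j powr (- \<delta>) * (LINT x|M. Z x)) \<le> t j powr \<delta> * (R j / lam)"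
      by (intro mult_left_mono) auto
    moreover have "t j powr \<delta> * t j powr (- \<delta>) = 1" using t[of j] unfolding powr_add[symmetric] by simp
    ultimately show ?thesis by (simp add: mult.assoc[symmetric])
  qed
  have "R \<longlonglongrightarrow> A g k - (LINT x|M. h x * \<phi> x)"
    unfolding R_def t_def by (intro tendsto_diff tendsto_const tendsto_A_perturb sobD(2)[OF s] sobD(2)[OF \<phi>(1)])
  moreover have "(\<lambda>j. t j powr \<delta>) \<longlonglongrightarrow> 0"
    unfolding t_def by (rule tendsto_zero_powrI[OF LIMSEQ_Suc[OF lim_1_over_n] tendsto_const]) (use \<delta> in auto)
  ultimately have "(\<lambda>j. t j powr \<delta> * (R j / lam)) \<longlonglongrightarrow> 0 * ((A g k - (LINT x|M. h x * \<phi> x)) / lam)"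
    using lam by (intro tendsto_mult tendsto_divide tendsto_const) auto
  then have "(LINT x|M. Z x) \<le> 0" using pmass_le_limit[OF Zle] by simp
  moreover have "AE x in M. 0 \<le> Z x" by (simp add: Z_def)
  ultimately have "AE x in M. Z x = 0"
    using integral_nonneg_eq_0_iff_AE[OF Zi] integral_nonneg_AE[of Z M] by fastforce
  with u0 show ?thesis
    by (rule eventually_elim2) (auto simp: Z_def split: if_splits)
qed

lemma minimizer_pos:
  assumes h: "source h" and u: "minimizer h u g"
  shows "AE x in M. 0 < u x"
proof (rule AE_lebesgue_on_boxI[OF open_dom])
  fix a b assume "cbox a b \<subseteq> \<Omega>"
  then have "sob (bump a b) (grad (bump a b))" by (intro sob_test test_function_bump)
  from minimizer_pos_where_test_pos[OF h u this] have "AE x in M. 0 < bump a b x \<longrightarrow> 0 < u x"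
    by (simp add: bump_bounds)
  then show "AE x in M. x \<in> box a b \<longrightarrow> 0 < u x"
    by (rule eventually_mono) (use bump_pos in blast)
qed

text \<open>As t decreases to 0 the singular integrands increase, because u > 0 and the exponent is
  negative. Their integrals stay bounded by the variation inequality, so monotone convergence gives
  integrability in the limit as well as the inequality.\<close>

lemma euler_lagrange_nonneg:
  assumes h: "source h" and u: "minimizer h u g" and \<phi>: "sob \<phi> k" "AE x in M. 0 \<le> \<phi> x"
  shows "integrable M (\<lambda>x. u x powr (- \<delta>) * \<phi> x)"
    "lam * (LINT x|M. u x powr (- \<delta>) * \<phi> x) + (LINT x|M. h x * \<phi> x) \<le> A g k"
proof -
  have s: "sob u g" using u by (auto simp: minimizer_def admissible_def)
  note um = sob_measurable(1)[OF s] sob_measurable(1)[OF \<phi>(1)]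
  have up: "AE x in M. 0 < u x \<and> 0 \<le> \<phi> x"
    using minimizer_pos[OF h u] \<phi>(2) by (rule eventually_elim2) simp
  define t where "t j = 1 / real (Suc j)" for j
  have t: "0 < t j" for j by (simp add: t_def)
  have t_dec: "t j \<le> t i" if "i \<le> j" for i j using that by (simp add: t_def frac_le)
  define F where "F j x = (u x + t j * \<phi> x) powr (- \<delta>) * \<phi> x" for j x
  define R where "R j = (A (\<lambda>x. g x + t j *\<^sub>R k x) k - (LINT x|M. h x * \<phi> x)) / lam" for j
  have Fi: "integrable M (F j)" and FR: "(LINT x|M. F j x) \<le> R j" for j
    unfolding F_def R_def using one_sided_variation[OF h u \<phi> t[of j]] lam
    by (auto simp: field_simps)
  have Rlim: "R \<longlonglongrightarrow> (A g k - (LINT x|M. h x * \<phi> x)) / lam"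
    unfolding R_def t_def using lam
    by (intro tendsto_divide tendsto_diff tendsto_const tendsto_A_perturb sobD(2)[OF s] sobD(2)[OF \<phi>(1)]) auto
  have mono: "AE x in M. mono (\<lambda>j. F j x)"
    using up
  proof (rule eventually_mono)
    fix x assume x: "0 < u x \<and> 0 \<le> \<phi> x"
    show "mono (\<lambda>j. F j x)"
    proof (rule monoI)
      fix i j :: nat assume "i \<le> j"
      then have "u x + t j * \<phi> x \<le> u x + t i * \<phi> x" using t_dec x by (simp add: mult_right_mono)
      moreover have "0 < u x + t j * \<phi> x" using x t[of j] by (simp add: add_pos_nonneg)
      ultimately show "F i x \<le> F j x" unfolding F_def
        using \<delta> x by (intro mult_right_mono powr_mono2') auto
    qed
  qed
  have lim: "AE x in M. (\<lambda>j. F j x) \<longlonglongrightarrow> u x powr (- \<delta>) * \<phi> x"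
    using up
  proof (rule eventually_mono)
    fix x assume x: "0 < u x \<and> 0 \<le> \<phi> x"
    have "(\<lambda>j. u x + t j * \<phi> x) \<longlonglongrightarrow> u x + 0 * \<phi> x"
      unfolding t_def by (intro tendsto_add tendsto_mult tendsto_const LIMSEQ_Suc[OF lim_1_over_n])
    then show "(\<lambda>j. F j x) \<longlonglongrightarrow> u x powr (- \<delta>) * \<phi> x"
      unfolding F_def using x by (intro tendsto_mult tendsto_powr tendsto_const) auto
  qed
  have "incseq (\<lambda>j. LINT x|M. F j x)"
  proof (rule monoI)
    fix i j :: nat assume "i \<le> j"
    show "(LINT x|M. F i x) \<le> (LINT x|M. F j x)"
      by (rule integral_mono_AE[OF Fi Fi]) (use mono \<open>i \<le> j\<close> in \<open>auto elim!: eventually_mono dest: monoD\<close>)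
  qed
  moreover obtain B where "\<And>j. R j \<le> B"
    using convergent_imp_Bseq[OF convergentI[OF Rlim]] by (auto simp: Bseq_def abs_le_iff)
  ultimately obtain L where L: "(\<lambda>j. LINT x|M. F j x) \<longlonglongrightarrow> L"
    using incseq_convergent[of "\<lambda>j. LINT x|M. F j x" B] FR by (meson order_trans)
  have m: "(\<lambda>x. u x powr (- \<delta>) * \<phi> x) \<in> borel_measurable M" using um by measurable
  show "integrable M (\<lambda>x. u x powr (- \<delta>) * \<phi> x)"
    by (rule integrable_monotone_convergence[OF Fi mono lim L m])
  have "(LINT x|M. u x powr (- \<delta>) * \<phi> x) = L"
    by (rule integral_monotone_convergence[OF Fi mono lim L m])
  also have "L \<le> (A g k - (LINT x|M. h x * \<phi> x)) / lam"
    by (rule LIMSEQ_le[OF L Rlim]) (use FR in blast)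
  finally show "lam * (LINT x|M. u x powr (- \<delta>) * \<phi> x) + (LINT x|M. h x * \<phi> x) \<le> A g k"
    using lam by (simp add: field_simps)
qed

text \<open>Multiples \<open>t * u\<close> remain admissible for t on both sides of 1, and along
  them \<open>J\<close> is an explicit combination of powers of t. Its derivative vanishes at the
  interior minimum t = 1, which gives an identity where other directions so far give an
  inequality.\<close>

lemma minimizer_scaling:
  assumes h: "source h" and u: "minimizer h u g"
  shows "A g g = lam * (LINT x|M. u x powr (- \<delta>) * u x) + (LINT x|M. h x * u x)"
proof -
  have cu: "admissible u g" and s: "sob u g" and u0: "AE x in M. 0 \<le> u x"
    using u by (auto simp: minimizer_def admissible_def)
  define P where "P = pmass p M g"
  define Q where "Q = pmass q M g"
  define S where "S = (LINT x|M. u x powr (1 - \<delta>))"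
  define H where "H = (LINT x|M. h x * u x)"
  define \<psi> where "\<psi> t = t powr p * (P / p) + \<beta> * (t powr q * (Q / q)) - lam / (1 - \<delta>) * (t powr (1 - \<delta>) * S) - t * H" for t
  have J\<psi>: "J h (\<lambda>x. t * u x) (\<lambda>x. t *\<^sub>R g x) = \<psi> t" if "0 \<le> t" for t
  proof -
    have "(LINT x|M. h x * (t * u x)) = t * H" by (simp add: H_def mult.left_commute)
    moreover have "(LINT x|M. (t * u x) powr (1 - \<delta>)) = t powr (1 - \<delta>) * S" by (simp add: S_def powr_mult)
    ultimately show ?thesis using that by (simp add: J_def \<psi>_def P_def Q_def pmass_scaleR)
  qed
  have "\<psi> 1 \<le> \<psi> t" if "0 \<le> t" for t
  proof -
    have "admissible (\<lambda>x. t * u x) (\<lambda>x. t *\<^sub>R g x)"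
      using admissible_add_cmult[OF cu cu, of t 0] that by simp
    then have "J h u g \<le> J h (\<lambda>x. t * u x) (\<lambda>x. t *\<^sub>R g x)" using u unfolding minimizer_def by blast
    then show ?thesis using J\<psi>[of 1] J\<psi>[OF that] by simp
  qed
  then have min: "\<forall>y. \<bar>1 - y\<bar> < 1 \<longrightarrow> \<psi> 1 \<le> \<psi> y" by (auto simp: abs_less_iff)
  have d: "((\<lambda>t::real. t powr a) has_real_derivative a) (at 1)" for a
    using has_real_derivative_powr[of 1 a] by simp
  have "(\<psi> has_real_derivative p * (P / p) + \<beta> * (q * (Q / q)) - lam / (1 - \<delta>) * ((1 - \<delta>) * S) - 1 * H) (at 1)"
    unfolding \<psi>_def by (intro DERIV_diff DERIV_add DERIV_cmult DERIV_cmult_right DERIV_ident d)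
  then have "p * (P / p) + \<beta> * (q * (Q / q)) - lam / (1 - \<delta>) * ((1 - \<delta>) * S) - 1 * H = 0"
    by (rule DERIV_local_min[OF _ zero_less_one min])
  then have "P + \<beta> * Q = lam * S + H" using p0 q \<delta> by simp
  moreover have "A g g = P + \<beta> * Q"
    unfolding A_split[OF sobD(2)[OF s] sobD(2)[OF s]] flux_inner_self P_def Q_def pmass_def ..
  moreover have "S = (LINT x|M. u x powr (- \<delta>) * u x)"
    unfolding S_def
  proof (rule integral_cong_AE)
    show "AE x in M. u x powr (1 - \<delta>) = u x powr (- \<delta>) * u x"
      using u0 by (rule eventually_mono) (use powr_mult_base[of _ "- \<delta>"] in \<open>auto simp: mult.commute\<close>)
  qed (use sob_measurable(1)[OF s] in measurable)
  ultimately show ?thesis by (simp add: H_def)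
qed

text \<open>Test with the positive part of \<open>u + \<epsilon> \<phi>\<close>; where it differs from \<open>u + \<epsilon> \<phi>\<close> the leading term
  has a sign, and the remainder is taken over a set that shrinks to a null set.\<close>

lemma euler_lagrange:
  assumes h: "source h" and u: "minimizer h u g" and \<phi>: "sob \<phi> k"
  shows "integrable M (\<lambda>x. u x powr (- \<delta>) * \<phi> x)"
    "A g k = lam * (LINT x|M. u x powr (- \<delta>) * \<phi> x) + (LINT x|M. h x * \<phi> x)"
proof -
  have s: "sob u g" using u by (auto simp: minimizer_def admissible_def)
  have int: "integrable M (\<lambda>x. u x powr (- \<delta>) * \<phi> x)" if \<phi>: "sob \<phi> k" for \<phi> k
  proof -
    note 1 = euler_lagrange_nonneg(1)[OF h u sob_max_0[OF \<phi>]]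
    note 2 = euler_lagrange_nonneg(1)[OF h u sob_max_0[OF sob_cmult[OF \<phi>, of "-1"]]]
    have "integrable M (\<lambda>x. u x powr (- \<delta>) * max 0 (\<phi> x) - u x powr (- \<delta>) * max 0 (-1 * \<phi> x))"
      using 1 2 by (intro Bochner_Integration.integrable_diff) auto
    moreover have "u x powr (- \<delta>) * max 0 (\<phi> x) - u x powr (- \<delta>) * max 0 (-1 * \<phi> x) = u x powr (- \<delta>) * \<phi> x" for x
      by (auto simp: max_def)
    ultimately show ?thesis by simp
  qed
  have ge: "lam * (LINT x|M. u x powr (- \<delta>) * \<phi> x) + (LINT x|M. h x * \<phi> x) \<le> A g k" if \<phi>: "sob \<phi> k" for \<phi> k
  proof -
    define t where "t j = 1 / real (Suc j)" for j
    have t: "0 < t j" for j by (simp add: t_def)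
    define N where "N j x = (if u x + t j * \<phi> x < 0 then pq_flux (g x) \<bullet> k x else 0)" for j x
    note um = sob_measurable[OF s] sob_measurable[OF \<phi>]
    note LPs = sobD(2)[OF s] sobD(2)[OF \<phi>]
    have fm: "(\<lambda>x. pq_flux (g x)) \<in> borel_measurable M" by (rule pq_flux_measurable[OF um(2)])
    have Nm: "N j \<in> borel_measurable M" for j unfolding N_def using um fm by measurable
    have Ni: "integrable M (N j)" for j
      by (rule Bochner_Integration.integrable_bound[OF integrable_pq_flux[OF LPs] Nm]) (auto simp: N_def)
    define E where "E = A g k - lam * (LINT x|M. u x powr (- \<delta>) * \<phi> x) - (LINT x|M. h x * \<phi> x)"
    have le: "(LINT x|M. N j x) \<le> E" for j
    proof -
      have su: "sob (\<lambda>x. u x + t j * \<phi> x) (\<lambda>x. g x + t j *\<^sub>R k x)" by (intro sob_add s sob_cmult \<phi>)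
      \<comment> \<open>\<psi> is the negative part of \<open>u + t j * \<phi>\<close>, so adding it
        back gives the positive part, which the one-sided inequality accepts. After expansion
        \<open>minimizer_scaling\<close> removes all terms in u alone and the unknown E keeps the
        factor \<open>t j\<close>.\<close>
      define \<psi> where "\<psi> x = max 0 (-1 * (u x + t j * \<phi> x))" for x
      define l where "l x = (if 0 < -1 * (u x + t j * \<phi> x) then (-1) *\<^sub>R (g x + t j *\<^sub>R k x) else 0)" for x
      have s\<psi>: "sob \<psi> l" unfolding \<psi>_def l_def by (rule sob_max_0[OF sob_cmult[OF su]])
      have sv: "sob (\<lambda>x. u x + t j * \<phi> x + \<psi> x) (\<lambda>x. g x + t j *\<^sub>R k x + l x)" by (rule sob_add[OF su s\<psi>])
      have v0: "AE x in M. 0 \<le> u x + t j * \<phi> x + \<psi> x" by (auto simp: \<psi>_def max_def)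
      note ii = int[OF s] int[OF \<phi>] int[OF s\<psi>]
      note hh = integrable_source[OF h s] integrable_source[OF h \<phi>] integrable_source[OF h s\<psi>]
      note ff = integrable_pq_flux[OF LPs(1) LPs(1)] integrable_pq_flux[OF LPs] integrable_pq_flux[OF LPs(1) sobD(2)[OF s\<psi>]]
      have 1: "(LINT x|M. u x powr (- \<delta>) * (u x + t j * \<phi> x + \<psi> x))
        = (LINT x|M. u x powr (- \<delta>) * u x) + t j * (LINT x|M. u x powr (- \<delta>) * \<phi> x) + (LINT x|M. u x powr (- \<delta>) * \<psi> x)"
      proof -
        have "(LINT x|M. u x powr (- \<delta>) * (u x + t j * \<phi> x + \<psi> x))
          = (LINT x|M. u x powr (- \<delta>) * u x + t j * (u x powr (- \<delta>) * \<phi> x) + u x powr (- \<delta>) * \<psi> x)"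
          by (intro Bochner_Integration.integral_cong) (auto simp: algebra_simps)
        then show ?thesis using ii by simp
      qed
      have 2: "(LINT x|M. h x * (u x + t j * \<phi> x + \<psi> x))
        = (LINT x|M. h x * u x) + t j * (LINT x|M. h x * \<phi> x) + (LINT x|M. h x * \<psi> x)"
      proof -
        have "(LINT x|M. h x * (u x + t j * \<phi> x + \<psi> x)) = (LINT x|M. h x * u x + t j * (h x * \<phi> x) + h x * \<psi> x)"
          by (intro Bochner_Integration.integral_cong) (auto simp: algebra_simps)
        then show ?thesis using hh by simp
      qed
      have 3: "A g (\<lambda>x. g x + t j *\<^sub>R k x + l x) = A g g + t j * A g k + A g l"
        unfolding A_def inner_add_right inner_scaleR_right using ff by simp
      have "lam * (LINT x|M. u x powr (- \<delta>) * (u x + t j * \<phi> x + \<psi> x)) + (LINT x|M. h x * (u x + t j * \<phi> x + \<psi> x))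
         \<le> A g (\<lambda>x. g x + t j *\<^sub>R k x + l x)" by (rule euler_lagrange_nonneg(2)[OF h u sv v0])
      then have 4: "lam * (LINT x|M. u x powr (- \<delta>) * \<psi> x) + (LINT x|M. h x * \<psi> x) \<le> t j * E + A g l"
        unfolding 1 2 3 E_def using minimizer_scaling[OF h u] by (simp add: algebra_simps)
      have \<psi>0: "0 \<le> \<psi> x" for x by (simp add: \<psi>_def)
      have 5: "0 \<le> (LINT x|M. u x powr (- \<delta>) * \<psi> x)" using \<psi>0 by (intro integral_nonneg_AE AE_I2) simp
      obtain B where B: "0 \<le> B" "AE x in M. 0 \<le> h x \<and> h x \<le> B" by (rule source_bound[OF h])
      have 6: "0 \<le> (LINT x|M. h x * \<psi> x)"
        using B(2) by (intro integral_nonneg_AE) (auto elim!: eventually_mono simp: \<psi>0)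
      \<comment> \<open>On the set where \<open>u + t j * \<phi>\<close> is negative, l is minus the
        perturbed gradient. Its part along g contributes with a nonpositive sign and is dropped; the
        rest carries the factor \<open>t j\<close>.\<close>
      have 7: "A g l \<le> (LINT x|M. - t j * N j x)"
        unfolding A_def
      proof (rule integral_mono[OF ff(3)])
        show "integrable M (\<lambda>x. - t j * N j x)" using Ni[of j] by (rule integrable_mult_right)
        fix x
        have "0 \<le> pq_flux (g x) \<bullet> g x" using \<beta> by (simp add: pq_flux_inner flux_inner_self)
        then show "pq_flux (g x) \<bullet> l x \<le> - t j * N j x"
          by (auto simp: l_def N_def inner_add_right inner_diff_right)
      qed
      have "0 \<le> lam * (LINT x|M. u x powr (- \<delta>) * \<psi> x)" using 5 lam by simp
      then have "0 \<le> t j * E - t j * (LINT x|M. N j x)" using 4 6 7 by simp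
      then have "t j * (LINT x|M. N j x) \<le> t j * E" by simp
      then show ?thesis using t[of j] by simp
    qed
    have "(\<lambda>j. LINT x|M. N j x) \<longlonglongrightarrow> (LINT x|M. 0)"
    proof (rule integral_dominated_convergence[where w="\<lambda>x. norm (pq_flux (g x) \<bullet> k x)"])
      show "AE x in M. (\<lambda>j. N j x) \<longlonglongrightarrow> 0"
        using minimizer_pos[OF h u]
      proof (rule eventually_mono)
        fix x assume x: "0 < u x"
        have "(\<lambda>j. u x + t j * \<phi> x) \<longlonglongrightarrow> u x + 0 * \<phi> x"
          unfolding t_def by (intro tendsto_add tendsto_mult tendsto_const LIMSEQ_Suc[OF lim_1_over_n])
        then have "\<forall>\<^sub>F j in sequentially. 0 < u x + t j * \<phi> x" by (rule order_tendstoD(1)) (use x in simp)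
        then have "\<forall>\<^sub>F j in sequentially. N j x = 0" by (rule eventually_mono) (simp add: N_def)
        then show "(\<lambda>j. N j x) \<longlonglongrightarrow> 0" by (rule tendsto_eventually)
      qed
      show "integrable M (\<lambda>x. norm (pq_flux (g x) \<bullet> k x))" using integrable_pq_flux[OF LPs] by (rule integrable_norm)
      show "AE x in M. norm (N j x) \<le> norm (pq_flux (g x) \<bullet> k x)" for j by (auto simp: N_def)
    qed (use Nm in auto)
    then have "(\<lambda>j. LINT x|M. N j x) \<longlonglongrightarrow> 0" by simp
    then have "0 \<le> E" by (rule LIMSEQ_le_const2) (use le in blast)
    then show ?thesis by (simp add: E_def)
  qed
  show "integrable M (\<lambda>x. u x powr (- \<delta>) * \<phi> x)" by (rule int[OF \<phi>])
  \<comment> \<open>Testing with -\<phi> reverses the inequality.\<close>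
  have "A g (\<lambda>x. (-1) *\<^sub>R k x) = - A g k" by (simp add: A_def)
  then show "A g k = lam * (LINT x|M. u x powr (- \<delta>) * \<phi> x) + (LINT x|M. h x * \<phi> x)"
    using ge[OF \<phi>] ge[OF sob_cmult[OF \<phi>, of "-1"]] by simp
qed

section \<open>Comparison with supersolutions\<close>

text \<open>Lowering u to the minimum of u and w does not raise the energy: convex tangents at gw
  and the concave tangent at w bound the change, and the supersolution property with the excess as
  test function signs it. Uniqueness then says the minimum is u. Of w only the truncated excess must
  belong to the Sobolev space.\<close>

lemma comparison:
  assumes h: "source h" and u: "minimizer h u g"
    and gw: "gw \<in> LP p M" and w0: "AE x in M. 0 < w x"
    and tr: "sob (\<lambda>x. max 0 (u x - w x)) (\<lambda>x. if u x > w x then g x - gw x else 0)"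
    and super: "\<And>\<phi> k. sob \<phi> k \<Longrightarrow> AE x in M. 0 \<le> \<phi> x \<Longrightarrow> integrable M (\<lambda>x. w x powr (- \<delta>) * \<phi> x) \<and>
      lam * (LINT x|M. w x powr (- \<delta>) * \<phi> x) + (LINT x|M. h x * \<phi> x) \<le> A gw k"
  shows "AE x in M. u x \<le> w x"
proof -
  have cu: "admissible u g" and s: "sob u g" and u0: "AE x in M. 0 \<le> u x"
    using u by (auto simp: minimizer_def admissible_def)
  define \<psi> where "\<psi> x = max 0 (u x - w x)" for x
  define l where "l x = (if u x > w x then g x - gw x else 0)" for x
  have s\<psi>: "sob \<psi> l" using tr by (simp add: \<psi>_def[abs_def] l_def[abs_def])
  have \<psi>0: "AE x in M. 0 \<le> \<psi> x" by (simp add: \<psi>_def)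
  \<comment> \<open>This is the pointwise minimum of u and w; its gradient is gw where u > w and g
    elsewhere.\<close>
  define v where "v x = u x - \<psi> x" for x
  define gv where "gv x = g x - l x" for x
  have sv: "sob v gv" unfolding v_def gv_def by (rule sob_diff[OF s s\<psi>])
  have "AE x in M. 0 \<le> v x"
    using u0 w0 by (rule eventually_elim2) (auto simp: v_def \<psi>_def max_def)
  then have cv: "admissible v gv" using sv by (simp add: admissible_def)
  note sup = super[OF s\<psi> \<psi>0]
  have pq: "m * (LINT x|M. flux m (gw x) \<bullet> l x) \<le> pmass m M g - pmass m M gv" if m: "1 < m" "m \<le> p" for m
  proof -
    have LPm: "g \<in> LP m M" "gv \<in> LP m M" "gw \<in> LP m M" "l \<in> LP m M"
      using LP_le[OF finite_M _ m(2)] m sobD(2)[OF s] sobD(2)[OF sv] sobD(2)[OF s\<psi>] gw by auto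
    note i = LP_integrable_powr[OF LPm(1)] LP_integrable_powr[OF LPm(2)] LP_integrable_flux_inner[OF m(1) LPm(3,4)]
    have "m * (LINT x|M. flux m (gw x) \<bullet> l x) = (LINT x|M. m * (flux m (gw x) \<bullet> l x))" by simp
    also have "\<dots> \<le> (LINT x|M. norm (g x) powr m - norm (gv x) powr m)"
    proof (rule integral_mono)
      fix x
      show "m * (flux m (gw x) \<bullet> l x) \<le> norm (g x) powr m - norm (gv x) powr m"
        using flux_tangent[OF m(1), of "gw x" "g x"] by (auto simp: l_def gv_def)
    qed (use i in auto)
    also have "\<dots> = pmass m M g - pmass m M gv" using i by (simp add: pmass_def)
    finally show ?thesis .
  qed
  have P: "(LINT x|M. flux p (gw x) \<bullet> l x) \<le> pmass p M g / p - pmass p M gv / p"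
    using pq[OF p_gt_1 order_refl] p0 by (simp add: field_simps)
  have "(LINT x|M. flux q (gw x) \<bullet> l x) \<le> pmass q M g / q - pmass q M gv / q"
    using pq[OF q(1) q0(2)] q by (simp add: field_simps)
  then have "\<beta> * (LINT x|M. flux q (gw x) \<bullet> l x) \<le> \<beta> * (pmass q M g / q - pmass q M gv / q)"
    using \<beta> by (intro mult_left_mono) auto
  then have Q: "\<beta> * (LINT x|M. flux q (gw x) \<bullet> l x) \<le> \<beta> * (pmass q M g / q) - \<beta> * (pmass q M gv / q)"
    by (simp only: right_diff_distrib)
  have "(LINT x|M. u x powr (1 - \<delta>) - v x powr (1 - \<delta>)) \<le> (LINT x|M. (1 - \<delta>) * (w x powr (- \<delta>) * \<psi> x))"
  proof (rule integral_mono_AE)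
    show "AE x in M. u x powr (1 - \<delta>) - v x powr (1 - \<delta>) \<le> (1 - \<delta>) * (w x powr (- \<delta>) * \<psi> x)"
      using u0 w0
    proof (rule eventually_elim2)
      fix x assume x: "0 \<le> u x" "0 < w x"
      show "u x powr (1 - \<delta>) - v x powr (1 - \<delta>) \<le> (1 - \<delta>) * (w x powr (- \<delta>) * \<psi> x)"
        using powr_tangent_concave[of "1 - \<delta>" "w x" "u x"] \<delta> x
        by (cases "u x > w x") (auto simp: v_def \<psi>_def max_def algebra_simps)
    qed
  qed (use integrable_sing[OF s] integrable_sing[OF sv] sup in auto)
  then have "(LINT x|M. u x powr (1 - \<delta>)) - (LINT x|M. v x powr (1 - \<delta>)) \<le> (1 - \<delta>) * (LINT x|M. w x powr (- \<delta>) * \<psi> x)"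
    using integrable_sing[OF s] integrable_sing[OF sv] by simp
  then have "lam / (1 - \<delta>) * ((LINT x|M. u x powr (1 - \<delta>)) - (LINT x|M. v x powr (1 - \<delta>)))
      \<le> lam / (1 - \<delta>) * ((1 - \<delta>) * (LINT x|M. w x powr (- \<delta>) * \<psi> x))"
    using lam \<delta> by (intro mult_left_mono) auto
  also have "\<dots> = lam * (LINT x|M. w x powr (- \<delta>) * \<psi> x)" using \<delta> by simp
  finally have S: "lam / (1 - \<delta>) * (LINT x|M. u x powr (1 - \<delta>)) - lam / (1 - \<delta>) * (LINT x|M. v x powr (1 - \<delta>))
      \<le> lam * (LINT x|M. w x powr (- \<delta>) * \<psi> x)" by (simp only: right_diff_distrib)
  have H: "(LINT x|M. h x * v x) = (LINT x|M. h x * u x) - (LINT x|M. h x * \<psi> x)"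
    unfolding v_def right_diff_distrib using integrable_source[OF h s] integrable_source[OF h s\<psi>] by simp
  have "J h v gv \<le> J h u g"
    unfolding J_def H using P Q S sup[THEN conjunct2] unfolding A_split[OF gw sobD(2)[OF s\<psi>]] by linarith
  from minimizer_unique[OF h u cv this] show ?thesis
    by (rule eventually_mono) (auto simp: v_def \<psi>_def max_def split: if_splits)
qed

text \<open>The minimizer for the larger source is a supersolution for the smaller one.\<close>

lemma minimizer_mono:
  assumes h: "source h1" "source h2" and le: "AE x in M. h1 x \<le> h2 x"
    and u: "minimizer h1 u1 g1" "minimizer h2 u2 g2"
  shows "AE x in M. u1 x \<le> u2 x"
proof (rule comparison[OF h(1) u(1)])
  have s: "sob u1 g1" "sob u2 g2" using u by (auto simp: minimizer_def admissible_def)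
  show "g2 \<in> LP p M" by (rule sobD(2)[OF s(2)])
  show "AE x in M. 0 < u2 x" by (rule minimizer_pos[OF h(2) u(2)])
  show "sob (\<lambda>x. max 0 (u1 x - u2 x)) (\<lambda>x. if u2 x < u1 x then g1 x - g2 x else 0)"
    using sob_max_0[OF sob_diff[OF s]] by simp
  fix \<phi> k assume \<phi>: "sob \<phi> k" "AE x in M. 0 \<le> \<phi> x"
  have "(LINT x|M. h1 x * \<phi> x) \<le> (LINT x|M. h2 x * \<phi> x)"
  proof (rule integral_mono_AE[OF integrable_source[OF h(1) \<phi>(1)] integrable_source[OF h(2) \<phi>(1)]])
    show "AE x in M. h1 x * \<phi> x \<le> h2 x * \<phi> x"
      using le \<phi>(2) by (rule eventually_elim2) (rule mult_right_mono)
  qed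
  then show "integrable M (\<lambda>x. u2 x powr (- \<delta>) * \<phi> x) \<and>
      lam * (LINT x|M. u2 x powr (- \<delta>) * \<phi> x) + (LINT x|M. h1 x * \<phi> x) \<le> A g2 k"
    using euler_lagrange_nonneg[OF h(2) u(2) \<phi>] by simp
qed

end

section \<open>Barrier, monotone iteration, and the critical problem\<close>

text \<open>The derivative R of the arctangent solves R' = -2 t R^2, so regularity of R bootstraps
  through products.\<close>

lemma smooth_arctan: "smooth arctan"
proof -
  define R where "R t = inverse (1 + t\<^sup>2)" for t :: real
  have pos: "1 + t\<^sup>2 \<noteq> 0" for t :: real by (metis add_pos_nonneg less_irrefl zero_le_power2 zero_less_one)
  have R: "(R has_real_derivative (-2) * (t * (R t * R t))) (at t)" for t
    unfolding R_def[abs_def] using pos[of t]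
    by (auto intro!: derivative_eq_intros simp: power2_eq_square mult_ac)
  have CR: "Ck k R" for k
  proof (induction k)
    case 0
    show ?case using R by (auto intro!: continuous_at_imp_continuous_on DERIV_isCont)
  next
    case (Suc k)
    have "Ck k (\<lambda>t. (-2) * (t * (R t * R t)))"
      by (rule Ck_mult[OF Ck_const Ck_mult[OF Ck_ident Ck_mult[OF Suc Suc]]])
    with R show ?case by (rule Ck_has_real_derivativeI)
  qed
  have "Ck k arctan" for k
  proof (cases k)
    case 0
    show ?thesis unfolding 0 by (auto intro!: continuous_at_imp_continuous_on DERIV_isCont[OF DERIV_arctan])
  next
    case (Suc j)
    have "Ck (Suc j) arctan"
      by (rule Ck_has_real_derivativeI[where F'=R]) (use CR in \<open>auto simp: R_def[abs_def] intro!: derivative_eq_intros\<close>)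
    then show ?thesis unfolding Suc .
  qed
  then show ?thesis by (simp add: smooth_def)
qed

text \<open>For the function \<open>arctan (x \<bullet> e + c)\<close>, the \<open>m\<close>-Laplacian flux is \<open>(1 + \<theta>\<^sup>2)\<^sup>1\<^sup>-\<^sup>m e\<close> with
  \<open>\<theta> = x \<bullet> e + c\<close>; \<open>fluxdiv\<close> is minus its divergence.\<close>

definition fluxdiv :: "real \<Rightarrow> real \<Rightarrow> real" where
  "fluxdiv m t = (m - 1) * (2 * t * (1 + t\<^sup>2) powr (- m))"

lemma one_add_power2_ge_1: "1 \<le> 1 + (t::real)\<^sup>2"
  by simp

lemma fluxdiv_deriv:
  "((\<lambda>t. (1 + t\<^sup>2) powr (1 - m)) has_real_derivative - fluxdiv m t) (at t)"
proof -
  have pos: "0 < 1 + t\<^sup>2" using one_add_power2_ge_1[of t] by linarith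
  have "((\<lambda>t. (1 + t\<^sup>2) powr (1 - m)) has_real_derivative (1 - m) * (1 + t\<^sup>2) powr ((1 - m) - 1) * (2 * t)) (at t)"
    by (rule DERIV_chain2[where f="\<lambda>z. z powr (1 - m)" and g="\<lambda>t. 1 + t\<^sup>2", OF has_real_derivative_powr[OF pos]])
      (auto intro!: derivative_eq_intros)
  then show ?thesis by (simp add: fluxdiv_def algebra_simps)
qed

lemma continuous_fluxdiv: "continuous_on UNIV (fluxdiv m)"
proof -
  have "1 + t\<^sup>2 \<noteq> 0" for t :: real using one_add_power2_ge_1[of t] by linarith
  then show ?thesis unfolding fluxdiv_def[abs_def] by (intro continuous_intros) auto
qed

text \<open>From 2|t| \<le> 1 + t^2. Boundedness on the whole line makes the product with any
  Sobolev function integrable and stable under L^p limits.\<close>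

lemma abs_fluxdiv_le:
  assumes "1 < m"
  shows "\<bar>fluxdiv m t\<bar> \<le> m - 1"
proof -
  have "0 \<le> (1 - \<bar>t\<bar>)\<^sup>2" by simp
  then have "2 * \<bar>t\<bar> \<le> 1 + t\<^sup>2" by (simp add: power2_diff)
  then have "2 * \<bar>t\<bar> * (1 + t\<^sup>2) powr (- m) \<le> (1 + t\<^sup>2) * (1 + t\<^sup>2) powr (- m)"
    by (rule mult_right_mono) simp
  also have "\<dots> = (1 + t\<^sup>2) powr (1 - m)" using powr_mult_base[of "1 + t\<^sup>2" "- m"] by simp
  also have "\<dots> \<le> (1 + t\<^sup>2) powr 0" using assms by (intro powr_mono) auto
  also have "\<dots> \<le> 1" by simp
  finally have "(m - 1) * (2 * \<bar>t\<bar> * (1 + t\<^sup>2) powr (- m)) \<le> (m - 1) * 1"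
    using assms by (intro mult_left_mono) auto
  then show ?thesis using assms by (simp add: fluxdiv_def abs_mult)
qed

lemma fluxdiv_ge:
  assumes "1 < m" "1 \<le> t" "t \<le> K"
  shows "(m - 1) * (2 * (1 + K\<^sup>2) powr (- m)) \<le> fluxdiv m t"
proof -
  have "1 + t\<^sup>2 \<le> 1 + K\<^sup>2" using assms by (simp add: power_mono)
  then have "(1 + K\<^sup>2) powr (- m) \<le> (1 + t\<^sup>2) powr (- m)"
    using assms less_le_trans[OF zero_less_one one_add_power2_ge_1[of t]] by (intro powr_mono2') auto
  then have "(1 + K\<^sup>2) powr (- m) * 1 \<le> (1 + t\<^sup>2) powr (- m) * t"
    using assms by (intro mult_mono) auto
  then show ?thesis unfolding fluxdiv_def using assms
    by (intro mult_left_mono) (auto simp: mult.commute)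
qed

context energy begin

lemma smooth_barrier: "smooth (\<lambda>x::'a. a * (2 + arctan (x \<bullet> e + c)))"
  by (rule smooth_mult[OF smooth_const smooth_add[OF smooth_const
        smooth_compose[OF smooth_arctan smooth_add[OF smooth_inner_left smooth_const]]]])

lemma grad_barrier:
  "grad (\<lambda>x. a * (2 + arctan (x \<bullet> e + c))) x = (a * inverse (1 + (x \<bullet> e + c)\<^sup>2)) *\<^sub>R e"
proof (rule grad_eqI)
  have "(\<lambda>v. a * (v \<bullet> e * inverse (1 + (x \<bullet> e + c)\<^sup>2))) = (\<bullet>) ((a * inverse (1 + (x \<bullet> e + c)\<^sup>2)) *\<^sub>R e)"
    by (auto simp: inner_commute)
  moreover have "((\<lambda>x. a * (2 + arctan (x \<bullet> e + c))) has_derivative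
      (\<lambda>v. a * (v \<bullet> e * inverse (1 + (x \<bullet> e + c)\<^sup>2)))) (at x)"
  proof -
    have 1: "((\<lambda>x. x \<bullet> e + c) has_derivative (\<lambda>v. v \<bullet> e)) (at x)" by (auto intro!: derivative_eq_intros)
    have "((\<lambda>x. arctan (x \<bullet> e + c)) has_derivative (\<lambda>v. (v \<bullet> e) * inverse (1 + (x \<bullet> e + c)\<^sup>2))) (at x)"
      using has_derivative_compose[OF 1 DERIV_arctan[unfolded has_field_derivative_def]] by (simp add: mult.commute)
    then show ?thesis by (auto intro!: derivative_eq_intros)
  qed
  ultimately show "((\<lambda>x. a * (2 + arctan (x \<bullet> e + c))) has_derivative
      (\<bullet>) ((a * inverse (1 + (x \<bullet> e + c)\<^sup>2)) *\<^sub>R e)) (at x)" by simp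
qed

lemma flux_barrier:
  assumes "norm e = 1" "0 < a"
  shows "flux m (grad (\<lambda>x. a * (2 + arctan (x \<bullet> e + c))) x) = (a powr (m - 1) * (1 + (x \<bullet> e + c)\<^sup>2) powr (1 - m)) *\<^sub>R e"
proof -
  have pos: "0 < 1 + (x \<bullet> e + c)\<^sup>2" using one_add_power2_ge_1[of "x \<bullet> e + c"] by linarith
  then have "inverse (1 + (x \<bullet> e + c)\<^sup>2) powr (m - 1) = (1 + (x \<bullet> e + c)\<^sup>2) powr (1 - m)"
    using powr_minus[of "1 + (x \<bullet> e + c)\<^sup>2" "m - 1"] by (simp add: inverse_powr)
  moreover have "flux m e = e" using assms by (simp add: flux_def)
  ultimately show ?thesis
    unfolding grad_barrier using assms pos by (subst flux_scaleR) (simp_all add: powr_mult)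
qed

text \<open>For test functions this is integration by parts. Both weights are bounded, so the
  identity extends to all of \<open>sob\<close> by approximation.\<close>

lemma fluxdiv_integral:
  assumes m: "1 < m" "m \<le> p" and e: "norm e = 1" and s: "sob \<phi> k"
  shows "integrable M (\<lambda>x. fluxdiv m (x \<bullet> e + c) * \<phi> x)"
    "integrable M (\<lambda>x. (1 + (x \<bullet> e + c)\<^sup>2) powr (1 - m) * (k x \<bullet> e))"
    "(LINT x|M. (1 + (x \<bullet> e + c)\<^sup>2) powr (1 - m) * (k x \<bullet> e)) = (LINT x|M. fluxdiv m (x \<bullet> e + c) * \<phi> x)"
proof -
  define z where "z x = (1 + (x \<bullet> e + c)\<^sup>2) powr (1 - m)" for x
  define z' where "z' x = - fluxdiv m (x \<bullet> e + c) *\<^sub>R e" for x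
  have zd: "(z has_derivative (\<lambda>v. z' x \<bullet> v)) (at x)" for x
  proof -
    have 1: "((\<lambda>x. x \<bullet> e + c) has_derivative (\<lambda>v. v \<bullet> e)) (at x)" by (auto intro!: derivative_eq_intros)
    have "(\<lambda>v. - fluxdiv m (x \<bullet> e + c) * (v \<bullet> e)) = (\<lambda>v. z' x \<bullet> v)" by (auto simp: z'_def inner_commute)
    then show ?thesis unfolding z_def
      using has_derivative_compose[OF 1 fluxdiv_deriv[of m, unfolded has_field_derivative_def]] by simp
  qed
  have cz: "continuous_on UNIV z"
    by (intro continuous_at_imp_continuous_on ballI has_derivative_continuous[OF zd])
  have cd: "continuous_on UNIV (\<lambda>x. fluxdiv m (x \<bullet> e + c))"
    by (rule continuous_on_compose2[OF continuous_fluxdiv]) (auto intro!: continuous_intros)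
  have cz': "continuous_on UNIV z'" unfolding z'_def[abs_def] by (intro continuous_intros cd)
  have z1: "\<bar>z x\<bar> \<le> 1" for x
    using powr_mono[of "1 - m" 0 "1 + (x \<bullet> e + c)\<^sup>2"] m by (simp add: z_def split: if_splits)
  have ii: "integrable M (\<lambda>x. fluxdiv m (x \<bullet> e + c) * \<phi> x)" if s: "sob \<phi> k" for \<phi> k
  proof (rule Bochner_Integration.integrable_bound[OF integrable_mult_right[OF integrable_sob[OF s], of "m - 1"]])
    show "(\<lambda>x. fluxdiv m (x \<bullet> e + c) * \<phi> x) \<in> borel_measurable M"
      by (rule borel_measurable_times[OF continuous_measurable[OF cd] sob_measurable(1)[OF s]])
    show "AE x in M. norm (fluxdiv m (x \<bullet> e + c) * \<phi> x) \<le> norm ((m - 1) * \<phi> x)"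
      using abs_fluxdiv_le[OF m(1)] m by (auto simp: abs_mult intro!: mult_right_mono)
  qed
  have iz: "integrable M (\<lambda>x. z x * (k x \<bullet> e))" if "sob \<phi> k" for \<phi> k
  proof -
    have ki: "integrable M k" using LP_integrable[OF finite_M _ sobD(2)[OF that]] p_gt_1 by simp
    show ?thesis
    proof (rule Bochner_Integration.integrable_bound[OF ki])
      show "(\<lambda>x. z x * (k x \<bullet> e)) \<in> borel_measurable M"
        using continuous_measurable[OF cz] sob_measurable(2)[OF that] by measurable
      show "AE x in M. norm (z x * (k x \<bullet> e)) \<le> norm (k x)"
      proof (rule AE_I2)
        fix x
        have "\<bar>z x\<bar> * \<bar>k x \<bullet> e\<bar> \<le> 1 * norm (k x)"
          using z1[of x] Cauchy_Schwarz_ineq2[of "k x" e] e by (intro mult_mono) auto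
        then show "norm (z x * (k x \<bullet> e)) \<le> norm (k x)" by (simp add: abs_mult)
      qed
    qed
  qed
  show "integrable M (\<lambda>x. fluxdiv m (x \<bullet> e + c) * \<phi> x)" by (rule ii[OF s])
  show "integrable M (\<lambda>x. (1 + (x \<bullet> e + c)\<^sup>2) powr (1 - m) * (k x \<bullet> e))" using iz[OF s] by (simp add: z_def)
  obtain \<psi> where \<psi>: "\<And>j. test_function \<Omega> (\<psi> j)"
    "(\<lambda>j. pmass p M (\<lambda>x. \<psi> j x - \<phi> x)) \<longlonglongrightarrow> 0" "(\<lambda>j. pmass p M (\<lambda>x. grad (\<psi> j) x - k x)) \<longlonglongrightarrow> 0"
    using sob_seq[OF s] by blast
  have st: "sob (\<psi> j) (grad (\<psi> j))" for j by (intro sob_test \<psi>)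
  have l1: "(\<lambda>j. LINT x|M. z x * (grad (\<psi> j) x \<bullet> e)) \<longlonglongrightarrow> (LINT x|M. z x * (k x \<bullet> e))"
  proof (rule LP_tendsto_integral[OF finite_M p_gt_1 sobD(2)[OF st] sobD(2)[OF s] \<psi>(3) iz[OF st] iz[OF s] _ zero_le_one])
    fix j
    show "AE x in M. norm (z x * (grad (\<psi> j) x \<bullet> e) - z x * (k x \<bullet> e)) \<le> 1 * norm (grad (\<psi> j) x - k x)"
    proof (rule AE_I2)
      fix x
      have "\<bar>z x\<bar> * \<bar>(grad (\<psi> j) x - k x) \<bullet> e\<bar> \<le> 1 * norm (grad (\<psi> j) x - k x)"
        using z1[of x] Cauchy_Schwarz_ineq2[of "grad (\<psi> j) x - k x" e] e by (intro mult_mono) auto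
      then show "norm (z x * (grad (\<psi> j) x \<bullet> e) - z x * (k x \<bullet> e)) \<le> 1 * norm (grad (\<psi> j) x - k x)"
        by (simp add: inner_diff_left right_diff_distrib flip: abs_mult)
    qed
  qed
  have l2: "(\<lambda>j. LINT x|M. fluxdiv m (x \<bullet> e + c) * \<psi> j x) \<longlonglongrightarrow> (LINT x|M. fluxdiv m (x \<bullet> e + c) * \<phi> x)"
  proof (rule LP_tendsto_integral[OF finite_M p_gt_1 sobD(1)[OF st] sobD(1)[OF s] \<psi>(2) ii[OF st] ii[OF s]])
    fix j
    show "AE x in M. norm (fluxdiv m (x \<bullet> e + c) * \<psi> j x - fluxdiv m (x \<bullet> e + c) * \<phi> x) \<le> (m - 1) * norm (\<psi> j x - \<phi> x)"
      using abs_fluxdiv_le[OF m(1)] by (auto simp: abs_mult simp flip: right_diff_distrib intro!: mult_right_mono)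
  qed (use m in simp)
  have ee: "e \<bullet> e = 1" using e by (simp add: norm_eq_1)
  have "(LINT x|M. z x * (grad (\<psi> j) x \<bullet> e)) = (LINT x|M. fluxdiv m (x \<bullet> e + c) * \<psi> j x)" for j
    unfolding test_function_integral_by_parts(3)[OF open_dom \<psi>(1) zd cz'] by (simp add: z'_def ee mult.commute)
  with l1 have "(\<lambda>j. LINT x|M. fluxdiv m (x \<bullet> e + c) * \<psi> j x) \<longlonglongrightarrow> (LINT x|M. z x * (k x \<bullet> e))" by simp
  then have "(LINT x|M. z x * (k x \<bullet> e)) = (LINT x|M. fluxdiv m (x \<bullet> e + c) * \<phi> x)"
    using l2 by (rule LIMSEQ_unique)
  then show "(LINT x|M. (1 + (x \<bullet> e + c)\<^sup>2) powr (1 - m) * (k x \<bullet> e)) = (LINT x|M. fluxdiv m (x \<bullet> e + c) * \<phi> x)"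
    by (simp add: z_def)
qed

text \<open>On the domain w lies between a and 4a. The lower bound caps the singular term by
  \<open>lam * a powr (- \<delta>)\<close>, and \<open>small\<close> compares the whole right-hand
  side with the least value of -\<Delta>_p w given by \<open>fluxdiv_ge\<close>. The q-part has the
  favourable sign for every \<beta>, so w is a supersolution.\<close>

lemma minimizer_le_barrier:
  assumes e: "norm e = 1" and a: "0 < a" and dom: "\<And>x. x \<in> \<Omega> \<Longrightarrow> 1 \<le> x \<bullet> e + c \<and> x \<bullet> e + c \<le> K"
    and small: "lam * a powr (- \<delta>) + b \<le> a powr (p - 1) * ((p - 1) * (2 * (1 + K\<^sup>2) powr (- p)))"
    and h: "source h" and hb: "AE x in M. h x \<le> b" and u: "minimizer h u g"
  shows "AE x in M. u x \<le> 4 * a"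
proof -
  define w where "w x = a * (2 + arctan (x \<bullet> e + c))" for x :: 'a
  \<comment> \<open>Since pi < 4, the factor 2 + arctan stays between 0 and 4 everywhere;
    \<open>sob_truncate\<close> asks for a nonnegative w on the whole space, not only on the
    domain.\<close>
  have at: "-2 < arctan t" "arctan t < 2" for t using arctan_bounded[of t] pi_less_4 by auto
  have w: "0 < w x" "w x \<le> 4 * a" for x
    using at[of "x \<bullet> e + c"] a by (auto simp: w_def)
  have wa: "a \<le> w x" if "x \<in> \<Omega>" for x
  proof -
    have "0 < arctan (x \<bullet> e + c)" using dom[OF that] by (simp add: zero_less_arctan_iff)
    then show ?thesis using a by (simp add: w_def distrib_left)
  qed
  have sw: "smooth w" unfolding w_def[abs_def] by (rule smooth_barrier)
  have gw: "grad w x = (a * inverse (1 + (x \<bullet> e + c)\<^sup>2)) *\<^sub>R e" for x unfolding w_def[abs_def] by (rule grad_barrier)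
  have fw: "flux m (grad w x) = (a powr (m - 1) * (1 + (x \<bullet> e + c)\<^sup>2) powr (1 - m)) *\<^sub>R e" for m x
    unfolding w_def[abs_def] by (rule flux_barrier[OF e a])
  have wLP: "w \<in> LP p M"
    by (rule LP_bounded[OF finite_M p0(1) smooth_measurable(1)[OF sw], of "4 * a"])
      (use w less_imp_le[OF w(1)] in auto)
  have gwLP: "grad w \<in> LP p M"
  proof (rule LP_bounded[OF finite_M p0(1) smooth_measurable(2)[OF sw], of a], rule AE_I2)
    fix x
    have "inverse (1 + (x \<bullet> e + c)\<^sup>2) \<le> 1" using one_add_power2_ge_1 by (rule inverse_le_1_iff[THEN iffD2, OF disjI2])
    moreover have "0 \<le> inverse (1 + (x \<bullet> e + c)\<^sup>2)" by simp
    ultimately show "norm (grad w x) \<le> a" using a e by (simp add: gw mult_le_cancel_left1 abs_mult mult_left_le)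
  qed
  have su: "sob u g" using u by (simp add: minimizer_def admissible_def)
  have "AE x in M. u x \<le> w x"
  proof (rule comparison[OF h u gwLP])
    show "AE x in M. 0 < w x" using w by simp
    show "sob (\<lambda>x. max 0 (u x - w x)) (\<lambda>x. if w x < u x then g x - grad w x else 0)"
      by (rule sob_truncate[OF su sw less_imp_le[OF w(1)] wLP gwLP])
    fix \<phi> k assume \<phi>: "sob \<phi> k" "AE x in M. 0 \<le> \<phi> x"
    note im = integrable_sob[OF \<phi>(1)]
    have m: "(\<lambda>x. w x powr (- \<delta>) * \<phi> x) \<in> borel_measurable M"
      using LP_measurable[OF wLP] sob_measurable(1)[OF \<phi>(1)] by measurable
    have wle: "w x powr (- \<delta>) \<le> a powr (- \<delta>)" if "x \<in> \<Omega>" for x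
      using wa[OF that] a \<delta> by (intro powr_mono2') auto
    have \<Omega>AE: "AE x in M. x \<in> \<Omega>" by (rule AE_I2) simp
    have i: "integrable M (\<lambda>x. w x powr (- \<delta>) * \<phi> x)"
    proof (rule Bochner_Integration.integrable_bound[OF integrable_mult_right[OF im, of "a powr (- \<delta>)"] m])
      show "AE x in M. norm (w x powr (- \<delta>) * \<phi> x) \<le> norm (a powr (- \<delta>) * \<phi> x)"
        using \<Omega>AE by (rule eventually_mono) (use wle in \<open>auto simp: abs_mult intro!: mult_right_mono\<close>)
    qed
    have ih: "integrable M (\<lambda>x. h x * \<phi> x)" by (rule integrable_source[OF h \<phi>(1)])
    define c0 where "c0 = (p - 1) * (2 * (1 + K\<^sup>2) powr (- p))"
    note dp = fluxdiv_integral[OF p_gt_1 order_refl e \<phi>(1), of c]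
    note dq = fluxdiv_integral[OF q(1) q0(2) e \<phi>(1), of c]
    have Ap: "(LINT x|M. flux p (grad w x) \<bullet> k x) = a powr (p - 1) * (LINT x|M. fluxdiv p (x \<bullet> e + c) * \<phi> x)"
      unfolding fw dp(3)[symmetric] by (simp add: inner_commute mult.assoc)
    have Aq: "(LINT x|M. flux q (grad w x) \<bullet> k x) = a powr (q - 1) * (LINT x|M. fluxdiv q (x \<bullet> e + c) * \<phi> x)"
      unfolding fw dq(3)[symmetric] by (simp add: inner_commute mult.assoc)
    have q_ge: "0 \<le> (LINT x|M. fluxdiv q (x \<bullet> e + c) * \<phi> x)"
    proof (rule integral_nonneg_AE)
      show "AE x in M. 0 \<le> fluxdiv q (x \<bullet> e + c) * \<phi> x"
        using \<Omega>AE \<phi>(2) by (rule eventually_elim2)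
          (use dom q in \<open>auto simp: fluxdiv_def intro!: mult_nonneg_nonneg dest!: dom\<close>)
    qed
    have "lam * (LINT x|M. w x powr (- \<delta>) * \<phi> x) + (LINT x|M. h x * \<phi> x)
        = (LINT x|M. lam * (w x powr (- \<delta>) * \<phi> x) + h x * \<phi> x)" using i ih by simp
    also have "\<dots> \<le> (LINT x|M. a powr (p - 1) * (fluxdiv p (x \<bullet> e + c) * \<phi> x))"
    proof (rule integral_mono_AE)
      have "AE x in M. x \<in> \<Omega> \<and> h x \<le> b" using \<Omega>AE hb by (rule eventually_elim2) simp
      then show "AE x in M. lam * (w x powr (- \<delta>) * \<phi> x) + h x * \<phi> x \<le> a powr (p - 1) * (fluxdiv p (x \<bullet> e + c) * \<phi> x)"
        using \<phi>(2)
      proof (rule eventually_elim2)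
        fix x assume x: "x \<in> \<Omega> \<and> h x \<le> b" "0 \<le> \<phi> x"
        have "lam * w x powr (- \<delta>) \<le> lam * a powr (- \<delta>)" using wle x lam by (intro mult_left_mono) auto
        then have "lam * w x powr (- \<delta>) + h x \<le> a powr (p - 1) * c0"
          using x small unfolding c0_def by linarith
        also have "\<dots> \<le> a powr (p - 1) * fluxdiv p (x \<bullet> e + c)"
          unfolding c0_def using dom x by (intro mult_left_mono fluxdiv_ge p_gt_1) auto
        finally have "(lam * w x powr (- \<delta>) + h x) * \<phi> x \<le> (a powr (p - 1) * fluxdiv p (x \<bullet> e + c)) * \<phi> x"
          using x(2) by (rule mult_right_mono)
        then show "lam * (w x powr (- \<delta>) * \<phi> x) + h x * \<phi> x \<le> a powr (p - 1) * (fluxdiv p (x \<bullet> e + c) * \<phi> x)"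
          by (simp add: algebra_simps)
      qed
    qed (use i ih dp(1) in auto)
    also have "\<dots> = (LINT x|M. flux p (grad w x) \<bullet> k x)" unfolding Ap by simp
    also have "\<dots> \<le> A (grad w) k"
      unfolding A_split[OF gwLP sobD(2)[OF \<phi>(1)]] Aq using q_ge \<beta> by simp
    finally show "integrable M (\<lambda>x. w x powr (- \<delta>) * \<phi> x) \<and>
      lam * (LINT x|M. w x powr (- \<delta>) * \<phi> x) + (LINT x|M. h x * \<phi> x) \<le> A (grad w) k" using i by blast
  qed
  then show ?thesis by (rule eventually_mono) (use w(2) order_trans in blast)
qed

section \<open>Monotone iteration\<close>

text \<open>The hypothesis on b makes the bound self-reproducing. The pointwise limit v of the
  increasing iterates defines a limiting source H; since the iterates nearly minimize
  \<open>J H\<close>, they converge to its minimizer V as well, whence V = v and the source is the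
  power of V itself.\<close>

lemma iteration_limit:
  assumes r: "1 < r" and b: "\<And>h u g. source h \<Longrightarrow> AE x in M. h x \<le> b powr (r - 1) \<Longrightarrow> minimizer h u g \<Longrightarrow> AE x in M. u x \<le> b"
    and b0: "0 \<le> b"
  shows "\<exists>V G. source (\<lambda>x. V x powr (r - 1)) \<and> minimizer (\<lambda>x. V x powr (r - 1)) V G"
proof -
  define U :: "nat \<Rightarrow> ('a \<Rightarrow> real) \<times> ('a \<Rightarrow> 'a)" where
    "U = rec_nat (\<lambda>_. 0, \<lambda>_. 0) (\<lambda>n ug. SOME vg. minimizer (\<lambda>x. fst ug x powr (r - 1)) (fst vg) (snd vg))"
  define u where "u n = fst (U n)" for n
  define g where "g n = snd (U n)" for n
  define h where "h n x = u n x powr (r - 1)" for n x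
  \<comment> \<open>The choice in U is meaningful only once \<open>h n\<close> is known to be a
    source, hence the conditional form, discharged in the induction below. Note the shift: stage
    \<open>Suc n\<close> minimizes with the source of stage n.\<close>
  have min_if: "minimizer (h n) (u (Suc n)) (g (Suc n))" if "source (h n)" for n
  proof -
    obtain v k where "minimizer (h n) v k" using minimizer_exists[OF \<open>source (h n)\<close>] by blast
    then have "minimizer (\<lambda>x. fst (U n) x powr (r - 1)) (fst (v, k)) (snd (v, k))"
      by (simp add: h_def[abs_def] u_def)
    from someI[of "\<lambda>vg. minimizer (\<lambda>x. fst (U n) x powr (r - 1)) (fst vg) (snd vg)", OF this]
    show ?thesis by (simp add: h_def[abs_def] u_def g_def U_def)
  qed
  have adm_u: "admissible (u n) (g n) \<and> (AE x in M. u n x \<le> b)" for n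
  proof (induction n)
    case 0
    show ?case using sob_zero b0 by (simp add: u_def g_def U_def admissible_def)
  next
    case (Suc n)
    have src: "source (h n)" and hb: "AE x in M. h n x \<le> b powr (r - 1)"
    proof -
      have "AE x in M. 0 \<le> u n x" "AE x in M. u n x \<le> b" using Suc by (auto simp: admissible_def)
      then have *: "AE x in M. 0 \<le> h n x \<and> h n x \<le> b powr (r - 1)"
        by (rule eventually_elim2) (use r in \<open>auto simp: h_def intro!: powr_mono2\<close>)
      moreover have "h n \<in> borel_measurable M"
      proof -
        have "u n \<in> borel_measurable M" using sob_measurable(1)[of "u n" "g n"] Suc by (simp add: admissible_def)
        then show ?thesis unfolding h_def[abs_def] by measurable
      qed
      ultimately show "source (h n)" by (auto simp: source_def)
      show "AE x in M. h n x \<le> b powr (r - 1)" using * by (rule eventually_mono) blast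
    qed
    have "minimizer (h n) (u (Suc n)) (g (Suc n))" by (rule min_if[OF src])
    then show ?case using b[OF src hb] by (simp add: minimizer_def)
  qed
  have s: "sob (u n) (g n)" and u0: "AE x in M. 0 \<le> u n x" and ub: "AE x in M. u n x \<le> b" for n
    using adm_u[of n] by (auto simp: admissible_def)
  note um = sob_measurable(1)[OF s]
  have src: "source (h n)" for n
  proof -
    have "AE x in M. 0 \<le> h n x \<and> h n x \<le> b powr (r - 1)"
      using u0[of n] ub[of n] by (rule eventually_elim2) (use r in \<open>auto simp: h_def intro!: powr_mono2\<close>)
    moreover have "h n \<in> borel_measurable M" using um[of n] unfolding h_def[abs_def] by measurable
    ultimately show ?thesis by (auto simp: source_def)
  qed
  note min_u = min_if[OF src]
  have mono: "AE x in M. u n x \<le> u (Suc n) x" for n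
  proof (induction n)
    case 0
    show ?case using u0[of 1] by (rule eventually_mono) (simp add: u_def U_def)
  next
    case (Suc n)
    show ?case
    proof (rule minimizer_mono[OF src src _ min_u min_u])
      show "AE x in M. h n x \<le> h (Suc n) x"
        using Suc u0[of n] by (rule eventually_elim2) (use r in \<open>auto simp: h_def intro!: powr_mono2\<close>)
    qed
  qed
  have all: "AE x in M. \<forall>n. 0 \<le> u n x \<and> u n x \<le> b \<and> u n x \<le> u (Suc n) x"
    using u0 ub mono by (simp add: AE_all_countable AE_conj_iff)
  define v where "v x = lim (\<lambda>n. u n x)" for x
  have vm: "v \<in> borel_measurable M" unfolding v_def by (rule borel_measurable_lim_metric) (rule um)
  have vlim: "AE x in M. (\<lambda>n. u n x) \<longlonglongrightarrow> v x \<and> (\<forall>n. 0 \<le> u n x \<and> u n x \<le> v x \<and> v x \<le> b)"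
    using all
  proof (rule eventually_mono)
    fix x assume x: "\<forall>n. 0 \<le> u n x \<and> u n x \<le> b \<and> u n x \<le> u (Suc n) x"
    then have "incseq (\<lambda>n. u n x)" by (simp add: incseq_SucI)
    then obtain L where L: "(\<lambda>n. u n x) \<longlonglongrightarrow> L" "\<forall>n. u n x \<le> L"
      using incseq_convergent[of "\<lambda>n. u n x" b] x by blast
    then have "v x = L" unfolding v_def by (intro limI)
    moreover have "L \<le> b" by (rule LIMSEQ_le_const2[OF L(1)]) (use x in blast)
    ultimately show "(\<lambda>n. u n x) \<longlonglongrightarrow> v x \<and> (\<forall>n. 0 \<le> u n x \<and> u n x \<le> v x \<and> v x \<le> b)"
      using L x by blast
  qed
  define H where "H x = v x powr (r - 1)" for x
  have Hm: "H \<in> borel_measurable M" unfolding H_def[abs_def] using vm by measurable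
  have Hb: "AE x in M. (\<lambda>n. h n x) \<longlonglongrightarrow> H x \<and> (\<forall>n. 0 \<le> h n x \<and> h n x \<le> H x \<and> H x \<le> b powr (r - 1))"
    using vlim
  proof (rule eventually_mono)
    fix x assume x: "(\<lambda>n. u n x) \<longlonglongrightarrow> v x \<and> (\<forall>n. 0 \<le> u n x \<and> u n x \<le> v x \<and> v x \<le> b)"
    then have "0 \<le> v x" by (meson order_trans)
    have "(\<lambda>n. h n x) \<longlonglongrightarrow> H x"
      unfolding h_def H_def using x r by (intro tendsto_powr') auto
    moreover have "\<forall>n. 0 \<le> h n x \<and> h n x \<le> H x \<and> H x \<le> b powr (r - 1)"
      unfolding h_def H_def using x r \<open>0 \<le> v x\<close> by (auto intro!: powr_mono2)
    ultimately show "(\<lambda>n. h n x) \<longlonglongrightarrow> H x \<and> (\<forall>n. 0 \<le> h n x \<and> h n x \<le> H x \<and> H x \<le> b powr (r - 1))" by blast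
  qed
  have srcH: "source H" unfolding source_def
  proof (intro conjI Hm exI)
    show "AE x in M. 0 \<le> H x \<and> H x \<le> b powr (r - 1)"
      using Hb by (rule eventually_mono) (auto simp: H_def)
  qed
  obtain V G where V: "minimizer H V G" using minimizer_exists[OF srcH] by blast
  have cV: "admissible V G" and sV: "sob V G" and V0: "AE x in M. 0 \<le> V x" using V by (auto simp: minimizer_def admissible_def)
  have mV: "J H V G \<le> J H z l" if "admissible z l" for z l using V that by (simp add: minimizer_def)
  have iV: "integrable M (\<lambda>x. h n x * V x)" "integrable M (\<lambda>x. H x * V x)" for n
    by (intro integrable_source[OF src sV] integrable_source[OF srcH sV])+
  \<comment> \<open>Changing the source from \<open>h n\<close> to H costs the difference of the
    source terms at V, while at the iterate the change only lowers the energy because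
    \<open>h n \<le> H\<close>. The cost tends to 0 by dominated convergence.\<close>
  have Jle: "J H (u (Suc n)) (g (Suc n)) \<le> J H V G + ((LINT x|M. H x * V x) - (LINT x|M. h n x * V x))" for n
  proof -
    have "J (h n) (u (Suc n)) (g (Suc n)) \<le> J (h n) V G" using min_u[of n] cV by (simp add: minimizer_def)
    moreover have "(LINT x|M. h n x * u (Suc n) x) \<le> (LINT x|M. H x * u (Suc n) x)"
    proof (rule integral_mono_AE[OF integrable_source[OF src s] integrable_source[OF srcH s]])
      show "AE x in M. h n x * u (Suc n) x \<le> H x * u (Suc n) x"
        using Hb u0[of "Suc n"] by (rule eventually_elim2) (auto intro!: mult_right_mono)
    qed
    ultimately show ?thesis unfolding J_def by linarith
  qed
  have "(\<lambda>n. LINT x|M. h n x * V x) \<longlonglongrightarrow> (LINT x|M. H x * V x)"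
  proof (rule integral_dominated_convergence[OF _ _ iV(2)])
    show "AE x in M. (\<lambda>n. h n x * V x) \<longlonglongrightarrow> H x * V x"
      using Hb by (rule eventually_mono) (intro tendsto_mult tendsto_const, blast)
    show "AE x in M. norm (h n x * V x) \<le> H x * V x" for n
      using Hb V0 by (rule eventually_elim2) (auto simp: abs_mult intro!: mult_right_mono)
  qed (use iV in auto)
  from tendsto_diff[OF tendsto_const[of "LINT x|M. H x * V x"] this]
  have gap: "(\<lambda>n. (LINT x|M. H x * V x) - (LINT x|M. h n x * V x)) \<longlonglongrightarrow> 0" by simp
  have conv: "(\<lambda>n. pmass p M (\<lambda>x. u (Suc n) x - V x)) \<longlonglongrightarrow> 0"
  proof (rule LIMSEQ_I)
    fix \<epsilon> :: real assume \<epsilon>: "0 < \<epsilon>"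
    have "\<exists>d>0. \<forall>u g v k. admissible u g \<and> admissible v k \<and> J H u g \<le> J H V G + d \<and> J H v k \<le> J H V G + d \<longrightarrow>
        pmass p M (\<lambda>x. g x - k x) < \<epsilon> \<and> pmass p M (\<lambda>x. u x - v x) < \<epsilon>"
      by (rule near_minimizers_close[OF srcH _ \<epsilon>]) (rule mV)
    then obtain d where d: "d > 0" "\<And>u g v k. admissible u g \<Longrightarrow> admissible v k \<Longrightarrow> J H u g \<le> J H V G + d \<Longrightarrow> J H v k \<le> J H V G + d \<Longrightarrow>
        pmass p M (\<lambda>x. u x - v x) < \<epsilon>" by blast
    obtain N where N: "\<And>n. n \<ge> N \<Longrightarrow> (LINT x|M. H x * V x) - (LINT x|M. h n x * V x) < d"
      using order_tendstoD(2)[OF gap d(1)] unfolding eventually_sequentially by blast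
    have "pmass p M (\<lambda>x. u (Suc n) x - V x) < \<epsilon>" if "n \<ge> N" for n
      by (rule d(2)[OF conjunct1[OF adm_u[of "Suc n"]] cV]) (use Jle[of n] N[OF that] d(1) in linarith)+
    then show "\<exists>n0. \<forall>n\<ge>n0. norm (pmass p M (\<lambda>x. u (Suc n) x - V x) - 0) < \<epsilon>"
      by (intro exI[of _ N]) (simp add: pmass_nonneg)
  qed
  obtain \<rho> where \<rho>: "strict_mono \<rho>" "AE x in M. (\<lambda>n. u (Suc (\<rho> n)) x) \<longlonglongrightarrow> V x"
    by (rule LP_convergent_subsequence[OF p_gt_1 sobD(1)[OF s] sobD(1)[OF sV] conv]) blast
  have Vv: "AE x in M. V x = v x"
    using \<rho>(2) vlim
  proof (rule eventually_elim2)
    fix x assume x: "(\<lambda>n. u (Suc (\<rho> n)) x) \<longlonglongrightarrow> V x" "(\<lambda>n. u n x) \<longlonglongrightarrow> v x \<and> (\<forall>n. 0 \<le> u n x \<and> u n x \<le> v x \<and> v x \<le> b)"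
    have "strict_mono (\<lambda>n. Suc (\<rho> n))" using \<rho>(1) by (simp add: strict_mono_def)
    from LIMSEQ_subseq_LIMSEQ[OF conjunct1[OF x(2)] this]
    have "(\<lambda>n. u (Suc (\<rho> n)) x) \<longlonglongrightarrow> v x" by (simp add: o_def)
    then show "V x = v x" using x(1) LIMSEQ_unique by blast
  qed
  have Vm: "V \<in> borel_measurable M" by (rule sob_measurable(1)[OF sV])
  have HV: "AE x in M. H x = V x powr (r - 1)" using Vv by (rule eventually_mono) (simp add: H_def)
  have srcV: "source (\<lambda>x. V x powr (r - 1))"
    unfolding source_def
  proof (intro conjI exI)
    show "AE x in M. 0 \<le> V x powr (r - 1) \<and> V x powr (r - 1) \<le> b powr (r - 1)"
      using Hb HV by (rule eventually_elim2) auto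
    show "(\<lambda>x. V x powr (r - 1)) \<in> borel_measurable M" using Vm by measurable
  qed
  \<comment> \<open>H is the power of v, which agrees with V only almost everywhere; the functional
    cannot tell them apart.\<close>
  have "J (\<lambda>x. V x powr (r - 1)) z l = J H z l" if "sob z l" for z l
  proof -
    have "(LINT x|M. V x powr (r - 1) * z x) = (LINT x|M. H x * z x)"
      by (rule integral_cong_AE)
        (use sob_measurable(1)[OF that] Vm Hm HV in \<open>auto elim!: eventually_mono\<close>)
    then show ?thesis by (simp add: J_def)
  qed
  then have "minimizer (\<lambda>x. V x powr (r - 1)) V G" using V by (simp add: minimizer_def admissible_def)
  then show ?thesis using srcV by blast
qed

text \<open>The equation is known for the gradient g carried along, while
  \<open>weak_solution\<close> refers to the chosen \<open>weak_grad\<close>. Almost everywhere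
  equality transfers both integrability and value of the integral.\<close>

lemma minimizer_weak_solution:
  assumes h: "source (\<lambda>x. u x powr (r - 1))" and u: "minimizer (\<lambda>x. u x powr (r - 1)) u g"
  shows "weak_solution \<Omega> p q r \<delta> lam \<beta> u"
proof -
  have s: "sob u g" using u by (simp add: minimizer_def admissible_def)
  note W = sob_imp_W1p0[OF s]
  have wgm: "weak_grad \<Omega> u \<in> borel_measurable M"
    by (rule sob_measurable(2)[OF W1p0_imp_sob[OF W(1)]])
  show ?thesis unfolding weak_solution_def
  proof (intro conjI ballI W(1) minimizer_pos[OF h u])
    fix \<phi> assume "\<phi> \<in> W1p0 p \<Omega>"
    then have s\<phi>: "sob \<phi> (weak_grad \<Omega> \<phi>)" by (rule W1p0_imp_sob)
    define k where "k = weak_grad \<Omega> \<phi>"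
    have s\<phi>: "sob \<phi> k" using s\<phi> by (simp add: k_def)
    note el = euler_lagrange[OF h u s\<phi>]
    define F where "F f x = (flux p (f x) \<bullet> k x) + \<beta> * (flux q (f x) \<bullet> k x) - lam * u x powr (- \<delta>) * \<phi> x - u x powr (r - 1) * \<phi> x" for f x
    have Fg: "F g = (\<lambda>x. pq_flux (g x) \<bullet> k x - lam * (u x powr (- \<delta>) * \<phi> x) - u x powr (r - 1) * \<phi> x)"
      by (simp add: F_def[abs_def] pq_flux_inner mult.assoc)
    note i = integrable_pq_flux[OF sobD(2)[OF s] sobD(2)[OF s\<phi>]] el(1) integrable_source[OF h s\<phi>]
    have Fgi: "integrable M (F g)" unfolding Fg using i by auto
    have Fg0: "integral\<^sup>L M (F g) = 0" unfolding Fg using i el(2) by (simp add: A_def)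
    have Fm: "F f \<in> borel_measurable M" if "f \<in> borel_measurable M" for f
      unfolding F_def[abs_def] flux_def using that sob_measurable[OF s\<phi>] sob_measurable(1)[OF s] by measurable
    have AE: "AE x in M. F g x = F (weak_grad \<Omega> u) x"
      using W(2) by (rule eventually_mono) (simp add: F_def)
    have "has_bochner_integral M (F (weak_grad \<Omega> u)) 0"
      unfolding has_bochner_integral_iff
      using integrable_cong_AE[OF Fm[OF sob_measurable(2)[OF s]] Fm[OF wgm] AE] Fgi
        integral_cong_AE[OF Fm[OF sob_measurable(2)[OF s]] Fm[OF wgm] AE] Fg0 by simp
    then show "has_bochner_integral M
        (\<lambda>x. (norm (weak_grad \<Omega> u x) powr (p - 2) *\<^sub>R weak_grad \<Omega> u x) \<bullet> weak_grad \<Omega> \<phi> x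
           + \<beta> * ((norm (weak_grad \<Omega> u x) powr (q - 2) *\<^sub>R weak_grad \<Omega> u x) \<bullet> weak_grad \<Omega> \<phi> x)
           - lam * u x powr (- \<delta>) * \<phi> x - u x powr (r - 1) * \<phi> x) 0"
      unfolding F_def[abs_def] flux_def k_def .
  qed
qed

end

theorem theorem2p3:
  fixes \<Omega> :: "(real ^ 'n) set" and p q r \<delta> :: real
  assumes "bounded_smooth_domain \<Omega>"
    and "p < real CARD('n)"
    and "1 < q" and "q < p"
    and "r = critical_exponent CARD('n) p"
    and "0 < \<delta>" and "\<delta> < 1"
  shows "\<exists>\<Lambda>>0. \<forall>lam \<beta>. 0 < lam \<and> lam < \<Lambda> \<and> 0 < \<beta> \<longrightarrow> (\<exists>u. weak_solution \<Omega> p q r \<delta> lam \<beta> u)"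
proof -
  have op: "open \<Omega>" and bd: "bounded \<Omega>" using assms(1) by (auto simp: bounded_smooth_domain_def)
  have p: "1 < p" using assms by simp
  have rp: "p < r"
  proof -
    have n: "0 < real CARD('n) - p" using assms by simp
    have "p * (real CARD('n) - p) < real CARD('n) * p" using p by (simp add: algebra_simps)
    then show ?thesis using n assms(5) by (simp add: critical_exponent_def pos_less_divide_eq)
  qed
  obtain e :: "real ^ 'n" where "e \<in> Basis" by (metis SOME_Basis)
  then have e: "norm e = 1" by simp
  obtain R where R: "R > 0" "\<And>x. x \<in> \<Omega> \<Longrightarrow> norm x \<le> R" using bd unfolding bounded_pos by blast
  \<comment> \<open>The shift moves the argument of the arctangent into [1, 2R + 1] on the domain,
    where both flux divergences are positive and the one for p is bounded below by c0.\<close>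
  define c where "c = R + 1"
  define K where "K = 2 * R + 1"
  have dom: "1 \<le> x \<bullet> e + c \<and> x \<bullet> e + c \<le> K" if "x \<in> \<Omega>" for x
  proof -
    have "\<bar>x \<bullet> e\<bar> \<le> R" using Cauchy_Schwarz_ineq2[of x e] e R(2)[OF that] by simp
    then show ?thesis by (auto simp: c_def K_def abs_le_iff)
  qed
  define c0 where "c0 = (p - 1) * (2 * (1 + K\<^sup>2) powr (- p))"
  have "1 + K\<^sup>2 \<noteq> 0" using one_add_power2_ge_1[of K] by linarith
  then have c0: "0 < c0" using p by (simp add: c0_def)
  \<comment> \<open>Solves \<open>(4 * a) powr (r - 1) = a powr (p - 1) * (c0 / 2)\<close>, which is
    possible because r > p: the critical power uses exactly half of what the barrier
    provides.\<close>
  define a where "a = (c0 / (2 * 4 powr (r - 1))) powr (1 / (r - p))"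
  have a: "0 < a" using c0 by (simp add: a_def)
  have "a powr (r - p) = c0 / (2 * 4 powr (r - 1))" using rp c0 by (simp add: a_def powr_powr)
  then have ar: "4 powr (r - 1) * a powr (r - p) = c0 / 2" by simp
  have "(4 * a) powr (r - 1) = 4 powr (r - 1) * (a powr (p - 1) * a powr (r - p))"
    unfolding powr_mult powr_add[symmetric] by simp
  also have "\<dots> = a powr (p - 1) * (4 powr (r - 1) * a powr (r - p))" by simp
  finally have b: "(4 * a) powr (r - 1) = a powr (p - 1) * (c0 / 2)" unfolding ar .
  \<comment> \<open>The threshold at which \<open>lam * a powr (- \<delta>)\<close> would use up the
    other half; neither \<open>a\<close> nor \<open>c0\<close> involves \<beta>.\<close>
  define \<Lambda> where "\<Lambda> = a powr \<delta> * (a powr (p - 1) * (c0 / 2))"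
  have "\<exists>u. weak_solution \<Omega> p q r \<delta> lam \<beta> u" if l: "0 < lam" "lam < \<Lambda>" "0 < \<beta>" for lam \<beta>
  proof -
    interpret energy \<Omega> p q \<beta> lam \<delta>
      by unfold_locales (use op bd p assms l in auto)
    have "lam * a powr (- \<delta>) \<le> \<Lambda> * a powr (- \<delta>)" using l by (intro mult_right_mono) auto
    also have "\<dots> = (a powr \<delta> * a powr (- \<delta>)) * (a powr (p - 1) * (c0 / 2))" by (simp add: \<Lambda>_def)
    also have "a powr \<delta> * a powr (- \<delta>) = 1" using a unfolding powr_add[symmetric] by simp
    finally have small: "lam * a powr (- \<delta>) + (4 * a) powr (r - 1)
        \<le> a powr (p - 1) * ((p - 1) * (2 * (1 + K\<^sup>2) powr (- p)))" unfolding b c0_def[symmetric] by simp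
    have "AE x in M. u x \<le> 4 * a"
      if "source h" "AE x in M. h x \<le> (4 * a) powr (r - 1)" "minimizer h u g" for h u g
      by (rule minimizer_le_barrier[OF e a dom small that])
    then obtain u g where "source (\<lambda>x. u x powr (r - 1))" "minimizer (\<lambda>x. u x powr (r - 1)) u g"
      using iteration_limit[of r "4 * a"] rp p a by auto
    then show ?thesis using minimizer_weak_solution by blast
  qed
  moreover have "\<Lambda> > 0" using a c0 by (simp add: \<Lambda>_def)
  ultimately show ?thesis by blast
qed

end
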